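(* Let $G$ be a finite group. Then the factorization graph $\mathfrak{F}(G)$ is a bipartite graph with no isolated vertex if and only if $G$ is isomorphic to one of the following groups: (1) $C_{p^m}$ or $C_{p^mq^n}$, where $p,q$ are distinct primes and $m,n\geqslant 0$ are integers; or (2) $\langle x,y : x^{p^m}=y^{q^n}=1,\ x^y=x^\lambda\rangle$, where $p,q$ are distinct primes, $m,n\geqslant1$ are integers, and $\lambda$ is an integer with $\mathrm{ord}_{p^m}\lambda=q$.
   Context: $\Phi(G)$ denotes the Frattini subgroup of $G$. The factorization graph $\mathfrak{F}(G)$ of a finite group $G$ is the simple undirected graph whose vertices are the proper subgroups $H$ of $G$ with $H\nsubseteq\Phi(G)$, two vertices $U,V$ being adjacent if $G=UV$. A graph with no vertices is regarded as bipartite (with no isolated vertex). $C_k$ is the cyclic group of order $k$, $x^y=y^{-1}xy$, and $\mathrm{ord}_{p^m}\lambda$ is the multiplicative order of $\lambda$ modulo $p^m$. *)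

theory Defs
  imports
    "HOL-Algebra.Algebra"
    "HOL-Number_Theory.Number_Theory"
    "Graph_Theory.Pair_Digraph"
begin

section \<open>The Frattini subgroup\<close>

definition proper_subgroup :: "'a set \<Rightarrow> ('a, 'b) monoid_scheme \<Rightarrow> bool" where
  "proper_subgroup H G \<longleftrightarrow> subgroup H G \<and> H \<noteq> carrier G"

definition maximal_subgroup :: "'a set \<Rightarrow> ('a, 'b) monoid_scheme \<Rightarrow> bool" where
  "maximal_subgroup M G \<longleftrightarrow>
     proper_subgroup M G \<and> (\<forall>H. proper_subgroup H G \<and> M \<subseteq> H \<longrightarrow> H = M)"

text \<open>If there is no maximal subgroup (for finite groups: if the group is trivial),
  the Frattini subgroup is the whole group.\<close>

definition frattini :: "('a, 'b) monoid_scheme \<Rightarrow> 'a set" where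
  "frattini G = carrier G \<inter> \<Inter> {M. maximal_subgroup M G}"


section \<open>The factorization graph\<close>

text \<open>As usual in Graph\_Theory, an undirected graph is a symmetric digraph; that the
  factorization graph is finite, loop-free and symmetric is proved below.\<close>

definition factorization_graph :: "('a, 'b) monoid_scheme \<Rightarrow> 'a set pair_pre_digraph" where
  "factorization_graph G =
     \<lparr> pverts = {H. proper_subgroup H G \<and> \<not> H \<subseteq> frattini G},
       parcs = {(U, V). proper_subgroup U G \<and> \<not> U \<subseteq> frattini G \<and>
                        proper_subgroup V G \<and> \<not> V \<subseteq> frattini G \<and>
                        carrier G = U <#>\<^bsub>G\<^esub> V} \<rparr>"

text \<open>The parts may be empty, so the graph without vertices is bipartite.\<close>

definition bipartite :: "'v pair_pre_digraph \<Rightarrow> bool" where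
  "bipartite \<Gamma> \<longleftrightarrow>
     (\<exists>A B. pverts \<Gamma> = A \<union> B \<and> A \<inter> B = {} \<and>
        (\<forall>(u, v) \<in> parcs \<Gamma>. u \<in> A \<and> v \<in> B \<or> u \<in> B \<and> v \<in> A))"

definition isolated_vertex :: "'v pair_pre_digraph \<Rightarrow> 'v \<Rightarrow> bool" where
  "isolated_vertex \<Gamma> u \<longleftrightarrow>
     u \<in> pverts \<Gamma> \<and> (\<forall>v. (u, v) \<notin> parcs \<Gamma> \<and> (v, u) \<notin> parcs \<Gamma>)"

lemma (in group) set_mult_proper_subgroup_self:
  assumes "proper_subgroup U G"
  shows "carrier G \<noteq> U <#> U"
proof -
  have "subgroup U G" "U \<noteq> carrier G"
    using assms unfolding proper_subgroup_def by blast+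
  then show ?thesis
    using subgroup_mult_id[of U] by metis
qed

lemma (in group) factorization_commute:
  assumes U: "subgroup U G" and V: "subgroup V G" and eq: "carrier G = U <#> V"
  shows "carrier G = V <#> U"
proof
  show "V <#> U \<subseteq> carrier G"
    using U V by (meson set_mult_closed subgroup.subset)
  show "carrier G \<subseteq> V <#> U"
  proof
    fix g assume g: "g \<in> carrier G"
    then have "inv g \<in> U <#> V"
      using eq inv_closed[OF g] by blast
    then obtain u v where uv: "u \<in> U" "v \<in> V" "inv g = u \<otimes> v"
      unfolding set_mult_def by auto
    have c: "u \<in> carrier G" "v \<in> carrier G"
      using uv U V by (auto dest: subgroup.mem_carrier)
    have "g = inv v \<otimes> inv u"
      using uv c g by (metis inv_inv inv_mult_group)
    then show "g \<in> V <#> U"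
      using uv U V unfolding set_mult_def by (auto intro: subgroup.m_inv_closed)
  qed
qed

lemma (in group) pair_graph_factorization_graph:
  assumes "finite (carrier G)"
  shows "pair_graph (factorization_graph G)"
proof -
  let ?V = "pverts (factorization_graph G)"
  have arc: "(U, V) \<in> parcs (factorization_graph G) \<longleftrightarrow>
      proper_subgroup U G \<and> \<not> U \<subseteq> frattini G \<and>
      proper_subgroup V G \<and> \<not> V \<subseteq> frattini G \<and> carrier G = U <#> V" for U V
    by (simp only: factorization_graph_def pair_pre_digraph.simps mem_Collect_eq case_prod_conv)
  have V: "?V \<subseteq> Pow (carrier G)"
    by (auto simp: factorization_graph_def proper_subgroup_def dest: subgroup.subset)
  have finV: "finite ?V"
    using V assms by (meson finite_Pow_iff finite_subset)
  have P: "parcs (factorization_graph G) \<subseteq> ?V \<times> ?V"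
    by (auto simp: factorization_graph_def)
  have finP: "finite (parcs (factorization_graph G))"
    using P finV by (meson finite_SigmaI finite_subset)
  have "sym (parcs (factorization_graph G))"
    using arc factorization_commute unfolding sym_def proper_subgroup_def by metis
  moreover have "u \<noteq> v" if "(u, v) \<in> parcs (factorization_graph G)" for u v
    using that arc set_mult_proper_subgroup_self by metis
  ultimately show ?thesis
    using finV finP P
    by unfold_locales (auto simp: symmetric_def)
qed


section \<open>Groups given by generators and relations\<close>

text \<open>Words in the generators (all elements of the type \<^typ>\<open>'g\<close>) and their formal inverses:
  the letter \<open>(g, True)\<close> stands for \<open>g\<close> and \<open>(g, False)\<close> for its inverse.\<close>

type_synonym 'g gword = "('g \<times> bool) list"

definition gen_word :: "'g \<Rightarrow> 'g gword" where
  "gen_word g = [(g, True)]"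

definition inv_word :: "'g gword \<Rightarrow> 'g gword" where
  "inv_word w = rev (map (\<lambda>(g, b). (g, \<not> b)) w)"

definition pow_word :: "'g gword \<Rightarrow> int \<Rightarrow> 'g gword" where
  "pow_word w k =
     (if 0 \<le> k then concat (replicate (nat k) w)
      else concat (replicate (nat (- k)) (inv_word w)))"

text \<open>The least congruence on words which contains the relations \<open>u = v\<close> for \<open>(u, v) \<in> R\<close>
  and the cancellation of mutually inverse letters. For \<open>R = {}\<close> the quotient is the free
  group; in general it is the quotient of the free group by the normal closure of the
  elements \<open>u v\<^sup>-\<^sup>1\<close>.\<close>

inductive word_eq :: "('g gword \<times> 'g gword) set \<Rightarrow> 'g gword \<Rightarrow> 'g gword \<Rightarrow> bool"
  for R :: "('g gword \<times> 'g gword) set" where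
  rel: "(u, v) \<in> R \<Longrightarrow> word_eq R u v"
| cancel: "word_eq R [(g, b), (g, \<not> b)] []"
| refl: "word_eq R u u"
| sym: "word_eq R u v \<Longrightarrow> word_eq R v u"
| trans: "word_eq R u v \<Longrightarrow> word_eq R v w \<Longrightarrow> word_eq R u w"
| append: "word_eq R u u' \<Longrightarrow> word_eq R v v' \<Longrightarrow> word_eq R (u @ v) (u' @ v')"

definition word_class :: "('g gword \<times> 'g gword) set \<Rightarrow> 'g gword \<Rightarrow> 'g gword set" where
  "word_class R u = {v. word_eq R u v}"

definition presented_group :: "('g gword \<times> 'g gword) set \<Rightarrow> 'g gword set monoid" where
  "presented_group R =
     \<lparr> carrier = range (word_class R),
       monoid.mult = (\<lambda>A B. \<Union>u\<in>A. \<Union>v\<in>B. word_class R (u @ v)),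
       one = word_class R [] \<rparr>"

lemma word_class_eq_iff: "word_class R u = word_class R v \<longleftrightarrow> word_eq R u v"
proof
  assume "word_class R u = word_class R v"
  then show "word_eq R u v"
    using word_eq.refl[of R v] by (auto simp: word_class_def)
next
  assume "word_eq R u v"
  then have "word_eq R u w \<longleftrightarrow> word_eq R v w" for w
    by (meson word_eq.sym word_eq.trans)
  then show "word_class R u = word_class R v"
    by (simp add: word_class_def)
qed

lemma mult_presented_group:
  "word_class R u \<otimes>\<^bsub>presented_group R\<^esub> word_class R v = word_class R (u @ v)"
proof -
  have "word_class R (u' @ v') = word_class R (u @ v)"
    if "u' \<in> word_class R u" "v' \<in> word_class R v" for u' v'
    using that unfolding word_class_eq_iff unfolding word_class_def mem_Collect_eq
    by (intro word_eq.append word_eq.sym[of R u] word_eq.sym[of R v])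
  moreover have "u \<in> word_class R u" "v \<in> word_class R v"
    by (auto simp: word_class_def intro: word_eq.refl)
  ultimately have "(\<Union>u'\<in>word_class R u. \<Union>v'\<in>word_class R v. word_class R (u' @ v')) =
      word_class R (u @ v)"
    by blast
  then show ?thesis
    by (simp add: presented_group_def)
qed

lemma word_eq_inv_word: "word_eq R (inv_word u @ u) []"
proof (induction u)
  case Nil
  show ?case by (simp add: inv_word_def word_eq.refl)
next
  case (Cons a u)
  obtain g b where a: "a = (g, b)" by fastforce
  have "word_eq R [(g, \<not> b), (g, b)] []"
    using word_eq.cancel[of R g "\<not> b"] by simp
  then have "word_eq R (inv_word u @ ([(g, \<not> b), (g, b)] @ u)) (inv_word u @ ([] @ u))"
    by (intro word_eq.append word_eq.refl)
  then have "word_eq R (inv_word (a # u) @ (a # u)) (inv_word u @ u)"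
    by (simp add: inv_word_def a)
  then show ?case
    using Cons.IH by (rule word_eq.trans)
qed

lemma group_presented_group: "group (presented_group R)"
proof (rule groupI)
  show "\<exists>y\<in>carrier (presented_group R). y \<otimes>\<^bsub>presented_group R\<^esub> x = \<one>\<^bsub>presented_group R\<^esub>"
    if "x \<in> carrier (presented_group R)" for x
  proof -
    obtain u where u: "x = word_class R u"
      using \<open>x \<in> carrier (presented_group R)\<close> by (auto simp: presented_group_def)
    have "word_class R (inv_word u) \<otimes>\<^bsub>presented_group R\<^esub> x = \<one>\<^bsub>presented_group R\<^esub>"
      unfolding u mult_presented_group
      using word_eq_inv_word by (simp add: presented_group_def word_class_eq_iff)
    then show ?thesis
      by (auto simp: presented_group_def)
  qed
next
  fix x y assume "x \<in> carrier (presented_group R)" "y \<in> carrier (presented_group R)"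
  then obtain u v where "x = word_class R u" "y = word_class R v"
    by (auto simp: presented_group_def)
  then show "x \<otimes>\<^bsub>presented_group R\<^esub> y \<in> carrier (presented_group R)"
    by (simp add: mult_presented_group) (simp add: presented_group_def)
next
  show "\<one>\<^bsub>presented_group R\<^esub> \<in> carrier (presented_group R)"
    by (simp add: presented_group_def)
next
  fix x y z
  assume "x \<in> carrier (presented_group R)" "y \<in> carrier (presented_group R)"
    "z \<in> carrier (presented_group R)"
  then obtain u v w where "x = word_class R u" "y = word_class R v" "z = word_class R w"
    by (auto simp: presented_group_def)
  then show "x \<otimes>\<^bsub>presented_group R\<^esub> y \<otimes>\<^bsub>presented_group R\<^esub> z =
      x \<otimes>\<^bsub>presented_group R\<^esub> (y \<otimes>\<^bsub>presented_group R\<^esub> z)"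
    by (simp add: mult_presented_group)
next
  fix x assume "x \<in> carrier (presented_group R)"
  then obtain u where "x = word_class R u"
    by (auto simp: presented_group_def)
  moreover have "\<one>\<^bsub>presented_group R\<^esub> = word_class R []"
    by (simp add: presented_group_def)
  ultimately show "\<one>\<^bsub>presented_group R\<^esub> \<otimes>\<^bsub>presented_group R\<^esub> x = x"
    by (simp add: mult_presented_group)
qed

datatype two_gens = Gen_x | Gen_y

definition metacyclic_presentation ::
    "nat \<Rightarrow> nat \<Rightarrow> int \<Rightarrow> two_gens gword set monoid" where
  "metacyclic_presentation a b l =
     (let x = gen_word Gen_x; y = gen_word Gen_y in
      presented_group
        {(pow_word x (int a), []),
         (pow_word y (int b), []),
         (inv_word y @ x @ y, pow_word x l)})"

end

theory Submission
  imports Defs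
begin

text \<open>
  Throughout, \<open>\<Phi>\<close> is the Frattini subgroup. Since \<open>\<Phi>\<close> consists of non-generators, two proper
  subgroups with product \<open>G\<close> are vertices of the factorization graph in any case
  (\<open>factorization_graph_adjacent_iff\<close>). Hence the graph condition has two simple consequences:
  every proper subgroup not inside \<open>\<Phi>\<close> has a proper supplement, and there is no triangle, that is,
  no three proper subgroups which pairwise factorize \<open>G\<close>. These already determine \<open>G\<close>.

  Supplements produce subgroups of prime index: an element \<open>x\<close> outside \<open>\<Phi>\<close> with \<open>x\<^sup>r \<in> \<Phi>\<close>
  has a maximal supplement of index \<open>r\<close> (\<open>maximal_supplement_of_prime_index\<close>). For the least prime \<open>q\<close>
  dividing \<open>|G : \<Phi>|\<close>, a subgroup \<open>M\<close> of index \<open>q\<close> is normal, hence adjacent to every other maximal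
  subgroup. If \<open>G\<close> is cyclic, three prime divisors of its order would give a triangle. Suppose that
  \<open>G\<close> is not cyclic. No group is the union of two proper subgroups, so a second normal maximal
  subgroup would form a triangle with \<open>M\<close> and a third maximal subgroup. Hence all maximal subgroups other than \<open>M\<close>
  are non-normal and pairwise non-adjacent, and this forces \<open>|G : \<Phi>| = p q\<close>
  (\<open>noncyclic_frattini_index\<close>).

  The passage from \<open>G / \<Phi>\<close> to \<open>G\<close> is pure group theory (\<open>metacyclic_lift\<close>). By the Frattini
  argument the Sylow \<open>p\<close>-subgroup \<open>P\<close> is normal; \<open>G = P\<langle>y\<rangle>\<close> for every \<open>q\<close>-element \<open>y\<close> outside \<open>M\<close>,
  and \<open>y\<^sup>q\<close> centralizes \<open>P\<close>. Some \<open>\<lambda>\<close> with \<open>\<lambda>\<^sup>q \<equiv> 1\<close> modulo \<open>p\<^sup>m\<close> describes the action of \<open>y\<close> on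
  \<open>P / (P \<inter> \<Phi>)\<close>, which has order \<open>p\<close>. Then \<open>u \<mapsto> y\<^sup>-\<^sup>1 u\<^sup>\<mu> y\<close>, with \<open>\<mu>\<close> inverse to \<open>\<lambda>\<close>, permutes a coset of
  \<open>P \<inter> \<Phi>\<close> with order dividing \<open>q\<close>. The size of the coset is a power of \<open>p\<close>, so there is a fixed
  point \<open>x\<close>. It satisfies \<open>x\<^sup>y = x\<^sup>\<lambda>\<close>, and together with \<open>y\<close> it generates \<open>G\<close> modulo \<open>\<Phi>\<close>, hence \<open>G\<close>.

  For the converse let \<open>G\<close> be generated by \<open>x\<close> and \<open>y\<close> of orders powers of \<open>p\<close> and \<open>q\<close> such that \<open>y\<close>
  normalizes \<open>\<langle>x\<rangle>\<close> and \<open>y\<^sup>q\<close> is central (\<open>metacyclic_factorization_graph\<close>). The vertices inside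
  \<open>N = \<langle>x\<rangle>\<langle>y\<^sup>q\<rangle>\<close> form one part of the graph and the remaining ones the other; a vertex inside
  \<open>N\<close> contains \<open>x\<close> and is adjacent to \<open>\<langle>y\<rangle>\<close>, and a vertex outside \<open>N\<close> is adjacent to \<open>\<langle>x\<rangle>\<close>. This
  covers the cyclic groups as well, and it applies to the presented groups without determining
  their order.
\<close>

section \<open>Counting in finite groups\<close>

locale finite_group = group G for G (structure) +
  assumes finite_carrier: "finite (carrier G)"
begin

lemma finite_subgroup: "subgroup H G \<Longrightarrow> finite H"
  by (meson finite_carrier finite_subset subgroup.subset)

lemma card_subgroup_pos: "subgroup H G \<Longrightarrow> 0 < card H"
  using finite_subgroup subgroup.one_closed card_gt_0_iff by fastforce

lemma card_subgroup_dvd: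
  assumes H: "subgroup H G" and K: "subgroup K G" and HK: "H \<subseteq> K"
  shows "card H dvd card K"
proof -
  interpret K: group "G\<lparr>carrier := K\<rparr>"
    by (rule subgroup_imp_group[OF K])
  have "subgroup H (G\<lparr>carrier := K\<rparr>)"
    using subgroup_incl[OF H K HK] .
  from K.lagrange[OF this] show ?thesis
    unfolding order_def by (auto intro: dvdI[of _ _ "card (rcosets\<^bsub>G\<lparr>carrier := K\<rparr>\<^esub> H)"] simp: mult.commute)
qed

text \<open>Choosing one factorization of each element \<open>z\<close> of \<open>H K\<close>, all others arise from it by
  shifting an element \<open>d \<in> H \<inter> K\<close> from one factor to the other.\<close>

lemma card_set_mult:
  assumes H: "subgroup H G" and K: "subgroup K G"
  shows "card (H <#> K) * card (H \<inter> K) = card H * card K"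
proof -
  define s where "s z = (SOME p. fst p \<in> H \<and> snd p \<in> K \<and> fst p \<otimes> snd p = z)" for z
  have s: "fst (s z) \<in> H \<and> snd (s z) \<in> K \<and> fst (s z) \<otimes> snd (s z) = z" if "z \<in> H <#> K" for z
    unfolding s_def
  proof (rule someI_ex)
    show "\<exists>p. fst p \<in> H \<and> snd p \<in> K \<and> fst p \<otimes> snd p = z"
      using that by (auto simp: set_mult_def)
  qed
  let ?f = "\<lambda>(z, d). (fst (s z) \<otimes> d, inv d \<otimes> snd (s z))"
  have Hc: "h \<in> carrier G" if "h \<in> H" for h using that H by (rule subgroup.mem_carrier[rotated])
  have Kc: "h \<in> carrier G" if "h \<in> K" for h using that K by (rule subgroup.mem_carrier[rotated])
  have "bij_betw ?f ((H <#> K) \<times> (H \<inter> K)) (H \<times> K)"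
    unfolding bij_betw_def
  proof
    have mult: "(fst (s z) \<otimes> d) \<otimes> (inv d \<otimes> snd (s z)) = z" if "z \<in> H <#> K" "d \<in> H" for z d
    proof -
      have c: "fst (s z) \<in> carrier G" "snd (s z) \<in> carrier G" "d \<in> carrier G"
        using s[OF that(1)] that(2) Hc Kc by auto
      then have "(fst (s z) \<otimes> d) \<otimes> (inv d \<otimes> snd (s z)) = fst (s z) \<otimes> snd (s z)"
        by (metis inv_closed l_inv m_assoc m_closed r_inv r_one)
      then show ?thesis using s[OF that(1)] by simp
    qed
    show "inj_on ?f ((H <#> K) \<times> (H \<inter> K))"
    proof (rule inj_onI, clarify)
      fix z d z' d'
      assume z: "z \<in> H <#> K" "z' \<in> H <#> K" "d \<in> H" "d' \<in> H"
        and e: "fst (s z) \<otimes> d = fst (s z') \<otimes> d'" "inv d \<otimes> snd (s z) = inv d' \<otimes> snd (s z')"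
      have zz: "z = z'" using mult[of z d] mult[of z' d'] z e by simp
      then have "fst (s z) \<otimes> d = fst (s z) \<otimes> d'" using e by simp
      then show "z = z' \<and> d = d'"
        using zz z s[OF z(1)] Hc by (simp add: l_cancel)
    qed
    show "?f ` ((H <#> K) \<times> (H \<inter> K)) = H \<times> K"
    proof
      show "?f ` ((H <#> K) \<times> (H \<inter> K)) \<subseteq> H \<times> K"
        using s H K by (auto intro: subgroup.m_closed subgroup.m_inv_closed)
      show "H \<times> K \<subseteq> ?f ` ((H <#> K) \<times> (H \<inter> K))"
      proof clarify
        fix h k assume hk: "h \<in> H" "k \<in> K"
        let ?z = "h \<otimes> k"
        have z: "?z \<in> H <#> K" using hk by (auto simp: set_mult_def)
        obtain a b where ab: "s ?z = (a, b)" by fastforce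
        have a: "a \<in> H" "b \<in> K" "a \<otimes> b = h \<otimes> k" using s[OF z] ab by auto
        define d where "d = inv a \<otimes> h"
        have dH: "d \<in> H" unfolding d_def using a hk H by (simp add: subgroup.m_closed subgroup.m_inv_closed)
        have d2: "d = b \<otimes> inv k"
          unfolding d_def using a hk Hc Kc
          by (metis inv_closed inv_solve_left inv_solve_right m_assoc m_closed)
        then have dK: "d \<in> K" using a hk K by (simp add: subgroup.m_closed subgroup.m_inv_closed)
        have "?f (?z, d) = (a \<otimes> d, inv d \<otimes> b)" using ab by simp
        moreover have "a \<otimes> d = h" unfolding d_def using a hk Hc
          by (simp add: m_assoc[symmetric])
        moreover have "inv d \<otimes> b = k" unfolding d2 using a hk Kc
          by (simp add: inv_mult_group m_assoc)
        ultimately show "(h, k) \<in> ?f ` ((H <#> K) \<times> (H \<inter> K))"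
          using z dH dK by (metis (no_types, lifting) IntI SigmaI image_eqI)
      qed
    qed
  qed
  from bij_betw_same_card[OF this] show ?thesis
    by (simp add: card_cartesian_product)
qed

lemma subgroup_eq_of_card_le:
  assumes "subgroup H G" "subgroup K G" "H \<subseteq> K" "card K \<le> card H" shows "H = K"
  using assms finite_subgroup card_seteq by metis

end

section \<open>Fixed points of actions of p-groups\<close>

lemma group_actionI:
  assumes "group H"
    and closed: "\<And>g x. g \<in> carrier H \<Longrightarrow> x \<in> E \<Longrightarrow> f g x \<in> E"
    and one: "\<And>x. x \<in> E \<Longrightarrow> f \<one>\<^bsub>H\<^esub> x = x"
    and mult: "\<And>g h x. g \<in> carrier H \<Longrightarrow> h \<in> carrier H \<Longrightarrow> x \<in> E \<Longrightarrow> f (g \<otimes>\<^bsub>H\<^esub> h) x = f g (f h x)"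
  shows "group_action H E (\<lambda>g. restrict (f g) E)"
proof -
  interpret H: group H by fact
  have bij: "restrict (f g) E \<in> Bij E" if g: "g \<in> carrier H" for g
  proof -
    have "bij_betw (f g) E E"
    proof (rule bij_betw_byWitness[where f' = "f (inv\<^bsub>H\<^esub> g)"])
      show "\<forall>a\<in>E. f (inv\<^bsub>H\<^esub> g) (f g a) = a" using mult[of "inv\<^bsub>H\<^esub> g" g] one g by simp
      show "\<forall>a\<in>E. f g (f (inv\<^bsub>H\<^esub> g) a) = a" using mult[of g "inv\<^bsub>H\<^esub> g"] one g by simp
      show "f g ` E \<subseteq> E" using closed g by auto
      show "f (inv\<^bsub>H\<^esub> g) ` E \<subseteq> E" using closed g by auto
    qed
    then show ?thesis unfolding Bij_def by (auto simp: bij_betw_def inj_on_def)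
  qed
  have "(\<lambda>g. restrict (f g) E) \<in> hom H (BijGroup E)"
  proof (rule homI)
    show "restrict (f g) E \<in> carrier (BijGroup E)" if "g \<in> carrier H" for g
      using bij[OF that] by (simp add: BijGroup_def)
    fix g h assume gh: "g \<in> carrier H" "h \<in> carrier H"
    have "restrict (f (g \<otimes>\<^bsub>H\<^esub> h)) E = compose E (restrict (f g) E) (restrict (f h) E)"
      using mult gh closed by (auto simp: compose_def restrict_def fun_eq_iff)
    then show "restrict (f (g \<otimes>\<^bsub>H\<^esub> h)) E = restrict (f g) E \<otimes>\<^bsub>BijGroup E\<^esub> restrict (f h) E"
      using bij gh by (simp add: BijGroup_def)
  qed
  then show ?thesis
    unfolding group_action_def group_hom_def group_hom_axioms_def
    using group_BijGroup H.group_axioms by blast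
qed

text \<open>The length of each orbit is a power of \<open>p\<close>. Without fixed points all lengths are divisible
  by \<open>p\<close>, and so is their sum.\<close>

lemma p_group_action_fixed_point:
  assumes act: "group_action H E \<phi>" and p: "Factorial_Ring.prime p"
    and ord: "order H = p ^ k" and fin: "finite E" and nd: "\<not> p dvd card E"
  shows "\<exists>x\<in>E. \<forall>h\<in>carrier H. \<phi> h x = x"
proof (rule ccontr)
  assume no: "\<not> ?thesis"
  interpret group_action H E \<phi> by fact
  have "p dvd card orb" if o: "orb \<in> orbits H E \<phi>" for orb
  proof -
    obtain x where x: "x \<in> E" "orb = orbit H \<phi> x" using o unfolding orbits_def by blast
    have "card orb dvd p ^ k"
      using orbit_stabilizer_theorem[OF x(1)] ord x(2) by (metis dvd_triv_left)
    then obtain i where i: "card orb = p ^ i" using p divides_primepow_nat by blast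
    have "card orb \<noteq> 1"
    proof
      assume "card orb = 1"
      then obtain z where z: "orb = {z}" using card_1_singletonE by blast
      then have "orb = {x}" using orbit_refl[OF x(1)] x(2) by simp
      then have "\<forall>h\<in>carrier H. \<phi> h x = x" using x(2) unfolding orbit_def by blast
      then show False using no x(1) by blast
    qed
    then show ?thesis using i by (cases i) auto
  qed
  moreover have "card E = (\<Sum>orb\<in>orbits H E \<phi>. card orb)"
    using disjoint_sum[OF fin, of "\<lambda>_. 1::nat"] by simp
  ultimately show False using nd by (simp add: dvd_sum)
qed

text \<open>The powers of \<open>f\<close> are an action of the cyclic group of order \<open>q\<close>.\<close>

lemma prime_order_map_fixed_point:
  assumes q: "Factorial_Ring.prime q" and fin: "finite C" and f: "\<And>x. x \<in> C \<Longrightarrow> f x \<in> C"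
    and fq: "\<And>x. x \<in> C \<Longrightarrow> (f ^^ q) x = x" and nd: "\<not> q dvd card C"
  shows "\<exists>x\<in>C. f x = x"
proof -
  have q1: "1 < q" using q prime_gt_1_nat by blast
  let ?Z = "integer_mod_group q"
  have closed: "(f ^^ k) x \<in> C" if "x \<in> C" for k x
    using that f by (induction k) auto
  have md: "(f ^^ (k mod q)) x = (f ^^ k) x" if "x \<in> C" for k x
  proof -
    have "(f ^^ (q * j)) x = x" for j
      using that fq by (induction j) (auto simp: funpow_add)
    then have "(f ^^ (k mod q + q * (k div q))) x = (f ^^ (k mod q)) x"
      by (subst funpow_add) simp
    then show ?thesis by (simp only: mod_mult_div_eq)
  qed
  have "group_action ?Z C (\<lambda>g. restrict (f ^^ nat g) C)"
  proof (rule group_actionI)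
    fix g h x assume g: "g \<in> carrier ?Z" "h \<in> carrier ?Z" and x: "x \<in> C"
    have gh: "0 \<le> g" "0 \<le> h" using g q1 by (auto simp: carrier_integer_mod_group)
    have "nat ((g + h) mod int q) = (nat g + nat h) mod q"
      using gh by (metis nat_add_distrib nat_int nat_mod_distrib of_nat_0_le_iff add_nonneg_nonneg)
    then show "(f ^^ nat (g \<otimes>\<^bsub>?Z\<^esub> h)) x = (f ^^ nat g) ((f ^^ nat h) x)"
      using md[OF x] by (simp add: funpow_add)
  qed (use closed in auto)
  moreover have "order ?Z = q ^ 1" using q1 by (simp add: order_def carrier_integer_mod_group)
  ultimately obtain x where x: "x \<in> C" "\<forall>h\<in>carrier ?Z. restrict (f ^^ nat h) C x = x"
    using p_group_action_fixed_point[OF _ q _ fin nd] by blast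
  have "1 \<in> carrier ?Z" using q1 by simp
  then have "restrict (f ^^ nat 1) C x = x" using x(2) by blast
  then show ?thesis using x(1) by (intro bexI[of _ x]) auto
qed

section \<open>Conjugates and powers\<close>

context group begin

abbreviation conj_set :: "'a \<Rightarrow> 'a set \<Rightarrow> 'a set" where
  "conj_set g H \<equiv> (\<lambda>h. g \<otimes> h \<otimes> inv g) ` H"

lemma conj_mult:
  "g \<in> carrier G \<Longrightarrow> a \<in> carrier G \<Longrightarrow> b \<in> carrier G \<Longrightarrow>
    g \<otimes> (a \<otimes> b) \<otimes> inv g = (g \<otimes> a \<otimes> inv g) \<otimes> (g \<otimes> b \<otimes> inv g)"
  by (metis inv_closed inv_solve_right m_assoc m_closed)

lemma conj_hom: "g \<in> carrier G \<Longrightarrow> group_hom G G (\<lambda>h. g \<otimes> h \<otimes> inv g)"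
  by (unfold_locales) (auto intro!: homI simp: conj_mult)

lemma conj_nat_pow:
  "g \<in> carrier G \<Longrightarrow> a \<in> carrier G \<Longrightarrow> g \<otimes> (a [^] (n::nat)) \<otimes> inv g = (g \<otimes> a \<otimes> inv g) [^] n"
  using group_hom.hom_nat_pow[OF conj_hom] by blast

lemma subgroup_conj_set:
  "g \<in> carrier G \<Longrightarrow> subgroup H G \<Longrightarrow> subgroup (conj_set g H) G"
  using group_hom.subgroup_img_is_subgroup[OF conj_hom] by blast

lemma card_conj_set:
  assumes "g \<in> carrier G" "H \<subseteq> carrier G"
  shows "card (conj_set g H) = card H"
proof (rule card_image)
  show "inj_on (\<lambda>h. g \<otimes> h \<otimes> inv g) H"
    using assms by (auto simp: inj_on_def subset_iff)
qed

lemma conj_set_conj_set: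
  assumes "x \<in> carrier G" "y \<in> carrier G" "H \<subseteq> carrier G"
  shows "conj_set x (conj_set y H) = conj_set (x \<otimes> y) H"
proof -
  have "x \<otimes> (y \<otimes> h \<otimes> inv y) \<otimes> inv x = x \<otimes> y \<otimes> h \<otimes> inv (x \<otimes> y)" if "h \<in> H" for h
    using assms that by (simp add: subset_iff m_assoc inv_mult_group)
  then show ?thesis by (auto simp: image_image)
qed

lemma conj_set_one: "H \<subseteq> carrier G \<Longrightarrow> conj_set \<one> H = H"
  by (auto simp: subset_iff image_iff)

lemma conj_set_self:
  assumes "subgroup H G" "x \<in> H" shows "conj_set x H = H"
proof
  show "conj_set x H \<subseteq> H" using assms by (auto intro: subgroup.m_closed subgroup.m_inv_closed)
  show "H \<subseteq> conj_set x H"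
  proof
    fix h assume h: "h \<in> H"
    have c: "x \<in> carrier G" "h \<in> carrier G" using assms h by (auto dest: subgroup.mem_carrier)
    have "h = x \<otimes> (inv x \<otimes> h \<otimes> x) \<otimes> inv x"
      using c by (simp add: m_assoc) (simp add: m_assoc[symmetric])
    moreover have "inv x \<otimes> h \<otimes> x \<in> H" using assms h by (simp add: subgroup.m_closed subgroup.m_inv_closed)
    ultimately show "h \<in> conj_set x H" by blast
  qed
qed

lemma subgroup_nat_pow_closed: "subgroup V G \<Longrightarrow> x \<in> V \<Longrightarrow> x [^] (n::nat) \<in> V"
  by (induction n) (auto intro: subgroup.m_closed subgroup.one_closed)

text \<open>By Bezout's identity \<open>x\<close> is a product of powers of \<open>x\<^sup>a\<close> and \<open>x\<^sup>b\<close>.\<close>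

lemma mem_of_coprime_powers:
  assumes V: "subgroup V G" and x: "x \<in> carrier G"
    and ab: "x [^] (a::nat) \<in> V" "x [^] (b::nat) \<in> V" and co: "coprime a b"
  shows "x \<in> V"
proof -
  obtain u v :: int where uv: "u * int a + v * int b = 1"
    using co bezout_int[of "int a" "int b"] by (metis coprime_int_iff coprime_imp_gcd_eq_1)
  have "x = x [^] (int a * u) \<otimes> x [^] (int b * v)"
    using x uv by (simp add: int_pow_mult[symmetric] mult.commute)
  also have "\<dots> = (x [^] a) [^] u \<otimes> (x [^] b) [^] v"
    using x by (simp add: int_pow_pow[symmetric] int_pow_int)
  also have "\<dots> \<in> V"
    using ab V by (simp add: subgroup.m_closed subgroup_int_pow_closed)
  finally show ?thesis .
qed

section \<open>Maximal subgroups and the Frattini subgroup\<close>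

lemma maximal_subgroupD:
  assumes "maximal_subgroup M G"
  shows "subgroup M G" "M \<noteq> carrier G"
    and "\<And>H. subgroup H G \<Longrightarrow> M \<subseteq> H \<Longrightarrow> H = M \<or> H = carrier G"
  using assms unfolding maximal_subgroup_def proper_subgroup_def by blast+

lemma frattini_le_maximal: "maximal_subgroup M G \<Longrightarrow> frattini G \<subseteq> M"
  unfolding frattini_def by blast

lemma subgroup_frattini: "subgroup (frattini G) G"
proof (rule subgroupI)
  have "\<one> \<in> M" if "maximal_subgroup M G" for M
    using maximal_subgroupD(1)[OF that] by (rule subgroup.one_closed)
  then show "frattini G \<noteq> {}" unfolding frattini_def by blast
  show "inv a \<in> frattini G" if "a \<in> frattini G" for a
    using that maximal_subgroupD(1) unfolding frattini_def by (auto intro: subgroup.m_inv_closed)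
  show "a \<otimes> b \<in> frattini G" if "a \<in> frattini G" "b \<in> frattini G" for a b
    using that maximal_subgroupD(1) unfolding frattini_def by (auto intro: subgroup.m_closed)
qed (auto simp: frattini_def)

lemma maximal_subgroup_conj_set:
  assumes M: "maximal_subgroup M G" and g: "g \<in> carrier G"
  shows "maximal_subgroup (conj_set g M) G"
proof -
  note MD = maximal_subgroupD[OF M]
  have Mc: "M \<subseteq> carrier G" using MD(1) by (rule subgroup.subset)
  have back1: "conj_set (inv g) (conj_set g H) = H" if "H \<subseteq> carrier G" for H
    using that g by (simp only: conj_set_conj_set inv_closed l_inv conj_set_one)
  have back2: "conj_set g (conj_set (inv g) H) = H" if "H \<subseteq> carrier G" for H
    using that g by (simp only: conj_set_conj_set inv_closed r_inv conj_set_one)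
  have full: "conj_set h (carrier G) = carrier G" if "h \<in> carrier G" for h
    using conj_set_self[OF subgroup_self that] .
  have "conj_set g M \<noteq> carrier G"
    using back1[OF Mc] full[of "inv g"] MD(2) g by auto
  moreover have "H = conj_set g M" if H: "proper_subgroup H G" "conj_set g M \<subseteq> H" for H
  proof -
    have Hc: "H \<subseteq> carrier G" using H by (simp add: proper_subgroup_def subgroup.subset)
    have "M \<subseteq> conj_set (inv g) H" using image_mono[OF H(2), of "\<lambda>h. inv g \<otimes> h \<otimes> inv (inv g)"] back1[OF Mc] by argo
    moreover have "subgroup (conj_set (inv g) H) G"
      using H g unfolding proper_subgroup_def by (intro subgroup_conj_set) auto
    ultimately have "conj_set (inv g) H = M \<or> conj_set (inv g) H = carrier G" using MD(3) by blast
    moreover have "conj_set (inv g) H \<noteq> carrier G"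
    proof
      assume "conj_set (inv g) H = carrier G"
      then have "H = conj_set g (carrier G)" using back2[OF Hc] by simp
      then show False using full[OF g] H by (simp add: proper_subgroup_def)
    qed
    ultimately show ?thesis using back2[OF Hc] by simp
  qed
  ultimately show ?thesis
    using subgroup_conj_set[OF g MD(1)] unfolding maximal_subgroup_def proper_subgroup_def by blast
qed

text \<open>Conjugation permutes the maximal subgroups.\<close>

lemma normal_frattini: "frattini G \<lhd> G"
proof -
  have "x \<otimes> h \<otimes> inv x \<in> M" if x: "x \<in> carrier G" and h: "h \<in> frattini G" and M: "maximal_subgroup M G" for x h M
  proof -
    have "h \<in> conj_set (inv x) M" using frattini_le_maximal[OF maximal_subgroup_conj_set[OF M inv_closed[OF x]]] h by blast
    then have "x \<otimes> h \<otimes> inv x \<in> conj_set x (conj_set (inv x) M)" by blast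
    then show ?thesis
      using x subgroup.subset[OF maximal_subgroupD(1)[OF M]]
      by (simp only: conj_set_conj_set inv_closed r_inv conj_set_one)
  qed
  moreover have "frattini G \<subseteq> carrier G" unfolding frattini_def by blast
  ultimately show ?thesis
    unfolding normal_inv_iff using subgroup_frattini unfolding frattini_def by auto
qed

end

context finite_group begin

lemma proper_subgroup_le_maximal:
  assumes "proper_subgroup H G"
  shows "\<exists>M. maximal_subgroup M G \<and> H \<subseteq> M"
proof -
  let ?A = "{K. proper_subgroup K G \<and> H \<subseteq> K}"
  have "?A \<subseteq> Pow (carrier G)" by (auto simp: proper_subgroup_def dest: subgroup.subset)
  then have "finite ?A" using finite_carrier by (meson finite_Pow_iff finite_subset)
  then obtain M where M: "M \<in> ?A" "\<And>K. K \<in> ?A \<Longrightarrow> M \<subseteq> K \<Longrightarrow> M = K"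
    using finite_has_maximal2[of ?A H] assms by auto
  then have "maximal_subgroup M G" unfolding maximal_subgroup_def by blast
  then show ?thesis using M by blast
qed

text \<open>A maximal subgroup above \<open>U\<close> contains \<open>V\<close> too.\<close>

lemma frattini_nongenerator:
  assumes U: "proper_subgroup U G" and V: "V \<subseteq> frattini G"
  shows "carrier G \<noteq> U <#> V" "carrier G \<noteq> V <#> U"
proof -
  obtain M where M: "maximal_subgroup M G" "U \<subseteq> M" using proper_subgroup_le_maximal[OF U] by blast
  have "V \<subseteq> M" using V frattini_le_maximal[OF M(1)] by blast
  then have "U <#> V \<subseteq> M" "V <#> U \<subseteq> M"
    using M(2) maximal_subgroupD(1)[OF M(1)] unfolding set_mult_def by (auto intro: subgroup.m_closed)
  moreover have "\<not> carrier G \<subseteq> M"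
    using maximal_subgroupD(1,2)[OF M(1)] subgroup.subset by blast
  ultimately show "carrier G \<noteq> U <#> V" "carrier G \<noteq> V <#> U" by auto
qed

text \<open>By the non-generator property, the ends of an edge lie outside \<open>\<Phi>\<close> automatically.\<close>

lemma factorization_graph_adjacent_iff:
  "(U, V) \<in> parcs (factorization_graph G) \<longleftrightarrow>
     proper_subgroup U G \<and> proper_subgroup V G \<and> carrier G = U <#> V"
  using frattini_nongenerator unfolding factorization_graph_def by auto

lemma subgroup_eq_carrierI:
  assumes "subgroup K G" and "\<And>M. maximal_subgroup M G \<Longrightarrow> \<not> K \<subseteq> M"
  shows "K = carrier G"
  using assms proper_subgroup_le_maximal unfolding proper_subgroup_def by blast

text \<open>The Frattini argument, including the instance of Sylow's conjugacy theorem on which it rests.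
  For \<open>g \<in> G\<close> the conjugate of \<open>S\<close> by \<open>g\<close> lies in \<open>N\<close> and acts on the cosets of \<open>S\<close> in \<open>N\<close>; their number is
  \<open>m\<close>, so one of them is fixed, and its representative conjugates the conjugate of \<open>S\<close> back to \<open>S\<close>. As
  \<open>N \<subseteq> S \<Phi>\<close>, this representative may be taken in \<open>\<Phi>\<close>. Hence \<open>G = \<Phi> K\<close> for the normalizer \<open>K\<close> of \<open>S\<close>,
  and \<open>K = G\<close> because \<open>\<Phi>\<close> consists of non-generators.\<close>

lemma frattini_argument:
  assumes N: "N \<lhd> G" and S: "subgroup S G" "S \<subseteq> N" and p: "Factorial_Ring.prime p"
    and cS: "card S = p ^ k" and cN: "card N = p ^ k * m" and nd: "\<not> p dvd m"
    and NS: "N \<subseteq> S <#> frattini G"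
  shows "S \<lhd> G"
proof -
  have Nsub: "subgroup N G" using N by (rule normal_imp_subgroup)
  interpret N: group "G\<lparr>carrier := N\<rparr>" by (rule subgroup_imp_group[OF Nsub])
  have Nc: "x \<in> carrier G" if "x \<in> N" for x using that Nsub by (rule subgroup.mem_carrier[rotated])
  have Sc: "S \<subseteq> carrier G" using S(1) by (rule subgroup.subset)
  define E where "E = (\<lambda>a. S #> a) ` N"
  have SN: "subgroup S (G\<lparr>carrier := N\<rparr>)" using subgroup_incl[OF S(1) Nsub S(2)] .
  have E: "E = rcosets\<^bsub>G\<lparr>carrier := N\<rparr>\<^esub> S" unfolding E_def RCOSETS_def r_coset_def by auto
  have "card E * card S = card N"
    using N.lagrange[OF SN] unfolding E order_def by simp
  then have cE: "card E = m" using cS cN p by (auto simp: prime_gt_0_nat)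
  have finE: "finite E" using finite_subgroup[OF Nsub] unfolding E_def by blast
  define K where "K = {x \<in> carrier G. conj_set x S = S}"
  have K: "subgroup K G"
  proof (rule subgroupI)
    show "K \<subseteq> carrier G" unfolding K_def by blast
    show "K \<noteq> {}" using conj_set_one[OF Sc] unfolding K_def by blast
    show "inv a \<in> K" if "a \<in> K" for a
      using that conj_set_conj_set[of "inv a" a S] conj_set_one Sc unfolding K_def by simp
    show "a \<otimes> b \<in> K" if "a \<in> K" "b \<in> K" for a b
      using that conj_set_conj_set[of a b S] Sc unfolding K_def by simp
  qed
  have "\<exists>a\<in>frattini G. a \<otimes> g \<in> K" if g: "g \<in> carrier G" for g
  proof -
    let ?S = "conj_set g S"
    have S': "subgroup ?S G" using subgroup_conj_set[OF g S(1)] .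
    have S'N: "?S \<subseteq> N" using N g S(2) unfolding normal_inv_iff by blast
    interpret S': group "G\<lparr>carrier := ?S\<rparr>" by (rule subgroup_imp_group[OF S'])
    \<comment> \<open>the action of \<open>h\<close> is \<open>T \<mapsto> T h\<^sup>-\<^sup>1\<close>, since right multiplication by \<open>h\<close> would be an anti-action\<close>
    have act: "group_action (G\<lparr>carrier := ?S\<rparr>) E (\<lambda>h. restrict (\<lambda>T. T #> inv h) E)"
    proof (rule group_actionI)
      show "group (G\<lparr>carrier := ?S\<rparr>)" by (rule S'.group_axioms)
      have coset: "(S #> a) #> inv h = S #> (a \<otimes> inv h)" if "a \<in> N" "h \<in> ?S" for a h
        using that S'N Nc Sc by (intro coset_mult_assoc) auto
      show "T #> inv h \<in> E" if h: "h \<in> carrier (G\<lparr>carrier := ?S\<rparr>)" and T: "T \<in> E" for h T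
      proof -
        obtain a where a: "a \<in> N" "T = S #> a" using T unfolding E_def by blast
        have "h \<in> N" using h S'N by auto
        then have "a \<otimes> inv h \<in> N" using a Nsub by (simp add: subgroup.m_closed subgroup.m_inv_closed)
        then show ?thesis using coset[of a h] a h unfolding E_def by auto
      qed
      have Tc: "T \<subseteq> carrier G" if "T \<in> E" for T
        using that Sc Nc r_coset_subset_G unfolding E_def by blast
      show "T #> inv \<one>\<^bsub>G\<lparr>carrier := ?S\<rparr>\<^esub> = T" if "T \<in> E" for T
        using Tc[OF that] by simp
      show "T #> inv (h \<otimes>\<^bsub>G\<lparr>carrier := ?S\<rparr>\<^esub> h') = T #> inv h' #> inv h"
        if "h \<in> carrier (G\<lparr>carrier := ?S\<rparr>)" "h' \<in> carrier (G\<lparr>carrier := ?S\<rparr>)" "T \<in> E" for h h' T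
      proof -
        have "h \<in> carrier G" "h' \<in> carrier G" using that S'N Nc by auto
        then show ?thesis using Tc[OF that(3)] by (simp add: inv_mult_group coset_mult_assoc)
      qed
    qed
    have ord: "order (G\<lparr>carrier := ?S\<rparr>) = p ^ k"
      using card_conj_set[OF g Sc] cS by (simp add: order_def)
    have "\<not> p dvd card E" using nd cE by simp
    from p_group_action_fixed_point[OF act p ord finE this]
    obtain T where T: "T \<in> E" "\<And>h. h \<in> ?S \<Longrightarrow> restrict (\<lambda>T. T #> inv h) E T = T"
      by auto
    obtain a where a: "a \<in> N" "T = S #> a" using T unfolding E_def by blast
    have ac: "a \<in> carrier G" using a Nc by blast
    have "a \<otimes> h \<otimes> inv a \<in> S" if h: "h \<in> ?S" for h
    proof -
      have hc: "h \<in> carrier G" using h S'N Nc by blast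
      have "S #> (a \<otimes> inv h) = S #> a"
        using T(2)[OF h] T(1) a coset_mult_assoc[OF Sc ac] hc by auto
      then have "a \<otimes> inv h \<in> S #> a" using rcos_self[OF _ S(1)] ac hc by (metis inv_closed m_closed)
      then obtain s where s: "s \<in> S" "a \<otimes> inv h = s \<otimes> a" unfolding r_coset_def by blast
      then have "a \<otimes> inv h \<otimes> inv a = s" using ac hc Sc by (simp add: inv_solve_right' subset_iff)
      then have "inv s = a \<otimes> h \<otimes> inv a" using ac hc by (auto simp: inv_mult_group m_assoc)
      then show ?thesis using s S(1) by (metis subgroup.m_inv_closed)
    qed
    then have "conj_set a ?S \<subseteq> S" by (rule image_subsetI)
    then have sub: "conj_set (a \<otimes> g) S \<subseteq> S" by (simp only: conj_set_conj_set[OF ac g Sc])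
    have eq: "conj_set (a \<otimes> g) S = S"
      using card_subset_eq[OF finite_subgroup[OF S(1)] sub card_conj_set[OF m_closed[OF ac g] Sc]] .
    obtain s f where sf: "s \<in> S" "f \<in> frattini G" "a = s \<otimes> f" using NS a unfolding set_mult_def by blast
    have c: "s \<in> carrier G" "f \<in> carrier G" using sf Sc unfolding frattini_def by auto
    have "f \<otimes> g = inv s \<otimes> (a \<otimes> g)" using sf c g by (simp add: m_assoc[symmetric])
    then have "conj_set (f \<otimes> g) S = conj_set (inv s) (conj_set (a \<otimes> g) S)"
      using conj_set_conj_set[of "inv s" "a \<otimes> g" S] c ac g Sc by simp
    also have "\<dots> = S" using eq conj_set_self[OF S(1), of "inv s"] sf S(1) by (simp add: subgroup.m_inv_closed)
    finally show ?thesis using sf c g unfolding K_def by auto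
  qed
  then have *: "\<exists>a\<in>frattini G. a \<otimes> g \<in> K" if "g \<in> carrier G" for g using that by blast
  have "K = carrier G"
  proof (rule subgroup_eq_carrierI[OF K])
    fix M assume M: "maximal_subgroup M G"
    show "\<not> K \<subseteq> M"
    proof
      assume KM: "K \<subseteq> M"
      have "carrier G \<subseteq> M"
      proof
        fix g assume g: "g \<in> carrier G"
        obtain a where a: "a \<in> frattini G" "a \<otimes> g \<in> K" using *[OF g] by blast
        have aM: "a \<in> M" "a \<in> carrier G" using a frattini_le_maximal[OF M] by (auto simp: frattini_def)
        have "g = inv a \<otimes> (a \<otimes> g)" using aM g by (simp add: m_assoc[symmetric])
        also have "\<dots> \<in> M" using aM a KM maximal_subgroupD(1)[OF M]
          by (meson subgroup.m_closed subgroup.m_inv_closed subsetD)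
        finally show "g \<in> M" .
      qed
      then show False using maximal_subgroupD(1,2)[OF M] subgroup.subset by blast
    qed
  qed
  then have "\<And>x s. x \<in> carrier G \<Longrightarrow> s \<in> S \<Longrightarrow> x \<otimes> s \<otimes> inv x \<in> S" unfolding K_def by blast
  then show ?thesis using S(1) by (simp add: normal_inv_iff)
qed

lemma exists_sylow_subgroup:
  assumes p: "Factorial_Ring.prime p" and K: "subgroup K G"
  shows "\<exists>P. subgroup P G \<and> P \<subseteq> K \<and> card P = p ^ multiplicity p (card K)"
proof -
  interpret K: group "G\<lparr>carrier := K\<rparr>" by (rule subgroup_imp_group[OF K])
  have "p ^ multiplicity p (card K) dvd card K" by (rule multiplicity_dvd)
  then obtain m where "order (G\<lparr>carrier := K\<rparr>) = p ^ multiplicity p (card K) * m"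
    unfolding order_def by auto
  then obtain P where P: "subgroup P (G\<lparr>carrier := K\<rparr>)" "card P = p ^ multiplicity p (card K)"
    using sylow_thm[OF p K.group_axioms] finite_subgroup[OF K] by auto
  then show ?thesis
    using incl_subgroup[OF K P(1)] subgroup.subset[OF P(1)] by auto
qed

lemma pow_card_subgroup: "subgroup P G \<Longrightarrow> x \<in> P \<Longrightarrow> x [^] card P = \<one>"
proof -
  assume P: "subgroup P G" and x: "x \<in> P"
  interpret P: group "G\<lparr>carrier := P\<rparr>" by (rule subgroup_imp_group[OF P])
  show ?thesis using P.pow_order_eq_1[of x] x by (simp add: order_def nat_pow_consistent[symmetric])
qed

text \<open>A relative version of Cauchy's theorem: a Sylow \<open>p\<close>-subgroup of \<open>K\<close> is too large to lie in
  \<open>F\<close>, and among the \<open>p\<close>-power powers of one of its elements outside \<open>F\<close> the last one outside \<open>F\<close>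
  is as required.\<close>

lemma exists_prime_power_element:
  assumes p: "Factorial_Ring.prime p" and K: "subgroup K G" and F: "subgroup F G" and FK: "F \<subseteq> K"
    and dvd: "p * card F dvd card K"
  shows "\<exists>x\<in>K. x \<notin> F \<and> x [^] p \<in> F \<and> (\<exists>j. x [^] (p ^ j) = \<one>)"
proof -
  obtain P where P: "subgroup P G" "P \<subseteq> K" "card P = p ^ multiplicity p (card K)"
    using exists_sylow_subgroup[OF p K] by blast
  have "\<not> P \<subseteq> F"
  proof
    assume "P \<subseteq> F"
    then have "p * p ^ multiplicity p (card K) dvd p * card F"
      using card_subgroup_dvd[OF P(1) F] P(3) by simp
    then have "p ^ Suc (multiplicity p (card K)) dvd card K" using dvd dvd_trans by (metis power_Suc)
    then have "Suc (multiplicity p (card K)) \<le> multiplicity p (card K)"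
      using p card_subgroup_pos[OF K] by (intro multiplicity_geI) auto
    then show False by simp
  qed
  then obtain x where x: "x \<in> P" "x \<notin> F" by blast
  have xc: "x \<in> carrier G" using x P(1) by (meson subgroup.mem_carrier)
  have x1: "x [^] (p ^ multiplicity p (card K)) = \<one>" using pow_card_subgroup[OF P(1) x(1)] P(3) by simp
  define j where "j = (LEAST j. x [^] (p ^ j) \<in> F)"
  have j: "x [^] (p ^ j) \<in> F"
    unfolding j_def by (rule LeastI[of _ "multiplicity p (card K)"]) (use x1 F in \<open>simp add: subgroup.one_closed\<close>)
  have "j \<noteq> 0" using j x xc by (cases j) auto
  then obtain i where i: "j = Suc i" by (cases j) auto
  have "x [^] (p ^ i) \<notin> F" using not_less_Least[of i "\<lambda>j. x [^] (p ^ j) \<in> F"] i unfolding j_def by simp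
  moreover have "(x [^] (p ^ i)) [^] p \<in> F" using j xc unfolding i by (simp add: nat_pow_pow mult.commute)
  moreover have "(x [^] (p ^ i)) [^] (p ^ multiplicity p (card K)) = \<one>"
    using x1 xc by (metis mult.commute nat_pow_one nat_pow_pow)
  moreover have "x [^] (p ^ i) \<in> K" using subgroup_nat_pow_closed[OF P(1) x(1)] P(2) by blast
  ultimately show ?thesis by blast
qed

end

section \<open>Factorizations and subgroups of prime index\<close>

context finite_group begin

lemma subgroup_normal_set_mult:
  assumes "N \<lhd> G" "subgroup H G" shows "subgroup (N <#> H) G"
proof -
  interpret second_isomorphism_grp N G H
    using assms by (simp add: second_isomorphism_grp_def second_isomorphism_grp_axioms_def)
  show ?thesis by (rule normal_set_mult_subgroup)
qed

lemma set_mult_subset_left: "subgroup H G \<Longrightarrow> A \<subseteq> carrier G \<Longrightarrow> A \<subseteq> A <#> H"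
  unfolding set_mult_def using subgroup.one_closed r_one by fastforce

lemma set_mult_subset_right: "subgroup H G \<Longrightarrow> A \<subseteq> carrier G \<Longrightarrow> A \<subseteq> H <#> A"
  unfolding set_mult_def using subgroup.one_closed l_one by fastforce

lemma maximal_normal_factorization:
  assumes N: "N \<lhd> G" and A: "maximal_subgroup A G" and NA: "\<not> N \<subseteq> A"
  shows "carrier G = N <#> A"
proof -
  have Nc: "N \<subseteq> carrier G" using N by (simp add: normal_imp_subgroup subgroup.subset)
  note AD = maximal_subgroupD[OF A]
  have "A \<subseteq> N <#> A" using set_mult_subset_right[OF normal_imp_subgroup[OF N] subgroup.subset[OF AD(1)]] .
  moreover have "N \<subseteq> N <#> A" using set_mult_subset_left[OF AD(1) Nc] .
  ultimately show ?thesis using AD(3)[OF subgroup_normal_set_mult[OF N AD(1)]] NA by blast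
qed

text \<open>The index of \<open>L \<inter> V\<close> in \<open>V\<close> is a multiple of \<open>p\<close>, so \<open>L V\<close> has at least \<open>p |L|\<close> elements.\<close>

lemma coprime_index_factorization:
  assumes L: "subgroup L G" and V: "subgroup V G" and p: "Factorial_Ring.prime p"
    and r: "Factorial_Ring.prime r" and pr: "p \<noteq> r"
    and cL: "card (carrier G) = p * card L" and cV: "card (carrier G) = r * card V"
  shows "carrier G = L <#> V"
proof -
  have I: "subgroup (L \<inter> V) G" using L V by (rule subgroups_Inter_pair)
  obtain a b where a: "card L = card (L \<inter> V) * a" and b: "card V = card (L \<inter> V) * b"
    using card_subgroup_dvd[OF I L] card_subgroup_dvd[OF I V] by (auto elim!: dvdE)
  have d: "card (L \<inter> V) > 0" using card_subgroup_pos[OF I] .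
  have "p * a = r * b" using cL cV a b d by auto
  moreover have "coprime p r" using p r pr primes_coprime by blast
  ultimately have "p dvd b" by (metis coprime_dvd_mult_right_iff dvd_triv_left)
  moreover have "b > 0" using b card_subgroup_pos[OF V] by (cases b) auto
  ultimately have "p \<le> b" by (simp add: dvd_imp_le)
  have "card (L <#> V) * card (L \<inter> V) = card L * b * card (L \<inter> V)"
    using card_set_mult[OF L V] by (simp only: b ac_simps)
  then have "card (L <#> V) = card L * b" using d by simp
  then have "card (carrier G) \<le> card (L <#> V)" using \<open>p \<le> b\<close> cL by (simp add: mult.commute)
  moreover have "L <#> V \<subseteq> carrier G" using L V by (simp add: setmult_subset_G subgroup.subset)
  ultimately show ?thesis using finite_carrier card_seteq by metis
qed

lemma prime_index_intermediate:
  assumes H: "subgroup H G" and J: "subgroup J G" and K: "subgroup K G" and "H \<subseteq> J" "J \<subseteq> K"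
    and r: "Factorial_Ring.prime r" and c: "card K = r * card H"
  shows "J = H \<or> J = K"
proof -
  obtain a where a: "card J = card H * a"
    using card_subgroup_dvd[OF H J assms(4)] by (elim dvdE)
  obtain b where b: "card K = card J * b"
    using card_subgroup_dvd[OF J K assms(5)] by (elim dvdE)
  have "card H * r = card H * (a * b)" using a b c by (simp add: ac_simps)
  then have "r = a * b" using card_subgroup_pos[OF H] by simp
  then have "a = 1 \<or> b = 1" using r by (metis prime_product)
  then show ?thesis
  proof
    assume "a = 1" then have "card J \<le> card H" using a by simp
    then show ?thesis using subgroup_eq_of_card_le[OF H J assms(4)] by simp
  next
    assume "b = 1" then have "card K \<le> card J" using b by simp
    then show ?thesis using subgroup_eq_of_card_le[OF J K assms(5)] by simp
  qed
qed

text \<open>A subgroup whose index is the least prime divisor of the group order is normal; only the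
  prime divisors of the index of a normal subgroup \<open>F\<close> below \<open>V\<close> matter. If \<open>V\<close> differs from its
  conjugate \<open>V'\<close> by \<open>g\<close>, then every prime divisor of \<open>|V : V \<inter> V'|\<close> is at least \<open>r\<close>, so \<open>V V'\<close> is all
  of \<open>K\<close>. But a subgroup and its conjugate never factorize a group.\<close>

lemma least_prime_index_conj_set:
  assumes F: "F \<lhd> G" and FV: "F \<subseteq> V" and V: "subgroup V G" and K: "subgroup K G" and VK: "V \<subseteq> K"
    and c: "card K = r * card V"
    and least: "\<And>s. Factorial_Ring.prime s \<Longrightarrow> s * card F dvd card K \<Longrightarrow> r \<le> s"
    and g: "g \<in> K"
  shows "conj_set g V = V"
proof (rule ccontr)
  assume ne: "conj_set g V \<noteq> V"
  have gc: "g \<in> carrier G" using g K by (meson subgroup.mem_carrier)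
  have Vc: "V \<subseteq> carrier G" using V by (rule subgroup.subset)
  let ?V = "conj_set g V"
  have V': "subgroup ?V G" using subgroup_conj_set[OF gc V] .
  have V'K: "?V \<subseteq> K" using VK g K by (auto intro!: subgroup.m_closed subgroup.m_inv_closed)
  have FV': "F \<subseteq> ?V"
  proof
    fix f assume f: "f \<in> F"
    have fc: "f \<in> carrier G" using f FV Vc by blast
    have "inv g \<otimes> f \<otimes> g \<in> F" using F f gc by (simp add: normal.inv_op_closed1)
    moreover have "f = g \<otimes> (inv g \<otimes> f \<otimes> g) \<otimes> inv g"
      using fc gc by (simp add: m_assoc) (simp add: m_assoc[symmetric])
    ultimately show "f \<in> ?V" using FV by blast
  qed
  have I: "subgroup (V \<inter> ?V) G" using V V' by (rule subgroups_Inter_pair)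
  obtain t where t: "card V = card (V \<inter> ?V) * t"
    using card_subgroup_dvd[OF I V] by (auto elim!: dvdE)
  have d: "card (V \<inter> ?V) > 0" using card_subgroup_pos[OF I] .
  have cV': "card ?V = card V" using card_conj_set[OF gc Vc] .
  have "t \<noteq> 1"
  proof
    assume "t = 1"
    then have "V \<inter> ?V = V" using subgroup_eq_of_card_le[OF I V] t by simp
    then have "V = ?V" using subgroup_eq_of_card_le[OF V V'] cV' by auto
    then show False using ne by simp
  qed
  then obtain s where s: "Factorial_Ring.prime s" "s dvd t" using prime_factor_nat by blast
  have "s * card F dvd card (V \<inter> ?V) * t"
    using card_subgroup_dvd[OF normal_imp_subgroup[OF F] I] FV FV' s(2) by (metis Int_subset_iff mult.commute mult_dvd_mono)
  then have "s * card F dvd card K" using t c by (metis dvd_mult)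
  then have "r \<le> s" using least s(1) by blast
  have "t > 0" using t card_subgroup_pos[OF V] by (cases t) auto
  then have "r \<le> t" using \<open>r \<le> s\<close> s(2) dvd_imp_le le_trans by blast
  have "card (V <#> ?V) * card (V \<inter> ?V) = card V * t * card (V \<inter> ?V)"
    using card_set_mult[OF V V'] by (simp only: cV' t ac_simps)
  then have "card (V <#> ?V) = card V * t" using d by simp
  then have "card K \<le> card (V <#> ?V)" using \<open>r \<le> t\<close> c by (simp add: mult.commute)
  moreover have "V <#> ?V \<subseteq> K" using VK V'K K unfolding set_mult_def by (auto intro: subgroup.m_closed)
  ultimately have "V <#> ?V = K" using finite_subgroup[OF K] card_seteq by blast
  \<comment> \<open>a factorization of the inverse of \<open>g\<close> forces \<open>g \<in> V\<close>\<close>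
  moreover have "inv g \<in> K" using g K by (simp add: subgroup.m_inv_closed)
  ultimately obtain v w where vw: "v \<in> V" "w \<in> V" "inv g = v \<otimes> (g \<otimes> w \<otimes> inv g)"
    unfolding set_mult_def by blast
  have vwc: "v \<in> carrier G" "w \<in> carrier G" using vw Vc by auto
  have "\<one> = v \<otimes> g \<otimes> w"
  proof -
    have "inv g \<otimes> g = v \<otimes> (g \<otimes> w \<otimes> inv g) \<otimes> g" using vw(3) by simp
    then show ?thesis using gc vwc by (simp add: m_assoc)
  qed
  then have "g = inv v \<otimes> inv w"
    using gc vwc by (metis inv_closed inv_solve_left inv_solve_right l_one m_closed one_closed r_one)
  then have "g \<in> V" using vw V by (simp add: subgroup.m_closed subgroup.m_inv_closed)
  then show False using ne conj_set_self[OF V] by simp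
qed

lemma normal_conj_setI:
  assumes "subgroup V G" "\<And>g. g \<in> carrier G \<Longrightarrow> conj_set g V = V" shows "V \<lhd> G"
  using assms unfolding normal_inv_iff by blast

lemma union_proper_subgroups:
  assumes A: "subgroup A G" and B: "subgroup B G" and AB: "\<not> A \<subseteq> B" "\<not> B \<subseteq> A"
  shows "\<exists>g\<in>carrier G. g \<notin> A \<and> g \<notin> B"
proof -
  obtain a b where ab: "a \<in> A" "a \<notin> B" "b \<in> B" "b \<notin> A" using AB by blast
  have c: "a \<in> carrier G" "b \<in> carrier G" using ab A B by (auto dest: subgroup.mem_carrier)
  have "a \<otimes> b \<notin> A"
  proof
    assume "a \<otimes> b \<in> A"
    then have "inv a \<otimes> (a \<otimes> b) \<in> A" using ab A by (simp add: subgroup.m_closed subgroup.m_inv_closed)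
    then show False using ab c by (simp add: m_assoc[symmetric])
  qed
  moreover have "a \<otimes> b \<notin> B"
  proof
    assume "a \<otimes> b \<in> B"
    then have "(a \<otimes> b) \<otimes> inv b \<in> B" using ab B by (simp add: subgroup.m_closed subgroup.m_inv_closed)
    then show False using ab c by (simp add: m_assoc)
  qed
  ultimately show ?thesis using c by blast
qed

end

section \<open>Groups whose factorization graph is bipartite without isolated vertex\<close>

text \<open>What the graph condition says about subgroups: non-isolated vertices have supplements, and
  bipartite graphs have no triangles.\<close>

locale supplemented_triangle_free_group = finite_group +
  assumes supplement: "proper_subgroup H G \<Longrightarrow> \<not> H \<subseteq> frattini G \<Longrightarrow>
      \<exists>V. proper_subgroup V G \<and> carrier G = H <#> V"
    and no_triangle: "proper_subgroup A G \<Longrightarrow> proper_subgroup B G \<Longrightarrow> proper_subgroup C G \<Longrightarrow>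
      carrier G = A <#> B \<Longrightarrow> carrier G = A <#> C \<Longrightarrow> carrier G \<noteq> B <#> C"
begin

text \<open>Enlarge a proper supplement of \<open>\<langle>x\<rangle>\<close> to a maximal subgroup \<open>V\<close>; if \<open>\<langle>x\<rangle> = G\<close>, take any
  maximal subgroup without \<open>x\<close>. As \<open>x\<^sup>r \<in> \<Phi> \<le> V\<close>, the cosets of \<open>V\<close> are those of the powers \<open>x\<^sup>i\<close> with
  \<open>i < r\<close>; they are distinct because \<open>r\<close> is prime and \<open>x \<notin> V\<close>.\<close>

lemma maximal_supplement_of_prime_index:
  assumes x: "x \<in> carrier G" "x \<notin> frattini G" and r: "Factorial_Ring.prime r" and xr: "x [^] r \<in> frattini G"
  shows "\<exists>V. maximal_subgroup V G \<and> x \<notin> V \<and> card (carrier G) = r * card V"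
proof -
  let ?Z = "generate G {x}"
  have Z: "subgroup ?Z G" using x by (intro generate_is_subgroup) auto
  have xZ: "x \<in> ?Z" by (auto intro: generate.incl)
  have "\<exists>V. maximal_subgroup V G \<and> x \<notin> V \<and> carrier G = ?Z <#> V"
  proof (cases "?Z = carrier G")
    case True
    obtain V where V: "maximal_subgroup V G" "x \<notin> V" using x unfolding frattini_def by blast
    have "carrier G \<subseteq> ?Z <#> V"
      using set_mult_subset_left[OF maximal_subgroupD(1)[OF V(1)] subset_refl] True by simp
    moreover have "?Z <#> V \<subseteq> carrier G"
      using Z maximal_subgroupD(1)[OF V(1)] by (simp add: setmult_subset_G subgroup.subset)
    ultimately show ?thesis using V by blast
  next
    case False
    then have "proper_subgroup ?Z G" using Z by (simp add: proper_subgroup_def)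
    then obtain V' where V': "proper_subgroup V' G" "carrier G = ?Z <#> V'"
      using supplement xZ x by blast
    obtain V where V: "maximal_subgroup V G" "V' \<subseteq> V" using proper_subgroup_le_maximal[OF V'(1)] by blast
    note VD = maximal_subgroupD[OF V(1)]
    have "x \<notin> V"
    proof
      assume "x \<in> V"
      then have "?Z \<subseteq> V" using generate_subgroup_incl[OF _ VD(1)] by simp
      then have "carrier G \<subseteq> V" using V'(2) V(2) VD(1) unfolding set_mult_def by (auto intro: subgroup.m_closed)
      then show False using VD subgroup.subset by blast
    qed
    moreover have "carrier G \<subseteq> ?Z <#> V" using V'(2) V(2) mono_set_mult[of ?Z ?Z V' V] by blast
    moreover have "?Z <#> V \<subseteq> carrier G"
      using Z VD(1) by (simp add: setmult_subset_G subgroup.subset)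
    ultimately show ?thesis using V(1) by blast
  qed
  then obtain V where V: "maximal_subgroup V G" "x \<notin> V" "carrier G = ?Z <#> V" by blast
  note VD = maximal_subgroupD[OF V(1)]
  have Vc: "V \<subseteq> carrier G" using VD(1) by (rule subgroup.subset)
  have GVZ: "carrier G = V <#> ?Z" using factorization_commute[OF Z VD(1) V(3)] .
  have xrV: "x [^] r \<in> V" using xr frattini_le_maximal[OF V(1)] by blast
  have xk: "V #> x [^] k = V #> x [^] (k mod r)" for k
  proof -
    have "x [^] k = x [^] (r * (k div r)) \<otimes> x [^] (k mod r)"
      using x by (simp add: nat_pow_mult)
    also have "x [^] (r * (k div r)) = (x [^] r) [^] (k div r)" using x by (simp add: nat_pow_pow)
    finally have "x [^] k = (x [^] r) [^] (k div r) \<otimes> x [^] (k mod r)" .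
    moreover have "(x [^] r) [^] (k div r) \<in> V" using subgroup_nat_pow_closed[OF VD(1) xrV] .
    ultimately show ?thesis
      using x Vc coset_mult_assoc[of V "(x [^] r) [^] (k div r)" "x [^] (k mod r)"] coset_join2[OF _ VD(1)]
      by auto
  qed
  have "bij_betw (\<lambda>i. V #> x [^] i) {..<r} (rcosets V)"
    unfolding bij_betw_def
  proof
    have *: "\<not> i < j" if "i < r" "j < r" "V #> x [^] i = V #> x [^] j" for i j
    proof
      assume ij: "i < j"
      have "x [^] j \<in> V #> x [^] i" using that x rcos_self[OF _ VD(1), of "x [^] j"] by simp
      then obtain v where v: "v \<in> V" "x [^] j = v \<otimes> x [^] i" unfolding r_coset_def by blast
      have "x [^] (j - i) \<otimes> x [^] i = v \<otimes> x [^] i" using v ij x by (simp add: nat_pow_mult)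
      then have "x [^] (j - i) = v" using x v Vc by (metis nat_pow_closed r_cancel subsetD)
      then have "x [^] (j - i) \<in> V" using v by simp
      moreover have "coprime (j - i) r"
        using r ij that(2) by (metis coprime_commute dvd_imp_le less_imp_diff_less not_le prime_imp_coprime zero_less_diff)
      ultimately have "x \<in> V" using mem_of_coprime_powers[OF VD(1) x(1) _ xrV] by blast
      then show False using V(2) by blast
    qed
    show "inj_on (\<lambda>i. V #> x [^] i) {..<r}"
      unfolding inj_on_def using * by (metis lessThan_iff linorder_neqE_nat)
    show "(\<lambda>i. V #> x [^] i) ` {..<r} = rcosets V"
    proof
      show "(\<lambda>i. V #> x [^] i) ` {..<r} \<subseteq> rcosets V" using x Vc by (auto intro: rcosetsI)
      show "rcosets V \<subseteq> (\<lambda>i. V #> x [^] i) ` {..<r}"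
      proof
        fix R assume "R \<in> rcosets V"
        then obtain g where g: "g \<in> carrier G" "R = V #> g" unfolding RCOSETS_def by blast
        obtain v z where vz: "v \<in> V" "z \<in> ?Z" "g = v \<otimes> z" using g GVZ unfolding set_mult_def by blast
        obtain k :: nat where k: "z = x [^] k"
          using vz(2) generate_pow_on_finite_carrier[OF finite_carrier x(1)] by blast
        have "R = (V #> v) #> x [^] k" using g vz k x Vc by (simp add: coset_mult_assoc subset_iff)
        also have "\<dots> = V #> x [^] (k mod r)" using vz xk[of k] coset_join2[OF _ VD(1)] Vc by auto
        finally show "R \<in> (\<lambda>i. V #> x [^] i) ` {..<r}"
          using r prime_gt_0_nat by (intro image_eqI) auto
      qed
    qed
  qed
  then have "card (rcosets V) = r" using bij_betw_same_card by fastforce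
  then have "card (carrier G) = r * card V" using lagrange[OF VD(1)] by (simp add: order_def)
  then show ?thesis using V by blast
qed

lemma maximal_supplement_of_prime_dvd:
  assumes r: "Factorial_Ring.prime r" and K: "subgroup K G" "frattini G \<subseteq> K"
    and dvd: "r * card (frattini G) dvd card K"
  shows "\<exists>x V. x \<in> K \<and> maximal_subgroup V G \<and> x \<notin> V \<and> card (carrier G) = r * card V"
proof -
  obtain x where x: "x \<in> K" "x \<notin> frattini G" "x [^] r \<in> frattini G"
    using exists_prime_power_element[OF r K(1) subgroup_frattini K(2) dvd] by blast
  moreover have "x \<in> carrier G" using x K by (meson subgroup.mem_carrier)
  ultimately show ?thesis using maximal_supplement_of_prime_index[OF _ _ r] by blast
qed

text \<open>The structure of \<open>G / \<Phi>\<close> for noncyclic \<open>G\<close>; the hypothesis says that no element generates \<open>G\<close>.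
  With \<open>M\<close> normal of least prime index \<open>q\<close>, every other maximal subgroup is adjacent to \<open>M\<close>, hence
  two other ones are never adjacent (\<open>nonadj\<close>), and none is normal (\<open>nonnormal\<close>). Each prime dividing
  \<open>|M : \<Phi>|\<close> is the index of a maximal subgroup other than \<open>M\<close>: it cannot be \<open>q\<close>, since index \<open>q\<close> gives
  normality, and two different primes would give two adjacent subgroups. So \<open>M / \<Phi>\<close> is a \<open>p\<close>-group.
  If \<open>L\<close> has index \<open>p\<close>, then \<open>D = L \<inter> M\<close> is normal in \<open>M\<close> and in \<open>L\<close>, hence in \<open>G\<close>. An
  element of \<open>D\<close> outside \<open>\<Phi>\<close> is missed by some maximal subgroup \<open>V\<close>, and then \<open>G = D V = L V\<close>, although
  \<open>L\<close> and \<open>V\<close> are not adjacent. Hence \<open>D = \<Phi>\<close>, that is, \<open>|M : \<Phi>| = p\<close>.\<close>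

lemma noncyclic_frattini_index:
  assumes noncyclic: "\<And>g. g \<in> carrier G \<Longrightarrow> \<exists>T. maximal_subgroup T G \<and> g \<in> T"
  shows "\<exists>p q M L. Factorial_Ring.prime p \<and> Factorial_Ring.prime q \<and> p \<noteq> q \<and>
    maximal_subgroup M G \<and> M \<lhd> G \<and> card (carrier G) = q * card M \<and> card M = p * card (frattini G) \<and>
    subgroup L G \<and> \<not> L \<lhd> G"
proof -
  let ?F = "frattini G"
  note Fsub = subgroup_frattini
  have maxp: "proper_subgroup T G" if "maximal_subgroup T G" for T
    using that unfolding maximal_subgroup_def by blast
  have prime_quot: "\<exists>s. Factorial_Ring.prime s \<and> s * card ?F dvd card K"
    if K: "subgroup K G" "?F \<subseteq> K" "K \<noteq> ?F" for K
  proof -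
    obtain t where t: "card K = card ?F * t" using card_subgroup_dvd[OF Fsub K(1,2)] by (auto elim!: dvdE)
    have "t \<noteq> 1" using subgroup_eq_of_card_le[OF Fsub K(1,2)] K(3) t by auto
    then obtain s where "Factorial_Ring.prime s" "s dvd t" using prime_factor_nat by blast
    then show ?thesis using t by (metis dvd_refl mult.commute mult_dvd_mono)
  qed
  obtain T0 where T0: "maximal_subgroup T0 G" using noncyclic[of \<one>] by auto
  have "?F \<noteq> carrier G"
    using frattini_le_maximal[OF T0] maximal_subgroupD(1,2)[OF T0] subgroup.subset by blast
  then have ex: "\<exists>s. Factorial_Ring.prime s \<and> s * card ?F dvd card (carrier G)"
    using prime_quot[OF subgroup_self] subgroup.subset[OF Fsub] by auto
  define q where "q = (LEAST s. Factorial_Ring.prime s \<and> s * card ?F dvd card (carrier G))"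
  have q: "Factorial_Ring.prime q" "q * card ?F dvd card (carrier G)"
    using LeastI_ex[OF ex] unfolding q_def by auto
  have qle: "q \<le> s" if "Factorial_Ring.prime s" "s * card ?F dvd card (carrier G)" for s
    unfolding q_def using that by (intro Least_le) auto
  have index_q_normal: "V \<lhd> G" if V: "maximal_subgroup V G" "card (carrier G) = q * card V" for V
    using least_prime_index_conj_set[OF normal_frattini frattini_le_maximal[OF V(1)]
        maximal_subgroupD(1)[OF V(1)] subgroup_self _ V(2) qle]
      subgroup.subset[OF maximal_subgroupD(1)[OF V(1)]] maximal_subgroupD(1)[OF V(1)]
    by (intro normal_conj_setI) auto
  obtain M where M: "maximal_subgroup M G" "card (carrier G) = q * card M"
    using maximal_supplement_of_prime_dvd[OF q(1) subgroup_self subgroup.subset[OF Fsub] q(2)] by blast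
  note MD = maximal_subgroupD[OF M(1)]
  have Mn: "M \<lhd> G" using index_q_normal[OF M] .
  have adj: "carrier G = N <#> R" if "N \<lhd> G" "maximal_subgroup N G" "maximal_subgroup R G" "R \<noteq> N" for N R
    using maximal_normal_factorization[OF that(1,3)] that maximal_subgroupD[OF that(2)] maximal_subgroupD[OF that(3)]
    by blast
  have nonadj: "carrier G \<noteq> R <#> S"
    if "maximal_subgroup R G" "maximal_subgroup S G" "R \<noteq> M" "S \<noteq> M" for R S
    using no_triangle[OF maxp[OF M(1)] maxp[OF that(1)] maxp[OF that(2)]] adj[OF Mn M(1)] that by blast
  have nonnormal: "\<not> R \<lhd> G" if R: "maximal_subgroup R G" "R \<noteq> M" for R
  proof
    assume Rn: "R \<lhd> G"
    have "\<not> M \<subseteq> R" "\<not> R \<subseteq> M" using R MD maximal_subgroupD[OF R(1)] by blast+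
    then obtain g where g: "g \<in> carrier G" "g \<notin> M" "g \<notin> R"
      using union_proper_subgroups[OF MD(1) maximal_subgroupD(1)[OF R(1)]] by blast
    obtain T where T: "maximal_subgroup T G" "g \<in> T" using noncyclic[OF g(1)] by blast
    then have "T \<noteq> M" "T \<noteq> R" using g by auto
    then show False using nonadj[OF R(1) T(1)] adj[OF Rn R(1) T(1)] R(2) by blast
  qed
  have FM: "?F \<subseteq> M" using frattini_le_maximal[OF M(1)] .
  have "\<not> M \<supseteq> carrier G" using MD(1,2) subgroup.subset by blast
  then obtain g T where gT: "g \<in> carrier G" "g \<notin> M" "maximal_subgroup T G" "g \<in> T" using noncyclic by blast
  have "M \<noteq> ?F" using frattini_le_maximal[OF gT(3)] maximal_subgroupD[OF gT(3)] MD(3)[of T] gT(2,4) by blast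
  then obtain p where p: "Factorial_Ring.prime p" "p * card ?F dvd card M"
    using prime_quot[OF MD(1) FM] by blast
  have "p \<noteq> q"
  proof
    assume "p = q"
    then obtain x V where xV: "x \<in> M" "maximal_subgroup V G" "x \<notin> V" "card (carrier G) = q * card V"
      using maximal_supplement_of_prime_dvd[OF p(1) MD(1) FM p(2)] by blast
    then have "V \<noteq> M" by blast
    then show False using nonnormal[OF xV(2)] index_q_normal[OF xV(2,4)] by blast
  qed
  obtain x L where L: "x \<in> M" "maximal_subgroup L G" "x \<notin> L" "card (carrier G) = p * card L"
    using maximal_supplement_of_prime_dvd[OF p(1) MD(1) FM p(2)] by blast
  note LD = maximal_subgroupD[OF L(2)]
  have LM: "L \<noteq> M" using L by blast
  have only_p: "r = p" if r: "Factorial_Ring.prime r" "r * card ?F dvd card M" for r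
  proof (rule ccontr)
    assume rp: "r \<noteq> p"
    obtain z V where V: "z \<in> M" "maximal_subgroup V G" "z \<notin> V" "card (carrier G) = r * card V"
      using maximal_supplement_of_prime_dvd[OF r(1) MD(1) FM r(2)] by blast
    then have "V \<noteq> M" by blast
    moreover have "carrier G = L <#> V"
      using coprime_index_factorization[OF LD(1) maximal_subgroupD(1)[OF V(2)] p(1) r(1) _ L(4) V(4)] rp by blast
    ultimately show False using nonadj[OF L(2) V(2) LM] by blast
  qed
  let ?D = "L \<inter> M"
  have D: "subgroup ?D G" using LD(1) MD(1) by (rule subgroups_Inter_pair)
  have FD: "?F \<subseteq> ?D" using FM frattini_le_maximal[OF L(2)] by blast
  have GML: "carrier G = M <#> L" using adj[OF Mn M(1) L(2) LM] .
  have "card (carrier G) * card ?D = card M * card L"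
    using card_set_mult[OF MD(1) LD(1)] GML by (simp add: Int_commute)
  then have cM: "card M = p * card ?D"
    using L(4) card_subgroup_pos[OF LD(1)] by simp
  have Dn: "?D \<lhd> G"
  proof (rule normal_conj_setI[OF D])
    have conjM: "conj_set m ?D = ?D" if "m \<in> M" for m
    proof (rule least_prime_index_conj_set[OF normal_frattini FD D MD(1) _ cM _ that])
      show "p \<le> s" if "Factorial_Ring.prime s" "s * card ?F dvd card M" for s
        using only_p[OF that] by simp
    qed auto
    have conjL: "conj_set l ?D = ?D" if l: "l \<in> L" for l
    proof -
      have lc: "l \<in> carrier G" using l LD(1) by (meson subgroup.mem_carrier)
      have "conj_set l ?D \<subseteq> L" using conj_set_self[OF LD(1) l] by blast
      moreover have "conj_set l ?D \<subseteq> M" using Mn lc unfolding normal_inv_iff by blast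
      ultimately have "conj_set l ?D \<subseteq> ?D" by blast
      then show ?thesis
        using card_subset_eq[OF finite_subgroup[OF D] _ card_conj_set[OF lc subgroup.subset[OF D]]] by blast
    qed
    fix g assume "g \<in> carrier G"
    then obtain m l where ml: "m \<in> M" "l \<in> L" "g = m \<otimes> l" using GML unfolding set_mult_def by blast
    have c: "m \<in> carrier G" "l \<in> carrier G" using ml MD(1) LD(1) by (auto dest: subgroup.mem_carrier)
    show "conj_set g ?D = ?D"
      using conj_set_conj_set[OF c subgroup.subset[OF D]] conjM[OF ml(1)] conjL[OF ml(2)] ml(3) by simp
  qed
  have "?D = ?F"
  proof (rule ccontr)
    assume "?D \<noteq> ?F"
    then obtain r where r: "Factorial_Ring.prime r" "r * card ?F dvd card ?D" using prime_quot[OF D FD] by blast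
    then obtain z V where V: "z \<in> ?D" "maximal_subgroup V G" "z \<notin> V"
      using maximal_supplement_of_prime_dvd[OF r(1) D FD r(2)] by blast
    have "carrier G = ?D <#> V" using maximal_normal_factorization[OF Dn V(2)] V(1,3) by blast
    then have "carrier G \<subseteq> L <#> V" using mono_set_mult[of ?D L V V G] by blast
    moreover have "L <#> V \<subseteq> carrier G"
      using LD(1) maximal_subgroupD(1)[OF V(2)] by (simp add: setmult_subset_G subgroup.subset)
    ultimately have "carrier G = L <#> V" by blast
    moreover have "V \<noteq> M" using V by blast
    ultimately show False using nonadj[OF L(2) V(2) LM] by blast
  qed
  then have "card M = p * card ?F" using cM by simp
  then show ?thesis using p(1) q(1) \<open>p \<noteq> q\<close> M Mn LD(1) nonnormal[OF L(2) LM] by blast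
qed

end

section \<open>Powers modulo prime powers\<close>

text \<open>If \<open>c \<equiv> 1\<close> modulo \<open>p\<^sup>k\<close> with \<open>k \<ge> 1\<close>, then \<open>c\<^sup>p - 1 = (c - 1)(1 + c + \<dots> + c\<^sup>p\<^sup>-\<^sup>1)\<close> gains a factor \<open>p\<close>, as the
  second factor is \<open>p\<close> modulo \<open>p\<close>.\<close>

lemma cong_one_prime_power:
  fixes a :: nat
  assumes p: "Factorial_Ring.prime p" and a: "[a = 1] (mod p)"
  shows "[a ^ (p ^ k) = 1] (mod p ^ Suc k)"
proof (induction k)
  case 0
  show ?case using a by simp
next
  case (Suc k)
  define c where "c = int (a ^ (p ^ k))"
  have c1: "int p ^ Suc k dvd c - 1"
    using Suc cong_int_iff[of "a ^ (p ^ k)" 1 "p ^ Suc k"] unfolding c_def by (simp add: cong_iff_dvd_diff)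
  then have "int p dvd c - 1" by (metis dvd_mult_left power_Suc)
  then have "[c = 1] (mod int p)" by (simp add: cong_iff_dvd_diff)
  then have "[(\<Sum>i<p. c ^ i) = (\<Sum>i<p. 1 ^ i)] (mod int p)" by (intro cong_sum cong_pow) auto
  then have "int p dvd (\<Sum>i<p. c ^ i)" by (simp add: cong_def dvd_eq_mod_eq_0)
  then have "int p ^ Suc k * int p dvd (c - 1) * (\<Sum>i<p. c ^ i)" using c1 by (rule mult_dvd_mono[rotated])
  then have "int p ^ Suc (Suc k) dvd c ^ p - 1" by (simp add: power_diff_1_eq mult.commute)
  then have "[int ((a ^ (p ^ k)) ^ p) = int 1] (mod int (p ^ Suc (Suc k)))"
    unfolding c_def by (simp add: cong_iff_dvd_diff)
  then show ?case unfolding cong_int_iff by (simp add: power_mult[symmetric] mult.commute)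
qed

text \<open>Fermat's little theorem, iterated.\<close>

lemma prime_power_cong_self:
  fixes a :: nat
  assumes p: "Factorial_Ring.prime p" shows "[a ^ (p ^ k) = a] (mod p)"
proof (induction k)
  case 0
  show ?case by simp
next
  case (Suc k)
  have fermat: "[a ^ p = a] (mod p)"
  proof (cases "p dvd a")
    case True
    then have "p dvd a ^ p" using p prime_gt_0_nat dvd_power by (metis dvd_trans)
    then show ?thesis using True by (simp add: cong_def dvd_eq_mod_eq_0)
  next
    case False
    have "[a * a ^ (p - 1) = a * 1] (mod p)" by (intro cong_mult fermat_theorem p False cong_refl)
    then show ?thesis using p prime_gt_0_nat by (metis mult.right_neutral power_eq_if not_gr0)
  qed
  have "[(a ^ (p ^ k)) ^ p = a ^ p] (mod p)" using Suc by (rule cong_pow)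
  then show ?case using fermat by (simp add: power_mult[symmetric] mult.commute cong_trans)
qed

section \<open>Lifting the structure of the Frattini quotient\<close>

context group begin

lemma nat_pow_cong:
  assumes x: "x \<in> carrier G" and n: "x [^] (n::nat) = \<one>" and ij: "[i = j] (mod n)"
  shows "x [^] (i::nat) = x [^] j"
proof -
  have "x [^] k = x [^] (k mod n)" for k
  proof -
    have "x [^] (n * (k div n)) = \<one>" using x n by (metis nat_pow_one nat_pow_pow)
    then have "x [^] (n * (k div n) + k mod n) = x [^] (k mod n)"
      using x by (subst nat_pow_mult[symmetric]) auto
    then show ?thesis by simp
  qed
  then show ?thesis using ij unfolding cong_def by metis
qed

text \<open>Centralizers are subgroups.\<close>

lemma comm_of_generators:
  assumes x: "x \<in> carrier G" and y: "y \<in> carrier G" and xy: "x \<otimes> y = y \<otimes> x"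
    and gen: "generate G {x, y} = carrier G" and g: "g \<in> carrier G" and h: "h \<in> carrier G"
  shows "g \<otimes> h = h \<otimes> g"
proof -
  have C: "subgroup {c \<in> carrier G. c \<otimes> z = z \<otimes> c} G" if z: "z \<in> carrier G" for z
  proof (rule subgroupI)
    show "inv a \<in> {c \<in> carrier G. c \<otimes> z = z \<otimes> c}" if "a \<in> {c \<in> carrier G. c \<otimes> z = z \<otimes> c}" for a
    proof -
      have a: "a \<in> carrier G" "a \<otimes> z = z \<otimes> a" using that by auto
      have "inv a \<otimes> z = inv a \<otimes> (z \<otimes> a) \<otimes> inv a" using a(1) z by (simp add: m_assoc)
      also have "\<dots> = inv a \<otimes> (a \<otimes> z) \<otimes> inv a" using a(2) by simp
      also have "\<dots> = z \<otimes> inv a" using a(1) z by (simp add: m_assoc[symmetric])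
      finally show ?thesis using a by simp
    qed
    show "a \<otimes> b \<in> {c \<in> carrier G. c \<otimes> z = z \<otimes> c}"
      if "a \<in> {c \<in> carrier G. c \<otimes> z = z \<otimes> c}" "b \<in> {c \<in> carrier G. c \<otimes> z = z \<otimes> c}" for a b
    proof -
      have c: "a \<in> carrier G" "b \<in> carrier G" "a \<otimes> z = z \<otimes> a" "b \<otimes> z = z \<otimes> b" using that by auto
      have "a \<otimes> b \<otimes> z = a \<otimes> z \<otimes> b" using c(1,2,4) z by (simp add: m_assoc)
      also have "\<dots> = z \<otimes> (a \<otimes> b)" using c(1-3) z by (simp add: m_assoc)
      finally show ?thesis using c by simp
    qed
  qed (use z in auto)
  have gen': "c \<otimes> z = z \<otimes> c" if "x \<otimes> z = z \<otimes> x" "y \<otimes> z = z \<otimes> y" "z \<in> carrier G" "c \<in> carrier G" for c z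
  proof -
    have "{x, y} \<subseteq> {c \<in> carrier G. c \<otimes> z = z \<otimes> c}" using that(1,2) x y by blast
    from generate_subgroup_incl[OF this C[OF that(3)]] show ?thesis using that(4) gen by blast
  qed
  have "g \<otimes> x = x \<otimes> g" "g \<otimes> y = y \<otimes> g"
    using gen'[OF HOL.refl xy[symmetric] x g] gen'[OF xy HOL.refl y g] by blast+
  then have "h \<otimes> g = g \<otimes> h" using gen'[OF _ _ g h] by simp
  then show ?thesis by simp
qed

end

context finite_group begin

text \<open>The order of \<open>z N\<close> divides the order of \<open>K / N\<close>.\<close>

lemma pow_index_mem_normal:
  assumes N: "N \<lhd> G" and K: "subgroup K G" and NK: "N \<subseteq> K" and c: "card K = r * card N" and z: "z \<in> K"
  shows "z [^] r \<in> N"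
proof -
  let ?K = "G\<lparr>carrier := K\<rparr>"
  interpret K: group ?K by (rule subgroup_imp_group[OF K])
  interpret N: normal N ?K using normal_restrict_supergroup[OF K N NK] .
  interpret Q: group "?K Mod N" by (rule N.factorgroup_is_group)
  have Nsub: "subgroup N G" using N by (rule normal_imp_subgroup)
  have "order (?K Mod N) * card N = card K"
    using K.lagrange[OF N.subgroup_axioms] by (simp add: order_def FactGroup_def)
  then have o: "order (?K Mod N) = r" using c card_subgroup_pos[OF Nsub] by simp
  have "N #>\<^bsub>?K\<^esub> z \<in> carrier (?K Mod N)" using z by (auto simp: carrier_FactGroup)
  then have "(N #>\<^bsub>?K\<^esub> z) [^]\<^bsub>?K Mod N\<^esub> r = N" using Q.pow_order_eq_1 o by fastforce
  then have "N #> (z [^] r) = N" using N.FactGroup_pow[of z r] z by (simp add: nat_pow_consistent[symmetric])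
  then show ?thesis
    using coset_join1[of N "z [^] r"] Nsub z K by (meson nat_pow_closed subgroup.mem_carrier subgroup.subset)
qed

text \<open>The reconstruction of a noncommutative \<open>G\<close> with a Frattini quotient of order \<open>p q\<close>. The only
  delicate point is that the Sylow \<open>p\<close>-subgroup \<open>P\<close> is cyclic. It suffices to find \<open>x \<in> P\<close> outside \<open>\<Phi>\<close>
  such that \<open>y\<close> normalizes \<open>\<langle>x\<rangle>\<close>, because \<open>x\<close> and \<open>y\<close> generate \<open>G\<close> modulo \<open>\<Phi>\<close>. Such an \<open>x\<close> is a fixed
  point of a map \<open>s\<close> of order dividing \<open>q\<close> on a set whose size is prime to \<open>q\<close>.\<close>

lemma metacyclic_lift:
  assumes p: "Factorial_Ring.prime p" and q: "Factorial_Ring.prime q" and pq: "p \<noteq> q"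
    and M: "maximal_subgroup M G" and Mn: "M \<lhd> G"
    and cG: "card (carrier G) = q * card M" and cM: "card M = p * card (frattini G)"
    and noncomm: "a0 \<in> carrier G" "b0 \<in> carrier G" "a0 \<otimes> b0 \<noteq> b0 \<otimes> a0"
  shows "\<exists>x y m n l. x \<in> carrier G \<and> y \<in> carrier G \<and> m \<ge> 1 \<and> n \<ge> 1 \<and> x [^] (p ^ m) = \<one> \<and>
    y [^] (q ^ n) = \<one> \<and> inv y \<otimes> x \<otimes> y = x [^] (l::nat) \<and> generate G {x, y} = carrier G \<and>
    card (carrier G) = p ^ m * q ^ n \<and> [l ^ q = 1] (mod p ^ m) \<and> \<not> [l = 1] (mod p ^ m)"
proof -
  let ?F = "frattini G"
  note MD = maximal_subgroupD[OF M]
  note F = normal_frattini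
  note Fsub = subgroup_frattini
  have p1: "p > 1" and q1: "q > 1" using p q prime_gt_1_nat by auto
  have FM: "?F \<subseteq> M" using frattini_le_maximal[OF M] .
  have cF: "card ?F > 0" using card_subgroup_pos[OF Fsub] .
  define m where "m = multiplicity p (card M)"
  have cM0: "card M \<noteq> 0" using card_subgroup_pos[OF MD(1)] by simp
  obtain w where w: "card M = p ^ m * w" "\<not> p dvd w"
    unfolding m_def using multiplicity_decompose'[of "card M" p] cM0 p1 by auto
  have m1: "m \<ge> 1" using w cM by (cases m) auto
  obtain P where P: "subgroup P G" "P \<subseteq> M" "card P = p ^ m"
    using exists_sylow_subgroup[OF p MD(1)] unfolding m_def by blast
  have Pc: "z \<in> carrier G" if "z \<in> P" for z using that P(1) by (meson subgroup.mem_carrier)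
  have PF: "\<not> P \<subseteq> ?F"
  proof
    assume "P \<subseteq> ?F"
    then have "p * p ^ m dvd p * card ?F" using card_subgroup_dvd[OF P(1) Fsub] P(3) by simp
    then have "p ^ m * p dvd p ^ m * w" using cM w by (simp add: mult.commute)
    then show False using w p1 by simp
  qed
  have FPsub: "subgroup (?F <#> P) G" using subgroup_normal_set_mult[OF F P(1)] .
  have FFP: "?F \<subseteq> ?F <#> P" using set_mult_subset_left[OF P(1) subgroup.subset[OF Fsub]] .
  have PFP: "P \<subseteq> ?F <#> P" using set_mult_subset_right[OF Fsub subgroup.subset[OF P(1)]] .
  have "?F <#> P \<subseteq> M" using FM P(2) MD(1) unfolding set_mult_def by (auto intro: subgroup.m_closed)
  then have FPM: "?F <#> P = M"
    using prime_index_intermediate[OF Fsub FPsub MD(1) FFP _ p cM] PF PFP by blast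
  have Pn: "P \<lhd> G"
    using frattini_argument[OF Mn P(1,2) p P(3) w] FPM commut_normal[OF P(1) F] by simp
  \<comment> \<open>as \<open>|M : \<Phi>|\<close> is prime, \<open>M\<close> is the only maximal subgroup that meets \<open>M\<close> outside \<open>\<Phi>\<close>\<close>
  have above: "R = M" if "maximal_subgroup R G" "z \<in> R" "z \<in> M" "z \<notin> ?F" for R z
  proof -
    have "subgroup (R \<inter> M) G" using maximal_subgroupD(1)[OF that(1)] MD(1) by (rule subgroups_Inter_pair)
    then have "R \<inter> M = M"
      using prime_index_intermediate[OF Fsub _ MD(1) _ _ p cM, of "R \<inter> M"] FM frattini_le_maximal[OF that(1)] that
      by blast
    then show ?thesis using MD(3)[OF maximal_subgroupD(1)[OF that(1)]] maximal_subgroupD(2)[OF that(1)] by blast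
  qed
  obtain y j where y: "y \<in> carrier G" "y \<notin> M" "y [^] (q ^ j) = \<one>"
    using exists_prime_power_element[OF q subgroup_self MD(1) subgroup.subset[OF MD(1)]] cG by auto
  have "ord y dvd q ^ j" using y by (simp add: pow_eq_id)
  then obtain n where n: "ord y = q ^ n" using q divides_primepow_nat by blast
  have n1: "n \<ge> 1"
  proof (rule ccontr)
    assume "\<not> n \<ge> 1"
    then have "ord y = 1" using n by (cases n) auto
    then have "y = \<one>" using ord_eq_1[OF y(1)] by blast
    then show False using y MD(1) subgroup.one_closed by blast
  qed
  have yn: "y [^] (q ^ n) = \<one>" using n y by (metis pow_ord_eq_1)
  let ?Y = "generate G {y}"
  have Y: "subgroup ?Y G" using y by (intro generate_is_subgroup) auto
  have cY: "card ?Y = q ^ n" using generate_pow_card[OF y(1)] n by simp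
  have triv: "A \<inter> B = {\<one>}" if A: "subgroup A G" "card A = p ^ i" and B: "subgroup B G" "card B = q ^ k" for A B i k
  proof -
    have I: "subgroup (A \<inter> B) G" using A(1) B(1) by (rule subgroups_Inter_pair)
    have "coprime (p ^ i) (q ^ k)" using p q pq by (simp add: primes_coprime)
    then have "card (A \<inter> B) = 1"
      using card_subgroup_dvd[OF I A(1)] card_subgroup_dvd[OF I B(1)] A(2) B(2) by (metis Int_lower1 Int_lower2 coprime_common_divisor_nat)
    then show ?thesis using subgroup.one_closed[OF I] card_1_singletonE by (metis singletonD)
  qed
  have PY: "P <#> ?Y = carrier G"
  proof (rule subgroup_eq_carrierI[OF subgroup_normal_set_mult[OF Pn Y]])
    fix R assume R: "maximal_subgroup R G"
    show "\<not> P <#> ?Y \<subseteq> R"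
    proof
      assume sub: "P <#> ?Y \<subseteq> R"
      have "P \<subseteq> R" using sub set_mult_subset_left[OF Y subgroup.subset[OF P(1)]] by blast
      moreover have "y \<in> R" using sub set_mult_subset_right[OF P(1) subgroup.subset[OF Y]] generate.incl[of y "{y}" G] by blast
      ultimately show False using above[OF R] PF P(2) y(2) by blast
    qed
  qed
  have card_G: "card (carrier G) = p ^ m * q ^ n"
    using card_set_mult[OF P(1) Y] triv[OF P(1,3) Y cY] PY P(3) cY by simp
  have yqM: "y [^] q \<in> M" using pow_index_mem_normal[OF Mn subgroup_self subgroup.subset[OF MD(1)] cG y(1)] .
  \<comment> \<open>\<open>y\<^sup>q \<in> M\<close> has \<open>q\<close>-power order, while \<open>M / \<Phi>\<close> has order \<open>p\<close>\<close>
  have yqF: "y [^] q \<in> ?F"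
  proof (rule mem_of_coprime_powers[OF Fsub])
    show "(y [^] q) [^] p \<in> ?F" using pow_index_mem_normal[OF F MD(1) FM cM yqM] .
    show "(y [^] q) [^] (q ^ n) \<in> ?F"
      using y yn subgroup.one_closed[OF Fsub] by (metis mult.commute nat_pow_one nat_pow_pow)
    show "coprime p (q ^ n)" using p q pq by (simp add: primes_coprime)
  qed (use y in auto)
  \<comment> \<open>\<open>\<langle>y\<^sup>q\<rangle>\<close> is a Sylow \<open>q\<close>-subgroup of \<open>\<Phi>\<close>, so it is normal in \<open>G\<close> and commutes with \<open>P\<close>\<close>
  let ?S = "generate G {y [^] q}"
  have S: "subgroup ?S G" using y by (intro generate_is_subgroup) auto
  have SF: "?S \<subseteq> ?F" using generate_subgroup_incl[OF _ Fsub] yqF by simp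
  obtain n' where n': "n = Suc n'" using n1 by (cases n) auto
  have cS: "card ?S = q ^ n'"
    using generate_pow_card[of "y [^] q"] ord_pow_gen[OF y(1), of q] y(1) n n' q1 by simp
  obtain m' where m': "m = Suc m'" using m1 by (cases m) auto
  have "q * p * card ?F = q * p * (q ^ n' * p ^ m')" using card_G cG cM unfolding m' n' by (simp add: ac_simps)
  then have cF': "card ?F = q ^ n' * p ^ m'" using p1 q1 by simp
  have "?S \<lhd> G"
  proof (rule frattini_argument[OF F S SF q cS cF'])
    show "\<not> q dvd p ^ m'" using p q pq by (metis prime_dvd_power primes_dvd_imp_eq)
    show "?F \<subseteq> ?S <#> ?F" using set_mult_subset_right[OF S subgroup.subset[OF Fsub]] .
  qed
  then have central: "z \<otimes> y [^] q = y [^] q \<otimes> z" if "z \<in> P" for z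
    using normal_imp_commuting[OF Pn _ _ that, of ?S "y [^] q"] triv[OF P(1,3) S cS] generate.incl[of "y [^] q" "{y [^] q}" G]
    by blast
  obtain x0 where x0: "x0 \<in> P" "x0 \<notin> ?F" using PF by blast
  let ?W = "P \<inter> ?F"
  have W: "subgroup ?W G" using P(1) Fsub by (rule subgroups_Inter_pair)
  have Wn: "?W \<lhd> G" using Pn F W unfolding normal_inv_iff by blast
  have "card M * card ?W = card ?F * card P" using card_set_mult[OF Fsub P(1)] FPM by (simp add: Int_commute)
  then have cPW: "card P = p * card ?W" using cM cF by simp
  then have cW: "card ?W = p ^ m'" using P(3) p1 unfolding m' by simp
  interpret W: normal ?W G by (rule Wn)
  note [simp del] = one_FactGroup mult_FactGroup
  let ?Q = "G Mod ?W"
  let ?h = "\<lambda>u. ?W #> u"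
  interpret Q: group ?Q by (rule W.factorgroup_is_group)
  interpret h: group_hom G ?Q ?h
    by (unfold_locales) (rule W.r_coset_hom_Mod)
  have h1: "?h u = \<one>\<^bsub>?Q\<^esub> \<longleftrightarrow> u \<in> ?W" if "u \<in> carrier G" for u
    unfolding one_FactGroup
    using coset_join1[OF _ that W] coset_join2[OF that W] by blast
  define t where "t = ?h x0"
  have x0c: "x0 \<in> carrier G" using Pc x0 by blast
  have tc: "t \<in> carrier ?Q" unfolding t_def using x0c h.hom_closed by blast
  have t1: "t \<noteq> \<one>\<^bsub>?Q\<^esub>" unfolding t_def using h1[OF x0c] x0 by blast
  have tp: "t [^]\<^bsub>?Q\<^esub> p = \<one>\<^bsub>?Q\<^esub>"
    using pow_index_mem_normal[OF Wn P(1) _ cPW x0(1)] h1[of "x0 [^] p"] x0c unfolding t_def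
    by (simp add: h.hom_nat_pow[symmetric])
  have ord_t: "Q.ord t = p"
    using tp t1 tc p by (metis Q.ord_eq_1 Q.pow_eq_id prime_nat_iff)
  have pow_t: "t [^]\<^bsub>?Q\<^esub> i = t [^]\<^bsub>?Q\<^esub> k" if "[i = k] (mod p)" for i k :: nat
    using Q.nat_pow_cong[OF tc tp that] .
  let ?Z = "generate G {x0}"
  have Z: "subgroup ?Z G" using x0c by (intro generate_is_subgroup) auto
  have WZ: "subgroup (?W <#> ?Z) G" using subgroup_normal_set_mult[OF Wn Z] .
  have ZP: "?Z \<subseteq> P" using generate_subgroup_incl[OF _ P(1)] x0 by simp
  have "?W <#> ?Z \<subseteq> P" using ZP P(1) unfolding set_mult_def by (auto intro: subgroup.m_closed)
  moreover have "x0 \<in> ?W <#> ?Z"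
    using set_mult_subset_right[OF W subgroup.subset[OF Z]] generate.incl[of x0 "{x0}" G] by blast
  moreover have "?W \<subseteq> ?W <#> ?Z" using set_mult_subset_left[OF Z subgroup.subset[OF W]] .
  ultimately have WZP: "?W <#> ?Z = P"
    using prime_index_intermediate[OF W WZ P(1) _ _ p cPW] x0 by blast
  have powers: "\<exists>k::nat. ?h z = t [^]\<^bsub>?Q\<^esub> k" if z: "z \<in> P" for z
  proof -
    obtain u v where uv: "u \<in> ?W" "v \<in> ?Z" "z = u \<otimes> v" using z WZP unfolding set_mult_def by blast
    obtain k :: nat where k: "v = x0 [^] k" using uv(2) generate_pow_on_finite_carrier[OF finite_carrier x0c] by blast
    have uc: "u \<in> carrier G" using uv Pc by blast
    have "?h z = ?h u \<otimes>\<^bsub>?Q\<^esub> ?h (x0 [^] k)" unfolding uv(3) k using uc x0c by (intro h.hom_mult) auto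
    also have "?h u = \<one>\<^bsub>?Q\<^esub>" using h1[OF uc] uv(1) by blast
    also have "\<one>\<^bsub>?Q\<^esub> \<otimes>\<^bsub>?Q\<^esub> ?h (x0 [^] k) = ?h (x0 [^] k)" using x0c by (intro Q.l_one h.hom_closed) auto
    also have "\<dots> = t [^]\<^bsub>?Q\<^esub> k" unfolding t_def using x0c by (rule h.hom_nat_pow)
    finally show ?thesis by blast
  qed
  have conjP: "inv v \<otimes> z \<otimes> v \<in> P" if "z \<in> P" "v \<in> carrier G" for z v
    using normal.inv_op_closed1[OF Pn] that by blast
  \<comment> \<open>\<open>y\<close> acts on \<open>P / (P \<inter> \<Phi>)\<close> by \<open>t \<mapsto> t\<^sup>a\<close>, where \<open>a\<^sup>q \<equiv> 1\<close> modulo \<open>p\<close>\<close>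
  obtain a :: nat where a: "?h (inv y \<otimes> x0 \<otimes> y) = t [^]\<^bsub>?Q\<^esub> a"
    using powers[OF conjP[OF x0(1) y(1)]] by blast
  let ?y = "?h y"
  have yc: "?y \<in> carrier ?Q" using y(1) h.hom_closed by blast
  have h_conj: "?h (inv y \<otimes> u \<otimes> y) = inv\<^bsub>?Q\<^esub> ?y \<otimes>\<^bsub>?Q\<^esub> ?h u \<otimes>\<^bsub>?Q\<^esub> ?y" if "u \<in> carrier G" for u
  proof -
    have "?h (inv y \<otimes> u \<otimes> y) = ?h (inv y \<otimes> u) \<otimes>\<^bsub>?Q\<^esub> ?y" using that y(1) by (intro h.hom_mult) auto
    also have "?h (inv y \<otimes> u) = ?h (inv y) \<otimes>\<^bsub>?Q\<^esub> ?h u" using that y(1) by (intro h.hom_mult) auto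
    also have "?h (inv y) = inv\<^bsub>?Q\<^esub> ?y" using y(1) by (rule h.hom_inv)
    finally show ?thesis .
  qed
  have conj_t: "inv\<^bsub>?Q\<^esub> ?y \<otimes>\<^bsub>?Q\<^esub> t \<otimes>\<^bsub>?Q\<^esub> ?y = t [^]\<^bsub>?Q\<^esub> a" using a h_conj[OF x0c] unfolding t_def by simp
  have conj_t_pow: "inv\<^bsub>?Q\<^esub> ?y \<otimes>\<^bsub>?Q\<^esub> (t [^]\<^bsub>?Q\<^esub> k) \<otimes>\<^bsub>?Q\<^esub> ?y = t [^]\<^bsub>?Q\<^esub> (a * k)" for k :: nat
    using Q.conj_nat_pow[of "inv\<^bsub>?Q\<^esub> ?y" t k] yc tc conj_t by (simp add: Q.nat_pow_pow)
  have inv_y_pow: "inv (y [^] Suc k) \<otimes> u \<otimes> y [^] Suc k = inv y \<otimes> (inv (y [^] k) \<otimes> u \<otimes> y [^] k) \<otimes> y"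
    if "u \<in> carrier G" for k u
    using that y(1) by (simp add: inv_mult_group m_assoc)
  have iter: "?h (inv (y [^] k) \<otimes> x0 \<otimes> y [^] k) = t [^]\<^bsub>?Q\<^esub> (a ^ k)" for k :: nat
  proof (induction k)
    case 0
    show ?case using x0c tc by (simp add: t_def)
  next
    case (Suc k)
    have "?h (inv (y [^] Suc k) \<otimes> x0 \<otimes> y [^] Suc k) =
        inv\<^bsub>?Q\<^esub> ?y \<otimes>\<^bsub>?Q\<^esub> ?h (inv (y [^] k) \<otimes> x0 \<otimes> y [^] k) \<otimes>\<^bsub>?Q\<^esub> ?y"
      unfolding inv_y_pow[OF x0c] using y(1) x0c by (intro h_conj) auto
    then show ?case using Suc conj_t_pow by simp
  qed
  have fixP: "inv (y [^] q) \<otimes> z \<otimes> y [^] q = z" if "z \<in> P" for z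
    using central[OF that] Pc[OF that] y(1) by (simp add: m_assoc) (simp add: m_assoc[symmetric])
  have "t [^]\<^bsub>?Q\<^esub> (a ^ q) = t" using iter[of q] fixP[OF x0(1)] by (simp add: t_def)
  then have "t [^]\<^bsub>?Q\<^esub> int (a ^ q) = t [^]\<^bsub>?Q\<^esub> (1::int)" unfolding int_pow_int using tc by simp
  then have "int p dvd 1 - int (a ^ q)" using Q.int_pow_eq[OF tc] ord_t by simp
  then have "[int (a ^ q) = int 1] (mod int p)" by (simp add: cong_iff_dvd_diff dvd_diff_commute)
  then have aq: "[a ^ q = 1] (mod p)" by (simp only: cong_int_iff)
  \<comment> \<open>\<open>l\<close> is congruent to \<open>a\<close> modulo \<open>p\<close>, but \<open>l\<^sup>q \<equiv> 1\<close> holds modulo \<open>p\<^sup>m\<close>; its inverse is \<open>b = l\<^sup>q\<^sup>-\<^sup>1\<close>\<close>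
  define l where "l = a ^ (p ^ m')"
  have lq: "[l ^ q = 1] (mod p ^ m)"
    using cong_one_prime_power[OF p aq, of m'] unfolding l_def m' by (simp add: power_mult[symmetric] mult.commute)
  have la: "[l = a] (mod p)" unfolding l_def using prime_power_cong_self[OF p] .
  define b where "b = l ^ (q - 1)"
  have lb: "l * b = l ^ q" unfolding b_def using q1 by (metis power_eq_if not_one_less_zero)
  have "[a * b = l * b] (mod p)" using la by (intro cong_mult) (auto simp: cong_sym)
  moreover have "[l * b = 1] (mod p)"
    using lq cong_dvd_modulus_nat[of "l ^ q" 1 "p ^ m" p] m1 unfolding lb by simp
  ultimately have ab: "[a * b = 1] (mod p)" by (rule cong_trans)
  \<comment> \<open>\<open>s\<close> maps the coset \<open>C\<close> to itself because \<open>a b \<equiv> 1\<close> modulo \<open>p\<close>; a fixed point \<open>u\<close> has \<open>u\<^sup>y = u\<^sup>l\<close>\<close>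
  define s where "s u = inv y \<otimes> u [^] b \<otimes> y" for u
  define C where "C = {u \<in> P. ?h u = t}"
  have "C = ?W #> x0"
  proof
    show "C \<subseteq> ?W #> x0"
    proof
      fix u assume "u \<in> C"
      then have "u \<in> P" "?W #> u = ?W #> x0" unfolding C_def t_def by auto
      then show "u \<in> ?W #> x0" using rcos_self[OF Pc W] by auto
    qed
    show "?W #> x0 \<subseteq> C"
    proof
      fix u assume u: "u \<in> ?W #> x0"
      then obtain v where v: "v \<in> ?W" "u = v \<otimes> x0" unfolding r_coset_def by blast
      have "u \<in> P" using v x0 P(1) by (auto intro: subgroup.m_closed)
      moreover have "?h u = t" unfolding t_def using repr_independence[OF u x0c W] by simp
      ultimately show "u \<in> C" unfolding C_def by blast
    qed
  qed
  then have cC: "card C = p ^ m'"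
    using card_rcosets_equal[OF rcosetsI[OF subgroup.subset[OF W] x0c] subgroup.subset[OF W]] cW by simp
  have "\<exists>u\<in>C. s u = u"
  proof (rule prime_order_map_fixed_point[OF q])
    show "finite C" using finite_subgroup[OF P(1)] unfolding C_def by simp
    show "\<not> q dvd card C" using p q pq unfolding cC by (metis prime_dvd_power primes_dvd_imp_eq)
    show "s u \<in> C" if u: "u \<in> C" for u
    proof -
      have uP: "u \<in> P" "?h u = t" using u unfolding C_def by auto
      have ub: "u [^] b \<in> P" using subgroup_nat_pow_closed[OF P(1) uP(1)] .
      have "s u \<in> P" unfolding s_def using conjP[OF ub y(1)] .
      moreover have "?h (u [^] b) = t [^]\<^bsub>?Q\<^esub> b" using h.hom_nat_pow[OF Pc[OF uP(1)]] uP(2) by simp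
      then have "?h (s u) = t [^]\<^bsub>?Q\<^esub> (a * b)" unfolding s_def h_conj[OF Pc[OF ub]] using conj_t_pow by simp
      then have "?h (s u) = t" using pow_t[OF ab] tc by simp
      ultimately show ?thesis unfolding C_def by blast
    qed
    show "(s ^^ q) u = u" if u: "u \<in> C" for u
    proof -
      have uP: "u \<in> P" "u \<in> carrier G" using u Pc unfolding C_def by auto
      have "(s ^^ k) u = inv (y [^] k) \<otimes> u [^] (b ^ k) \<otimes> y [^] k" for k
      proof (induction k)
        case 0
        show ?case using uP by simp
      next
        case (Suc k)
        have "(s ^^ Suc k) u = inv y \<otimes> (inv (y [^] k) \<otimes> u [^] (b ^ k) \<otimes> y [^] k) [^] b \<otimes> y"
          unfolding funpow.simps comp_apply Suc by (simp only: s_def)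
        also have "(inv (y [^] k) \<otimes> u [^] (b ^ k) \<otimes> y [^] k) [^] b = inv (y [^] k) \<otimes> u [^] (b ^ k * b) \<otimes> y [^] k"
          using conj_nat_pow[of "inv (y [^] k)" "u [^] (b ^ k)" b] y(1) uP by (simp add: nat_pow_pow)
        finally show ?case using inv_y_pow[of "u [^] (b ^ Suc k)" k] uP by (simp add: mult.commute)
      qed
      then have "(s ^^ q) u = u [^] (b ^ q)"
        using fixP[OF subgroup_nat_pow_closed[OF P(1) uP(1)]] by simp
      moreover have "[b ^ q = 1] (mod p ^ m)"
        using cong_pow[OF lq, of "q - 1"] unfolding b_def by (simp add: power_mult[symmetric] mult.commute)
      moreover have "u [^] (p ^ m) = \<one>" using pow_card_subgroup[OF P(1) uP(1)] P(3) by simp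
      ultimately show ?thesis using nat_pow_cong[OF uP(2), of "p ^ m" "b ^ q" 1] uP by simp
    qed
  qed
  then obtain x where x: "x \<in> P" "?h x = t" "s x = x" unfolding C_def by blast
  have xc: "x \<in> carrier G" using x Pc by blast
  have xm: "x [^] (p ^ m) = \<one>" using pow_card_subgroup[OF P(1) x(1)] P(3) by simp
  have xF: "x \<notin> ?F" using h1[OF xc] x t1 by blast
  have rel: "inv y \<otimes> x \<otimes> y = x [^] l"
  proof -
    have "x [^] l = (inv y \<otimes> x [^] b \<otimes> y) [^] l" using x(3) unfolding s_def by simp
    also have "\<dots> = inv y \<otimes> x [^] (l * b) \<otimes> y"
      using conj_nat_pow[of "inv y" "x [^] b" l] y(1) xc by (simp add: nat_pow_pow mult.commute)
    also have "x [^] (l * b) = x" using nat_pow_cong[OF xc xm, of "l * b" 1] lq lb xc by simp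
    finally show ?thesis by simp
  qed
  have gen: "generate G {x, y} = carrier G"
  proof (rule subgroup_eq_carrierI)
    show "subgroup (generate G {x, y}) G" using xc y(1) by (intro generate_is_subgroup) auto
    fix R assume R: "maximal_subgroup R G"
    show "\<not> generate G {x, y} \<subseteq> R"
    proof
      assume "generate G {x, y} \<subseteq> R"
      then have "x \<in> R" "y \<in> R" using generate.incl[of _ "{x, y}" G] by auto
      then show False using above[OF R, of x] x(1) P(2) xF y(2) by blast
    qed
  qed
  have "\<not> [l = 1] (mod p ^ m)"
  proof
    assume "[l = 1] (mod p ^ m)"
    then have "inv y \<otimes> x \<otimes> y = x" using rel nat_pow_cong[OF xc xm] xc by simp
    then have "x \<otimes> y = y \<otimes> x" using xc y(1) by (metis inv_closed inv_solve_left m_assoc m_closed)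
    then show False using comm_of_generators[OF xc y(1) _ gen noncomm(1,2)] noncomm(3) by blast
  qed
  then show ?thesis using xc y(1) m1 n1 xm yn rel gen card_G lq by blast
qed

end

section \<open>The factorization graph of a metacyclic group\<close>

context group begin

text \<open>Iterating \<open>z = z ^ (r i)\<close> yields \<open>z\<close> as a power whose exponent is divisible by \<open>r\<^sup>k\<close>.\<close>

lemma eq_one_of_power_fixed:
  assumes z: "z \<in> carrier G" and zk: "z [^] (r ^ k :: nat) = \<one>" and zi: "z = z [^] (r * i :: nat)"
  shows "z = \<one>"
proof -
  have "z [^] ((r * i) ^ j) = z" for j
  proof (induction j)
    case 0
    show ?case using z by simp
  next
    case (Suc j)
    have "z [^] ((r * i) ^ Suc j) = (z [^] ((r * i) ^ j)) [^] (r * i)"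
      using z by (simp add: nat_pow_pow mult.commute)
    then show ?case using Suc zi by simp
  qed
  then have "z = z [^] (r ^ k * i ^ k)" by (metis power_mult_distrib)
  also have "\<dots> = (z [^] (r ^ k)) [^] (i ^ k)" using z by (simp add: nat_pow_pow)
  finally show ?thesis using zk by simp
qed

lemma conj_power_power:
  assumes x: "x \<in> carrier G" and y: "y \<in> carrier G" and rel: "inv y \<otimes> x \<otimes> y = x [^] (l::nat)"
  shows "inv (y [^] j) \<otimes> x [^] (k::nat) \<otimes> y [^] (j::nat) = x [^] (k * l ^ j)"
proof (induction j)
  case 0
  show ?case using x by simp
next
  case (Suc j)
  have "inv (y [^] Suc j) \<otimes> x [^] k \<otimes> y [^] Suc j = inv y \<otimes> (inv (y [^] j) \<otimes> x [^] k \<otimes> y [^] j) \<otimes> y"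
    using x y by (simp add: inv_mult_group m_assoc)
  also have "\<dots> = inv y \<otimes> x [^] (k * l ^ j) \<otimes> y" using Suc by simp
  also have "\<dots> = (x [^] l) [^] (k * l ^ j)" using conj_nat_pow[of "inv y" x "k * l ^ j"] x y rel by simp
  also have "\<dots> = x [^] (k * l ^ Suc j)" using x by (simp add: nat_pow_pow ac_simps)
  finally show ?case .
qed

end

context finite_group begin

lemma mem_generate_powers:
  "g \<in> carrier G \<Longrightarrow> z \<in> generate G {g} \<longleftrightarrow> (\<exists>k::nat. z = g [^] k)"
  using generate_pow_on_finite_carrier[OF finite_carrier] by blast

text \<open>All proper subgroups lie in \<open>\<langle>g\<^sup>r\<rangle>\<close>, which is therefore the only maximal subgroup.\<close>

lemma prime_power_cyclic_proper_subgroup: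
  fixes r k :: nat
  assumes g: "g \<in> carrier G" and gen: "\<And>h. h \<in> carrier G \<Longrightarrow> \<exists>i::nat. h = g [^] i"
    and r: "Factorial_Ring.prime r" and rk: "g [^] (r ^ k) = \<one>" and H: "proper_subgroup H G"
  shows "H \<subseteq> frattini G"
proof -
  let ?K = "generate G {g [^] r}"
  have K: "subgroup ?K G" using g by (intro generate_is_subgroup) auto
  have full: "L = carrier G" if L: "subgroup L G" "g \<in> L" for L
    using gen subgroup_nat_pow_closed[OF L] subgroup.subset[OF L(1)] by fastforce
  have below: "L \<subseteq> ?K" if L: "proper_subgroup L G" for L
  proof
    fix h assume h: "h \<in> L"
    have Ls: "subgroup L G" using L unfolding proper_subgroup_def by blast
    obtain i :: nat where i: "h = g [^] i" using gen h Ls by (meson subgroup.mem_carrier)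
    have "r dvd i"
    proof (rule ccontr)
      assume "\<not> r dvd i"
      then have "coprime i (r ^ k)" using r prime_imp_coprime by (metis coprime_commute coprime_power_right_iff)
      then have "g \<in> L" using mem_of_coprime_powers[OF Ls g, of i "r ^ k"] h i rk subgroup.one_closed[OF Ls] by simp
      then show False using full[OF Ls] L unfolding proper_subgroup_def by blast
    qed
    then obtain i' where "i = r * i'" by (elim dvdE)
    then have "h = (g [^] r) [^] i'" using i g by (simp add: nat_pow_pow)
    then show "h \<in> ?K" using mem_generate_powers[of "g [^] r"] g by blast
  qed
  have "?K \<noteq> carrier G"
  proof
    assume "?K = carrier G"
    then obtain i :: nat where "g = (g [^] r) [^] i" using mem_generate_powers[of "g [^] r" g] g by blast
    then have "g = \<one>" using eq_one_of_power_fixed[OF g rk, of i] g by (simp add: nat_pow_pow)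
    then have "H = carrier G" using full[of H] H subgroup.one_closed unfolding proper_subgroup_def by blast
    then show False using H unfolding proper_subgroup_def by blast
  qed
  then have "?K \<subseteq> M" if M: "maximal_subgroup M G" for M
    using below[of M] M maximal_subgroupD[OF M] K unfolding maximal_subgroup_def by blast
  then have "?K \<subseteq> frattini G" unfolding frattini_def using subgroup.subset[OF K] by blast
  then show ?thesis using below[OF H] by blast
qed

lemma factorization_graph_no_vertices:
  assumes "\<And>H. proper_subgroup H G \<Longrightarrow> H \<subseteq> frattini G"
  shows "bipartite (factorization_graph G) \<and> (\<nexists>H. isolated_vertex (factorization_graph G) H)"
proof -
  have "pverts (factorization_graph G) = {}" "parcs (factorization_graph G) = {}"
    using assms unfolding factorization_graph_def by auto
  then show ?thesis unfolding bipartite_def isolated_vertex_def by auto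
qed

text \<open>The orders of \<open>x\<close> and \<open>y\<close> may be proper divisors of \<open>p\<^sup>m\<close> and \<open>q\<^sup>n\<close>, and the action of \<open>y\<close> may be
  trivial; in this form the lemma applies to the cyclic groups and to every quotient of the
  presented groups.

  Let \<open>x\<close> and \<open>y\<close> be nontrivial and \<open>X = \<langle>x\<rangle>\<close>, \<open>N = X\<langle>y\<^sup>q\<rangle>\<close>. A subgroup \<open>U\<close> not inside \<open>N\<close> satisfies
  \<open>X U = G\<close> (\<open>outside\<close>), since \<open>y\<close> is a power of \<open>y\<^sup>j\<close> unless \<open>q\<close> divides \<open>j\<close>. A subgroup inside \<open>N\<close> but
  without \<open>x\<close> lies in \<open>\<langle>x\<^sup>p\<rangle>\<langle>y\<^sup>q\<rangle>\<close> (\<open>inside\<close>), and this is part of \<open>\<Phi>\<close> (\<open>maxl\<close>). Two subgroups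
  outside \<open>N\<close> are not adjacent: enlarged to maximal subgroups \<open>R\<close> and \<open>T\<close> they have index \<open>p\<close>, so
  \<open>G = R T\<close> would give \<open>|R : R \<inter> T| = p\<close>; but \<open>R \<inter> T\<close> contains \<open>R \<inter> N\<close>, and \<open>|R : R \<inter> N| = |G : N|\<close> is a
  power of \<open>q\<close>.\<close>

lemma metacyclic_factorization_graph:
  fixes p q m n :: nat
  assumes p: "Factorial_Ring.prime p" and q: "Factorial_Ring.prime q" and pq: "p \<noteq> q"
    and x: "x \<in> carrier G" and y: "y \<in> carrier G"
    and xm: "x [^] (p ^ m) = \<one>" and yn: "y [^] (q ^ n) = \<one>"
    and rel: "inv y \<otimes> x \<otimes> y = x [^] (l::nat)" and cent: "y [^] q \<otimes> x = x \<otimes> y [^] q"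
    and gen: "\<And>g. g \<in> carrier G \<Longrightarrow> \<exists>(j::nat) (i::nat). g = y [^] j \<otimes> x [^] i"
  shows "bipartite (factorization_graph G) \<and> (\<nexists>H. isolated_vertex (factorization_graph G) H)"
proof (cases "x = \<one> \<or> y = \<one>")
  case True
  then show ?thesis
  proof
    assume "x = \<one>"
    then have pow: "\<exists>i::nat. h = y [^] i" if h: "h \<in> carrier G" for h
    proof -
      obtain j i :: nat where "h = y [^] j \<otimes> x [^] i" using gen[OF h] by blast
      then show ?thesis using \<open>x = \<one>\<close> y by auto
    qed
    then show ?thesis
      by (intro factorization_graph_no_vertices prime_power_cyclic_proper_subgroup[OF y pow q yn])
  next
    assume "y = \<one>"
    then have pow: "\<exists>i::nat. h = x [^] i" if h: "h \<in> carrier G" for h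
    proof -
      obtain j i :: nat where "h = y [^] j \<otimes> x [^] i" using gen[OF h] by blast
      then show ?thesis using \<open>y = \<one>\<close> x by auto
    qed
    then show ?thesis
      by (intro factorization_graph_no_vertices prime_power_cyclic_proper_subgroup[OF x pow p xm])
  qed
next
  case False
  then have x1: "x \<noteq> \<one>" and y1: "y \<noteq> \<one>" by auto
  have p1: "p > 1" and q1: "q > 1" using p q prime_gt_1_nat by auto
  let ?F = "frattini G"
  have copq: "coprime (p ^ i) (q ^ j)" for i j using p q pq by (simp add: primes_coprime)
  have one_mem: "\<one> \<in> U" if "subgroup U G" for U using that by (rule subgroup.one_closed)
  note conj_y = conj_power_power[OF x y rel]
  have normal_power: "generate G {x [^] k} \<lhd> G" for k :: nat
  proof -
    let ?X = "generate G {x [^] k}"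
    have Xs: "subgroup ?X G" using x by (intro generate_is_subgroup) auto
    have inv_conj: "inv g \<otimes> z \<otimes> g \<in> ?X" if g: "g \<in> carrier G" and z: "z \<in> ?X" for g z
    proof -
      obtain i :: nat where i: "z = (x [^] k) [^] i" using z mem_generate_powers[of "x [^] k"] x by blast
      obtain j i' :: nat where g': "g = y [^] j \<otimes> x [^] i'" using gen[OF g] by blast
      have "inv g \<otimes> z \<otimes> g = inv (x [^] i') \<otimes> (inv (y [^] j) \<otimes> x [^] (k * i) \<otimes> y [^] j) \<otimes> x [^] i'"
        unfolding g' i using x y by (simp add: inv_mult_group m_assoc nat_pow_pow)
      also have "\<dots> = inv (x [^] i') \<otimes> (x [^] (k * i * l ^ j) \<otimes> x [^] i')"
        using conj_y x by (simp add: m_assoc)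
      also have "x [^] (k * i * l ^ j) \<otimes> x [^] i' = x [^] i' \<otimes> x [^] (k * i * l ^ j)"
        using x by (simp add: nat_pow_mult add.commute)
      also have "inv (x [^] i') \<otimes> (x [^] i' \<otimes> x [^] (k * i * l ^ j)) = (x [^] k) [^] (i * l ^ j)"
        using x by (simp add: m_assoc[symmetric] nat_pow_pow mult.assoc)
      finally show ?thesis using mem_generate_powers[of "x [^] k"] x by blast
    qed
    show ?thesis
      unfolding normal_inv_iff using Xs inv_conj[OF inv_closed] by auto
  qed
  let ?X = "generate G {x}" and ?Xp = "generate G {x [^] p}" and ?Y = "generate G {y}" and ?S = "generate G {y [^] q}"
  have Xn: "?X \<lhd> G" using normal_power[of 1] x by simp
  have X: "subgroup ?X G" using Xn by (rule normal_imp_subgroup)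
  have Xpn: "?Xp \<lhd> G" by (rule normal_power)
  have Xp: "subgroup ?Xp G" using Xpn by (rule normal_imp_subgroup)
  have Y: "subgroup ?Y G" using y by (intro generate_is_subgroup) auto
  have S: "subgroup ?S G" using y by (intro generate_is_subgroup) auto
  have xX: "x \<in> ?X" and yY: "y \<in> ?Y" and ySq: "y [^] q \<in> ?S" and xpXp: "x [^] p \<in> ?Xp"
    by (auto intro: generate.incl)
  have central: "s \<otimes> g = g \<otimes> s" if s: "s \<in> ?S" and g: "g \<in> carrier G" for s g
  proof -
    obtain k :: nat where k: "s = (y [^] q) [^] k" using s mem_generate_powers[of "y [^] q"] y by blast
    obtain j i :: nat where ji: "g = y [^] j \<otimes> x [^] i" using gen[OF g] by blast
    have "x [^] i \<otimes> y [^] q = y [^] q \<otimes> x [^] i" using group_commutes_pow[of x "y [^] q" i] cent x y by simp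
    then have c: "y [^] q \<otimes> x [^] i = x [^] i \<otimes> y [^] q" by simp
    have "y [^] q \<otimes> g = y [^] j \<otimes> y [^] q \<otimes> x [^] i"
      unfolding ji using x y by (simp add: m_assoc[symmetric] nat_pow_comm)
    also have "\<dots> = g \<otimes> y [^] q" unfolding ji using c x y by (simp add: m_assoc)
    finally show ?thesis unfolding k using group_commutes_pow[of "y [^] q" g k] y g by simp
  qed
  have Sn: "?S \<lhd> G"
  proof -
    have "g \<otimes> s \<otimes> inv g \<in> ?S" if "g \<in> carrier G" "s \<in> ?S" for g s
    proof -
      have sc: "s \<in> carrier G" using that S by (meson subgroup.mem_carrier)
      have "g \<otimes> s \<otimes> inv g = s" using central[OF that(2,1), symmetric] that sc by (simp add: m_assoc)
      then show ?thesis using that by simp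
    qed
    then show ?thesis using S unfolding normal_inv_iff by blast
  qed
  have XY: "?X \<inter> ?Y = {\<one>}"
  proof -
    have "z = \<one>" if z: "z \<in> ?X" "z \<in> ?Y" for z
    proof -
      have zc: "z \<in> carrier G" using z X by (meson subgroup.mem_carrier)
      have "z [^] (p ^ m) = \<one>" using z(1) mem_generate_powers[OF x] x xm by (metis mult.commute nat_pow_one nat_pow_pow)
      moreover have "z [^] (q ^ n) = \<one>" using z(2) mem_generate_powers[OF y] y yn by (metis mult.commute nat_pow_one nat_pow_pow)
      ultimately have "z \<in> {\<one>}"
        using mem_of_coprime_powers[OF triv_subgroup zc _ _ copq[of m n]] by simp
      then show ?thesis by simp
    qed
    then show ?thesis using one_mem[OF X] one_mem[OF Y] by blast
  qed
  have xY: "x \<notin> ?Y" and yX: "y \<notin> ?X" using XY xX yY x1 y1 by auto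
  let ?N = "?X <#> ?S"
  have N: "subgroup ?N G" using subgroup_normal_set_mult[OF Xn S] .
  have XN: "?X \<subseteq> ?N" using set_mult_subset_left[OF S subgroup.subset[OF X]] .
  have SN: "?S \<subseteq> ?N" using set_mult_subset_right[OF X subgroup.subset[OF S]] .
  have full: "L = carrier G" if L: "subgroup L G" "x \<in> L" "y \<in> L" for L
  proof -
    have "g \<in> L" if g: "g \<in> carrier G" for g
      using gen[OF g] subgroup_nat_pow_closed[OF L(1,2)] subgroup_nat_pow_closed[OF L(1,3)] L(1)
      by (metis subgroup.m_closed)
    then show ?thesis using subgroup.subset[OF L(1)] by blast
  qed
  have yN: "y \<notin> ?N"
  proof
    assume "y \<in> ?N"
    then obtain z s where zs: "z \<in> ?X" "s \<in> ?S" "y = z \<otimes> s" unfolding set_mult_def by blast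
    have "?S \<subseteq> ?Y" using generate_subgroup_incl[OF _ Y] subgroup_nat_pow_closed[OF Y yY] by simp
    then have sY: "s \<in> ?Y" using zs by blast
    have c: "z \<in> carrier G" "s \<in> carrier G" using zs X S by (auto dest: subgroup.mem_carrier)
    have "z = y \<otimes> inv s" using zs(3) c by (simp add: m_assoc)
    then have "z \<in> ?Y" using yY sY Y by (simp add: subgroup.m_closed subgroup.m_inv_closed)
    then have "z = \<one>" using zs(1) XY by blast
    then have "y = s" using zs(3) c by simp
    then obtain k :: nat where "y = (y [^] q) [^] k" using zs(2) mem_generate_powers[of "y [^] q"] y by blast
    then have "y = y [^] (q * k)" using y by (simp add: nat_pow_pow)
    then show False using eq_one_of_power_fixed[OF y yn] y1 by blast
  qed
  have Nproper: "?N \<noteq> carrier G" using yN y by blast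
  \<comment> \<open>outside \<open>N\<close>: supplements of \<open>X\<close>\<close>
  have outside: "?X <#> U = carrier G" if U: "subgroup U G" and UN: "\<not> U \<subseteq> ?N" for U
  proof -
    let ?T = "?X <#> U"
    have T: "subgroup ?T G" using subgroup_normal_set_mult[OF Xn U] .
    have XT: "?X \<subseteq> ?T" using set_mult_subset_left[OF U subgroup.subset[OF X]] .
    have UT: "U \<subseteq> ?T" using set_mult_subset_right[OF X subgroup.subset[OF U]] .
    obtain u where u: "u \<in> U" "u \<notin> ?N" using UN by blast
    obtain j i :: nat where ji: "u = y [^] j \<otimes> x [^] i" using gen u U by (meson subgroup.mem_carrier)
    have "\<not> q dvd j"
    proof
      assume "q dvd j"
      then obtain j' where "j = q * j'" by (elim dvdE)
      then have "y [^] j = (y [^] q) [^] j'" using y by (simp add: nat_pow_pow)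
      then have "y [^] j \<in> ?N" using subgroup_nat_pow_closed[OF S ySq] SN by auto
      moreover have "x [^] i \<in> ?N" using subgroup_nat_pow_closed[OF X xX] XN by auto
      ultimately show False using u(2) N ji by (simp add: subgroup.m_closed)
    qed
    then have co: "coprime j (q ^ n)" using q prime_imp_coprime by (metis coprime_commute coprime_power_right_iff)
    have xT: "x \<in> ?T" using xX XT by blast
    have "y [^] j = u \<otimes> inv (x [^] i)" using ji x y by (simp add: m_assoc)
    moreover have "inv (x [^] i) \<in> ?T" using subgroup_nat_pow_closed[OF T xT] T by (simp add: subgroup.m_inv_closed)
    ultimately have "y [^] j \<in> ?T" using u(1) UT T by (auto intro: subgroup.m_closed)
    then have "y \<in> ?T" using mem_of_coprime_powers[OF T y _ _ co] yn one_mem[OF T] by simp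
    then show ?thesis using full[OF T xT] by blast
  qed
  have inside: "U \<subseteq> ?Xp <#> ?S" if U: "subgroup U G" and UN: "U \<subseteq> ?N" and xU: "x \<notin> U" for U
  proof
    fix u assume u: "u \<in> U"
    obtain z s where zs: "z \<in> ?X" "s \<in> ?S" "u = z \<otimes> s" using u UN unfolding set_mult_def by blast
    have c: "z \<in> carrier G" "s \<in> carrier G" using zs X S by (auto dest: subgroup.mem_carrier)
    obtain k :: nat where k: "z = x [^] k" using zs(1) mem_generate_powers[OF x] by blast
    obtain j :: nat where j: "s = (y [^] q) [^] j" using zs(2) mem_generate_powers[of "y [^] q"] y by blast
    have "s = y [^] (q * j)" unfolding j using y by (simp add: nat_pow_pow)
    then have "s [^] (q ^ n) = (y [^] (q ^ n)) [^] (q * j)" using y by (simp add: nat_pow_pow mult.commute)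
    then have s1: "s [^] (q ^ n) = \<one>" using yn by simp
    have "u [^] (q ^ n) = z [^] (q ^ n) \<otimes> s [^] (q ^ n)"
      unfolding zs(3) using c central[OF zs(2) c(1)] by (intro pow_mult_distrib) auto
    then have uq: "u [^] (q ^ n) = x [^] (k * q ^ n)" using s1 c k x by (simp add: nat_pow_pow)
    have "p dvd k"
    proof (rule ccontr)
      assume "\<not> p dvd k"
      then have "coprime k (p ^ m)" using p prime_imp_coprime by (metis coprime_commute coprime_power_right_iff)
      then have "coprime (k * q ^ n) (p ^ m)" using copq[of m n] by (simp add: coprime_commute)
      moreover have "x [^] (k * q ^ n) \<in> U" using subgroup_nat_pow_closed[OF U u] uq by metis
      moreover have "x [^] (p ^ m) \<in> U" using xm one_mem[OF U] by simp
      ultimately have "x \<in> U" using mem_of_coprime_powers[OF U x] by blast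
      then show False using xU by blast
    qed
    then obtain k' where "k = p * k'" by (elim dvdE)
    then have "z = (x [^] p) [^] k'" using k x by (simp add: nat_pow_pow)
    then have "z \<in> ?Xp" using mem_generate_powers[of "x [^] p"] x by blast
    then show "u \<in> ?Xp <#> ?S" using zs unfolding set_mult_def by blast
  qed
  \<comment> \<open>the powers of \<open>x\<close> outside \<open>\<langle>x\<^sup>p\<rangle>\<close> generate \<open>\<langle>x\<rangle>\<close>\<close>
  have power_mem: "x \<in> U" if U: "subgroup U G" and k: "x [^] (k::nat) \<in> U" "\<not> p dvd k" for U k
  proof -
    have "coprime k (p ^ m)" using k(2) p prime_imp_coprime by (metis coprime_commute coprime_power_right_iff)
    moreover have "x [^] (p ^ m) \<in> U" using xm one_mem[OF U] by simp
    ultimately show ?thesis using mem_of_coprime_powers[OF U x k(1)] by blast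
  qed
  have maxl: "x [^] p \<in> R \<and> y [^] q \<in> R" if R: "maximal_subgroup R G" for R
  proof (cases "x \<in> R")
    case True
    note RD = maximal_subgroupD[OF R]
    have XR: "?X \<subseteq> R" using generate_subgroup_incl[OF _ RD(1)] True by simp
    then have "?X <#> R \<subseteq> R" using RD(1) unfolding set_mult_def by (auto intro: subgroup.m_closed)
    then have "?X <#> R \<noteq> carrier G" using RD(1,2) subgroup.subset by blast
    then have "R \<subseteq> ?N" using outside[OF RD(1)] by blast
    then have "?N = R" using RD(3)[OF N] Nproper by blast
    then show ?thesis using SN ySq subgroup_nat_pow_closed[OF RD(1) True] by blast
  next
    case xR: False
    note RD = maximal_subgroupD[OF R]
    have extend: "A \<subseteq> R" if A: "A \<lhd> G" and xA: "x \<notin> A <#> R" for A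
    proof -
      have T: "subgroup (A <#> R) G" using subgroup_normal_set_mult[OF A RD(1)] .
      have "R \<subseteq> A <#> R" using set_mult_subset_right[OF normal_imp_subgroup[OF A] subgroup.subset[OF RD(1)]] .
      then have "A <#> R = R" using RD(3)[OF T] xA x by blast
      then show ?thesis using set_mult_subset_left[OF RD(1) subgroup.subset[OF normal_imp_subgroup[OF A]]] by simp
    qed
    have "x \<notin> ?Xp <#> R"
    proof
      assume "x \<in> ?Xp <#> R"
      then obtain z u where zu: "z \<in> ?Xp" "u \<in> R" "x = z \<otimes> u" unfolding set_mult_def by blast
      obtain i :: nat where i: "z = x [^] (p * i)" using zu(1) mem_generate_powers[of "x [^] p"] x by (auto simp: nat_pow_pow)
      have zX: "z \<in> ?X" using i subgroup_nat_pow_closed[OF X xX] by blast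
      have c: "z \<in> carrier G" "u \<in> carrier G" using i x zu(2) RD(1) by (auto dest: subgroup.mem_carrier)
      have "u = inv z \<otimes> x" using zu(3) c by (simp add: m_assoc[symmetric])
      then have "u \<in> ?X" using zX xX X by (simp add: subgroup.m_closed subgroup.m_inv_closed)
      then obtain k :: nat where k: "u = x [^] k" using mem_generate_powers[OF x] by blast
      have "p dvd k" using power_mem[OF RD(1), of k] zu(2) k xR by blast
      then obtain k' where k': "k = p * k'" by (elim dvdE)
      have "x = x [^] (p * (i + k'))" using zu(3) i k k' x by (simp add: nat_pow_mult distrib_left)
      then show False using eq_one_of_power_fixed[OF x xm] x1 by blast
    qed
    then have Xp: "?Xp \<subseteq> R" using extend[OF Xpn] by blast
    have "x \<notin> ?S <#> R"
    proof
      assume "x \<in> ?S <#> R"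
      then obtain s u where su: "s \<in> ?S" "u \<in> R" "x = s \<otimes> u" unfolding set_mult_def by blast
      have c: "s \<in> carrier G" "u \<in> carrier G" using su RD(1) S by (auto dest: subgroup.mem_carrier)
      obtain j :: nat where j: "s = (y [^] q) [^] j" using su(1) mem_generate_powers[of "y [^] q"] y by blast
      have "s = y [^] (q * j)" unfolding j using y by (simp add: nat_pow_pow)
      then have "s [^] (q ^ n) = (y [^] (q ^ n)) [^] (q * j)" using y by (simp add: nat_pow_pow mult.commute)
      then have s1: "s [^] (q ^ n) = \<one>" using yn by simp
      have "x [^] (q ^ n) = s [^] (q ^ n) \<otimes> u [^] (q ^ n)"
        unfolding su(3) using c central[OF su(1) c(2)] by (intro pow_mult_distrib) auto
      then have "x [^] (q ^ n) \<in> R" using s1 c subgroup_nat_pow_closed[OF RD(1) su(2)] by simp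
      moreover have "\<not> p dvd q ^ n" using p q pq by (metis prime_dvd_power primes_dvd_imp_eq)
      ultimately show False using power_mem[OF RD(1)] xR by blast
    qed
    then have "?S \<subseteq> R" using extend[OF Sn] by blast
    then show ?thesis using Xp ySq xpXp by blast
  qed
  have XpF: "?Xp \<subseteq> ?F" and SF: "?S \<subseteq> ?F"
    using generate_subgroup_incl[OF _ subgroup_frattini, of "{x [^] p}"]
      generate_subgroup_incl[OF _ subgroup_frattini, of "{y [^] q}"] maxl x y unfolding frattini_def by auto
  have XpSF: "?Xp <#> ?S \<subseteq> ?F"
    using XpF SF subgroup_frattini unfolding set_mult_def by (auto intro: subgroup.m_closed)
  have ord_x: "ord x = p * card ?Xp"
  proof -
    have "ord x dvd p ^ m" using xm x by (simp add: pow_eq_id)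
    then obtain e where e: "ord x = p ^ e" using p divides_primepow_nat by blast
    have "e \<noteq> 0" using e x1 ord_eq_1[OF x] by (cases e) auto
    then obtain e' where e': "e = Suc e'" by (cases e) auto
    have "ord (x [^] p) = p ^ e'" using ord_pow_gen[OF x, of p] e e' p1 by simp
    then show ?thesis using generate_pow_card[of "x [^] p"] x e e' by simp
  qed
  have index_p: "card (carrier G) = p * card R" if R: "maximal_subgroup R G" "\<not> R \<subseteq> ?N" for R
  proof -
    note RD = maximal_subgroupD[OF R(1)]
    have XR: "?X <#> R = carrier G" using outside[OF RD(1) R(2)] .
    have xR: "x \<notin> R"
    proof
      assume "x \<in> R"
      then have "?X \<subseteq> R" using generate_subgroup_incl[OF _ RD(1)] by simp
      then have "?X <#> R \<subseteq> R" using RD(1) unfolding set_mult_def by (auto intro: subgroup.m_closed)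
      then show False using XR RD(1,2) subgroup.subset by blast
    qed
    have "?X \<inter> R = ?Xp"
    proof
      show "?Xp \<subseteq> ?X \<inter> R"
        using generate_subgroup_incl[OF _ X, of "{x [^] p}"] subgroup_nat_pow_closed[OF X xX]
          generate_subgroup_incl[OF _ RD(1), of "{x [^] p}"] maxl[OF R(1)] by auto
      show "?X \<inter> R \<subseteq> ?Xp"
      proof
        fix z assume z: "z \<in> ?X \<inter> R"
        then obtain k :: nat where k: "z = x [^] k" using mem_generate_powers[OF x] by blast
        then have "p dvd k" using power_mem[OF RD(1), of k] z xR by blast
        then obtain k' where "k = p * k'" by (elim dvdE)
        then have "z = (x [^] p) [^] k'" using k x by (simp add: nat_pow_pow)
        then show "z \<in> ?Xp" using mem_generate_powers[of "x [^] p"] x by blast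
      qed
    qed
    then have "card (carrier G) * card ?Xp = p * card ?Xp * card R"
      using card_set_mult[OF X RD(1)] XR generate_pow_card[OF x] ord_x by simp
    then show ?thesis using card_subgroup_pos[OF Xp] by simp
  qed
  have no_edge: "carrier G \<noteq> U <#> V"
    if U: "proper_subgroup U G" "\<not> U \<subseteq> ?N" and V: "proper_subgroup V G" "\<not> V \<subseteq> ?N" for U V
  proof
    assume UV: "carrier G = U <#> V"
    obtain R where R: "maximal_subgroup R G" "U \<subseteq> R" using proper_subgroup_le_maximal[OF U(1)] by blast
    obtain T where T: "maximal_subgroup T G" "V \<subseteq> T" using proper_subgroup_le_maximal[OF V(1)] by blast
    have RN: "\<not> R \<subseteq> ?N" and TN: "\<not> T \<subseteq> ?N" using R T U V by blast+
    note RD = maximal_subgroupD[OF R(1)] and TD = maximal_subgroupD[OF T(1)]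
    have "carrier G \<subseteq> R <#> T" using UV R(2) T(2) mono_set_mult[of U R V T G] by blast
    moreover have "R <#> T \<subseteq> carrier G" using RD(1) TD(1) by (simp add: setmult_subset_G subgroup.subset)
    ultimately have RT: "R <#> T = carrier G" by blast
    have "card (carrier G) * card (R \<inter> T) = card R * card T"
      using card_set_mult[OF RD(1) TD(1)] RT by simp
    then have cR: "card R = p * card (R \<inter> T)"
      using index_p[OF T(1) TN] card_subgroup_pos[OF TD(1)] by simp
    have I: "subgroup (?N \<inter> R) G" using N RD(1) by (rule subgroups_Inter_pair)
    have xR: "x \<notin> R"
    proof
      assume "x \<in> R"
      then have "?X \<subseteq> R" using generate_subgroup_incl[OF _ RD(1)] by simp
      then have "?X <#> R \<subseteq> R" using RD(1) unfolding set_mult_def by (auto intro: subgroup.m_closed)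
      then show False using outside[OF RD(1) RN] RD(1,2) subgroup.subset by blast
    qed
    have "?N \<inter> R \<subseteq> ?Xp <#> ?S" using inside[OF I] xR by blast
    then have "?N \<inter> R \<subseteq> R \<inter> T" using XpSF frattini_le_maximal[OF R(1)] frattini_le_maximal[OF T(1)] by blast
    then obtain d where d: "card (R \<inter> T) = card (?N \<inter> R) * d"
      using card_subgroup_dvd[OF I subgroups_Inter_pair[OF RD(1) TD(1)]] by (auto elim!: dvdE)
    have NR: "?N <#> R = carrier G"
    proof -
      have "carrier G \<subseteq> ?N <#> R" using outside[OF RD(1) RN] mono_set_mult[OF XN, of R R G] by blast
      moreover have "?N <#> R \<subseteq> carrier G" using N RD(1) by (simp add: setmult_subset_G subgroup.subset)
      ultimately show ?thesis by blast
    qed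
    have NY: "?N <#> ?Y = carrier G"
    proof -
      have "\<not> ?Y \<subseteq> ?N" using yY yN by blast
      then have "carrier G \<subseteq> ?N <#> ?Y" using outside[OF Y] mono_set_mult[OF XN, of ?Y ?Y G] by blast
      moreover have "?N <#> ?Y \<subseteq> carrier G" using N Y by (simp add: setmult_subset_G subgroup.subset)
      ultimately show ?thesis by blast
    qed
    have NYs: "subgroup (?N \<inter> ?Y) G" using N Y by (rule subgroups_Inter_pair)
    obtain c where c: "card ?Y = card (?N \<inter> ?Y) * c"
      using card_subgroup_dvd[OF NYs Y] by (auto elim!: dvdE)
    have "card (carrier G) * card (?N \<inter> ?Y) = card ?N * c * card (?N \<inter> ?Y)"
      using card_set_mult[OF N Y] unfolding NY c by (simp only: ac_simps)
    then have cG: "card (carrier G) = card ?N * c" using card_subgroup_pos[OF NYs] by simp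
    have "card ?N * c * card (?N \<inter> R) = card ?N * (p * (card (?N \<inter> R) * d))"
      using card_set_mult[OF N RD(1)] unfolding NR cG cR d by simp
    then have "c = p * d" using card_subgroup_pos[OF N] card_subgroup_pos[OF I] by simp
    then have "p dvd card ?Y" using c by simp
    moreover have "card ?Y dvd q ^ n" using generate_pow_card[OF y] yn y by (simp add: pow_eq_id)
    ultimately have "p dvd q ^ n" by (rule dvd_trans)
    then show False using p q pq by (metis prime_dvd_power primes_dvd_imp_eq)
  qed
  have verts: "H \<in> pverts (factorization_graph G) \<longleftrightarrow> proper_subgroup H G \<and> \<not> H \<subseteq> ?F" for H
    unfolding factorization_graph_def by simp
  have "bipartite (factorization_graph G)"
    unfolding bipartite_def
  proof (intro exI conjI)
    let ?A = "{H \<in> pverts (factorization_graph G). H \<subseteq> ?N}" and ?B = "{H \<in> pverts (factorization_graph G). \<not> H \<subseteq> ?N}"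
    show "pverts (factorization_graph G) = ?A \<union> ?B" by blast
    show "?A \<inter> ?B = {}" by blast
    have "(U \<in> ?A \<and> V \<in> ?B) \<or> (U \<in> ?B \<and> V \<in> ?A)" if e: "(U, V) \<in> parcs (factorization_graph G)" for U V
    proof -
      have v: "U \<in> pverts (factorization_graph G)" "V \<in> pverts (factorization_graph G)"
        using e unfolding factorization_graph_def by auto
      have uv: "proper_subgroup U G" "proper_subgroup V G" "carrier G = U <#> V"
        using e factorization_graph_adjacent_iff by blast+
      have "\<not> (U \<subseteq> ?N \<and> V \<subseteq> ?N)"
      proof
        assume "U \<subseteq> ?N \<and> V \<subseteq> ?N"
        then have "U <#> V \<subseteq> ?N <#> ?N" using mono_set_mult[of U ?N V ?N G] by blast
        then have "carrier G \<subseteq> ?N" using uv(3) subgroup_mult_id[OF N] by blast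
        then show False using Nproper subgroup.subset[OF N] by blast
      qed
      then show ?thesis using v no_edge[OF uv(1) _ uv(2)] uv(3) by blast
    qed
    then show "\<forall>(u, v)\<in>parcs (factorization_graph G). u \<in> ?A \<and> v \<in> ?B \<or> u \<in> ?B \<and> v \<in> ?A" by blast
  qed
  moreover have "\<not> isolated_vertex (factorization_graph G) H" for H
  proof
    assume "isolated_vertex (factorization_graph G) H"
    then have H: "proper_subgroup H G" "\<not> H \<subseteq> ?F"
      and iso: "\<And>V. (H, V) \<notin> parcs (factorization_graph G)" "\<And>V. (V, H) \<notin> parcs (factorization_graph G)"
      unfolding isolated_vertex_def verts by auto
    have Hs: "subgroup H G" using H unfolding proper_subgroup_def by blast
    show False
    proof (cases "H \<subseteq> ?N")
      case True
      have xH: "x \<in> H" using inside[OF Hs True] XpSF H(2) by blast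
      have "carrier G \<subseteq> ?Y <#> H"
      proof
        fix g assume "g \<in> carrier G"
        then obtain j i :: nat where "g = y [^] j \<otimes> x [^] i" using gen by blast
        then show "g \<in> ?Y <#> H"
          using subgroup_nat_pow_closed[OF Y yY] subgroup_nat_pow_closed[OF Hs xH] unfolding set_mult_def by blast
      qed
      moreover have "?Y <#> H \<subseteq> carrier G" using Y Hs by (simp add: setmult_subset_G subgroup.subset)
      moreover have "proper_subgroup ?Y G" using Y xY x unfolding proper_subgroup_def by blast
      ultimately show False using iso(2) H(1) factorization_graph_adjacent_iff by blast
    next
      case False
      have "proper_subgroup ?X G" using X yX y unfolding proper_subgroup_def by blast
      then show False using outside[OF Hs False] iso(2) H(1) factorization_graph_adjacent_iff by blast
    qed
  qed
  ultimately show ?thesis by blast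
qed

end

section \<open>Evaluation of words\<close>

context group begin

definition word_val :: "('g \<Rightarrow> 'a) \<Rightarrow> 'g gword \<Rightarrow> 'a" where
  "word_val f w = foldr (\<lambda>(g, b) z. (if b then f g else inv (f g)) \<otimes> z) w \<one>"

lemma word_val_Nil [simp]: "word_val f [] = \<one>"
  by (simp add: word_val_def)

lemma word_val_Cons [simp]: "word_val f ((g, b) # w) = (if b then f g else inv (f g)) \<otimes> word_val f w"
  by (simp add: word_val_def)

lemma word_val_closed: "(\<And>g. f g \<in> carrier G) \<Longrightarrow> word_val f w \<in> carrier G"
  by (induction w) auto

lemma word_val_append:
  assumes f: "\<And>g. f g \<in> carrier G"
  shows "word_val f (u @ v) = word_val f u \<otimes> word_val f v"
  by (induction u) (auto simp: f word_val_closed m_assoc)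

lemma word_val_gen_word: "(\<And>g. f g \<in> carrier G) \<Longrightarrow> word_val f (gen_word g) = f g"
  by (simp add: gen_word_def)

lemma word_val_inv_word:
  assumes f: "\<And>g. f g \<in> carrier G"
  shows "word_val f (inv_word w) = inv (word_val f w)"
proof (induction w)
  case Nil
  show ?case by (simp add: inv_word_def)
next
  case (Cons a w)
  obtain g b where a: "a = (g, b)" by fastforce
  have "inv_word (a # w) = inv_word w @ [(g, \<not> b)]" by (simp add: inv_word_def a)
  then show ?case
    using Cons f word_val_closed[of f w] by (auto simp: word_val_append a inv_mult_group)
qed

lemma word_val_pow_word:
  assumes f: "\<And>g. f g \<in> carrier G"
  shows "word_val f (pow_word w k) = word_val f w [^] k"
proof -
  have rep: "word_val f (concat (replicate n v)) = word_val f v [^] n" for n v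
  proof (induction n)
    case (Suc n)
    have "word_val f v \<in> carrier G" using f by (rule word_val_closed)
    then show ?case using Suc nat_pow_Suc2[of "word_val f v" n] by (simp add: word_val_append[OF f])
  qed simp
  have w: "word_val f w \<in> carrier G" using f by (rule word_val_closed)
  show ?thesis
  proof (cases k rule: int_cases)
    case (nonneg n)
    then show ?thesis using rep[of n w] by (simp add: pow_word_def int_pow_int)
  next
    case (neg n)
    have "word_val f (pow_word w k) = inv (word_val f w) [^] Suc n"
      using rep[of "Suc n" "inv_word w"] neg by (simp add: pow_word_def word_val_inv_word[OF f] del: replicate_Suc of_nat_Suc nat_pow_Suc)
    also have "\<dots> = word_val f w [^] k"
      unfolding neg by (simp only: int_pow_neg[OF w] int_pow_int nat_pow_inv[OF w])
    finally show ?thesis .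
  qed
qed

lemma word_val_word_eq:
  assumes f: "\<And>g. f g \<in> carrier G" and R: "\<And>u v. (u, v) \<in> R \<Longrightarrow> word_val f u = word_val f v"
    and eq: "word_eq R u v"
  shows "word_val f u = word_val f v"
  using eq
proof induction
  case (cancel g b)
  show ?case using f by simp
next
  case (append u u' v v')
  then show ?case by (simp add: word_val_append[OF f])
qed (use R in auto)

text \<open>The universal property of a presented group.\<close>

lemma presented_group_hom:
  assumes f: "\<And>g. f g \<in> carrier G" and R: "\<And>u v. (u, v) \<in> R \<Longrightarrow> word_val f u = word_val f v"
  shows "\<exists>h \<in> hom (presented_group R) G. \<forall>w. h (word_class R w) = word_val f w"
proof -
  define h where "h A = word_val f (SOME w. A = word_class R w)" for A
  have h: "h (word_class R w) = word_val f w" for w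
  proof -
    have "word_class R w = word_class R (SOME v. word_class R w = word_class R v)"
      by (rule someI) (rule HOL.refl)
    then have "word_eq R w (SOME v. word_class R w = word_class R v)" by (simp only: word_class_eq_iff)
    then show ?thesis unfolding h_def using word_val_word_eq[OF f R] by metis
  qed
  have "h \<in> hom (presented_group R) G"
  proof (rule homI)
    fix A B assume "A \<in> carrier (presented_group R)" "B \<in> carrier (presented_group R)"
    then obtain u v where uv: "A = word_class R u" "B = word_class R v" by (auto simp: presented_group_def)
    show "h (A \<otimes>\<^bsub>presented_group R\<^esub> B) = h A \<otimes> h B"
      unfolding uv mult_presented_group h by (rule word_val_append[OF f])
  next
    fix A assume "A \<in> carrier (presented_group R)"
    then obtain u where "A = word_class R u" by (auto simp: presented_group_def)
    then show "h A \<in> carrier G" using h word_val_closed[OF f] by simp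
  qed
  then show ?thesis using h by blast
qed

section \<open>The metacyclic presentation\<close>

text \<open>The elements \<open>y\<^sup>j x\<^sup>i\<close> are closed under multiplication because \<open>x\<^sup>i y\<^sup>j = y\<^sup>j x\<^sup>k\<close> with \<open>k = i l\<^sup>j\<close>, and
  inverses of the generators are nonnegative powers of them.\<close>

lemma metacyclic_normal_form:
  assumes x: "x \<in> carrier G" and y: "y \<in> carrier G" and a: "a > 0" and b: "b > 0"
    and xa: "x [^] (a::nat) = \<one>" and yb: "y [^] (b::nat) = \<one>"
    and rel: "inv y \<otimes> x \<otimes> y = x [^] (l::nat)" and gen: "generate G {x, y} = carrier G"
    and g: "g \<in> carrier G"
  shows "\<exists>j<b. \<exists>i<a. g = y [^] j \<otimes> x [^] i"
proof -
  define T where "T = {y [^] j \<otimes> x [^] i | (j::nat) (i::nat). True}"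
  have TI: "y [^] j \<otimes> x [^] i \<in> T" for j i :: nat unfolding T_def by blast
  have powT: "y [^] (j::nat) \<in> T" "x [^] (i::nat) \<in> T" for i j
    using TI[of j 0] TI[of 0 i] x y by simp_all
  have T_mult: "g \<otimes> h \<in> T" if gh: "g \<in> T" "h \<in> T" for g h
  proof -
    obtain j i where ji: "g = y [^] (j::nat) \<otimes> x [^] (i::nat)" using gh(1) unfolding T_def by blast
    obtain j' i' where ji': "h = y [^] (j'::nat) \<otimes> x [^] (i'::nat)" using gh(2) unfolding T_def by blast
    have "x [^] i \<otimes> y [^] j' = y [^] j' \<otimes> (inv (y [^] j') \<otimes> x [^] i \<otimes> y [^] j')"
      using x y by (simp add: m_assoc[symmetric])
    also have "\<dots> = y [^] j' \<otimes> x [^] (i * l ^ j')" using conj_power_power[OF x y rel] by simp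
    finally have c: "x [^] i \<otimes> y [^] j' = y [^] j' \<otimes> x [^] (i * l ^ j')" .
    have "g \<otimes> h = y [^] j \<otimes> (x [^] i \<otimes> y [^] j') \<otimes> x [^] i'"
      unfolding ji ji' using x y by (simp add: m_assoc)
    also have "\<dots> = (y [^] j \<otimes> y [^] j') \<otimes> (x [^] (i * l ^ j') \<otimes> x [^] i')"
      unfolding c using x y by (simp add: m_assoc)
    also have "\<dots> = y [^] (j + j') \<otimes> x [^] (i * l ^ j' + i')" using x y by (simp add: nat_pow_mult)
    finally show ?thesis using TI by simp
  qed
  have inv_pow: "inv z = z [^] (c - 1)" if "z \<in> carrier G" "z [^] c = \<one>" "c > 0" for z and c :: nat
  proof -
    have "z [^] (c - 1) \<otimes> z = \<one>" using that by (simp add: nat_pow_Suc[symmetric] del: nat_pow_Suc)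
    then show ?thesis using that by (intro inv_equality) auto
  qed
  have "g \<in> generate G {x, y}" using g gen by simp
  then have "g \<in> T"
  proof induction
    case one
    show ?case using powT(1)[of 0] by simp
  next
    case (incl h)
    then show ?case using powT(1)[of 1] powT(2)[of 1] x y by auto
  next
    case (inv h)
    then show ?case using inv_pow[OF x xa a] inv_pow[OF y yb b] powT by auto
  next
    case (eng h1 h2)
    then show ?case using T_mult by blast
  qed
  then obtain j i where ji: "g = y [^] (j::nat) \<otimes> x [^] (i::nat)" unfolding T_def by blast
  have "x [^] i = x [^] (i mod a)" "y [^] j = y [^] (j mod b)"
    using nat_pow_cong[OF x xa, of i "i mod a"] nat_pow_cong[OF y yb, of j "j mod b"] by (auto simp: cong_def)
  then show ?thesis using ji a b by (metis mod_less_divisor)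
qed

end

lemma ord_int_eq_ord_nat:
  assumes "N > 0"
  shows "Pocklington.ord (int N) l = Pocklington.ord N (nat (l mod int N))"
proof -
  define k where "k = nat (l mod int N)"
  have k: "int k = l mod int N" unfolding k_def using assms by simp
  have "coprime (int N) l \<longleftrightarrow> coprime N k"
    using assms by (simp add: coprime_int_iff[symmetric] k coprime_mod_right_iff)
  moreover have "[l ^ d = 1] (mod int N) \<longleftrightarrow> [k ^ d = 1] (mod N)" for d
  proof -
    have "[k ^ d = 1] (mod N) \<longleftrightarrow> [int (k ^ d) = int 1] (mod int N)" by (simp only: cong_int_iff)
    also have "\<dots> \<longleftrightarrow> [l ^ d = 1] (mod int N)" unfolding cong_def by (simp add: k power_mod)
    finally show ?thesis by simp
  qed
  ultimately show ?thesis unfolding Pocklington.ord_def k_def[symmetric] by simp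
qed

text \<open>When the generators are mapped to their own classes, every word is evaluated to its class.
  So the presented group is generated by these classes, and they satisfy the relations.\<close>

lemma metacyclic_presentation_generators:
  fixes a b :: nat and l :: int
  defines "H \<equiv> metacyclic_presentation a b l"
  shows "group H" and "\<exists>s t. s \<in> carrier H \<and> t \<in> carrier H \<and> s [^]\<^bsub>H\<^esub> a = \<one>\<^bsub>H\<^esub> \<and> t [^]\<^bsub>H\<^esub> b = \<one>\<^bsub>H\<^esub> \<and>
    inv\<^bsub>H\<^esub> t \<otimes>\<^bsub>H\<^esub> s \<otimes>\<^bsub>H\<^esub> t = s [^]\<^bsub>H\<^esub> l \<and> generate H {s, t} = carrier H"
proof -
  define R where "R = {(pow_word (gen_word Gen_x) (int a), []), (pow_word (gen_word Gen_y) (int b), []),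
         (inv_word (gen_word Gen_y) @ gen_word Gen_x @ gen_word Gen_y, pow_word (gen_word Gen_x) l)}"
  have H: "H = presented_group R"
    unfolding H_def metacyclic_presentation_def R_def Let_def ..
  show G: "group H" unfolding H by (rule group_presented_group)
  interpret H: group H by (rule G)
  have cl: "word_class R w \<in> carrier H" for w unfolding H by (simp add: presented_group_def)
  define f where "f g = word_class R (gen_word g)" for g
  have f: "f g \<in> carrier H" for g unfolding f_def by (rule cl)
  have one: "\<one>\<^bsub>H\<^esub> = word_class R []" unfolding H by (simp add: presented_group_def)
  have inv_f: "inv\<^bsub>H\<^esub> (f g) = word_class R [(g, False)]" for g
  proof (rule H.inv_equality)
    have "word_eq R [(g, False), (g, True)] []" using word_eq.cancel[of R g False] by simp
    then show "word_class R [(g, False)] \<otimes>\<^bsub>H\<^esub> f g = \<one>\<^bsub>H\<^esub>"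
      unfolding f_def one unfolding H mult_presented_group by (simp add: word_class_eq_iff gen_word_def)
  qed (use f cl in auto)
  have val: "H.word_val f w = word_class R w" for w
  proof (induction w)
    case Nil
    show ?case using one by simp
  next
    case (Cons c w)
    obtain g b where c: "c = (g, b)" by fastforce
    have "(if b then f g else inv\<^bsub>H\<^esub> (f g)) = word_class R [(g, b)]"
      using inv_f by (simp add: f_def gen_word_def)
    then have "H.word_val f (c # w) = word_class R [(g, b)] \<otimes>\<^bsub>H\<^esub> word_class R w"
      using Cons unfolding c by (simp only: H.word_val_Cons)
    also have "\<dots> = word_class R ([(g, b)] @ w)" unfolding H by (rule mult_presented_group)
    finally show ?case unfolding c by simp
  qed
  have rel: "H.word_val f u = H.word_val f v" if "(u, v) \<in> R" for u v
    unfolding val word_class_eq_iff using that by (rule word_eq.rel)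
  let ?X = "f Gen_x" and ?Y = "f Gen_y"
  have gw: "H.word_val f (gen_word g) = f g" for g using H.word_val_gen_word[OF f] .
  have "?X [^]\<^bsub>H\<^esub> a = \<one>\<^bsub>H\<^esub>"
    using rel[of "pow_word (gen_word Gen_x) (int a)" "[]"] by (simp add: R_def H.word_val_pow_word[OF f] gw int_pow_int)
  moreover have "?Y [^]\<^bsub>H\<^esub> b = \<one>\<^bsub>H\<^esub>"
    using rel[of "pow_word (gen_word Gen_y) (int b)" "[]"] by (simp add: R_def H.word_val_pow_word[OF f] gw int_pow_int)
  moreover have "inv\<^bsub>H\<^esub> ?Y \<otimes>\<^bsub>H\<^esub> ?X \<otimes>\<^bsub>H\<^esub> ?Y = ?X [^]\<^bsub>H\<^esub> l"
    using rel[of "inv_word (gen_word Gen_y) @ gen_word Gen_x @ gen_word Gen_y" "pow_word (gen_word Gen_x) l"] f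
    by (simp add: R_def H.word_val_pow_word[OF f] H.word_val_append[OF f] H.word_val_inv_word[OF f] gw H.m_assoc)
  moreover have "generate H {?X, ?Y} = carrier H"
  proof
    show "generate H {?X, ?Y} \<subseteq> carrier H" by (rule H.generate_incl) (use f in simp)
    have "H.word_val f w \<in> generate H {?X, ?Y}" for w
    proof (induction w)
      case Nil
      show ?case by (simp add: generate.one)
    next
      case (Cons c w)
      obtain g b where c: "c = (g, b)" by fastforce
      have "f g \<in> {?X, ?Y}" by (cases g) auto
      then have "(if b then f g else inv\<^bsub>H\<^esub> (f g)) \<in> generate H {?X, ?Y}"
        by (auto intro: generate.incl generate.inv)
      then show ?case using Cons unfolding c by (simp add: generate.eng)
    qed
    then show "carrier H \<subseteq> generate H {?X, ?Y}"
      unfolding val by (auto simp: H presented_group_def)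
  qed
  ultimately show "\<exists>s t. s \<in> carrier H \<and> t \<in> carrier H \<and> s [^]\<^bsub>H\<^esub> a = \<one>\<^bsub>H\<^esub> \<and> t [^]\<^bsub>H\<^esub> b = \<one>\<^bsub>H\<^esub> \<and>
    inv\<^bsub>H\<^esub> t \<otimes>\<^bsub>H\<^esub> s \<otimes>\<^bsub>H\<^esub> t = s [^]\<^bsub>H\<^esub> l \<and> generate H {s, t} = carrier H"
    using f by blast
qed

lemma (in group) int_pow_eq_nat_pow_mod:
  assumes x: "x \<in> carrier G" and a: "a > 0" and xa: "x [^] (a::nat) = \<one>"
  shows "x [^] (l::int) = x [^] nat (l mod int a)"
proof -
  have "x [^] l = x [^] (int a * (l div int a)) \<otimes> x [^] (l mod int a)"
    using int_pow_mult[OF x, of "int a * (l div int a)" "l mod int a"] by (simp only: mult_div_mod_eq)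
  also have "x [^] (int a * (l div int a)) = (x [^] int a) [^] (l div int a)" using x by (simp only: int_pow_pow)
  also have "x [^] int a = \<one>" using xa by (simp add: int_pow_int)
  also have "x [^] (l mod int a) = x [^] nat (l mod int a)" using a by (metis int_pow_int nat_0_le of_nat_0_less_iff pos_mod_sign)
  finally show ?thesis using x by simp
qed

context finite_group begin

text \<open>The presented group maps onto \<open>G\<close>, and by the normal form it has at most \<open>a b = |G|\<close> elements.\<close>

lemma iso_metacyclic_presentation:
  assumes x: "x \<in> carrier G" and y: "y \<in> carrier G" and a: "a > 0" and b: "b > 0"
    and xa: "x [^] (a::nat) = \<one>" and yb: "y [^] (b::nat) = \<one>"
    and rel: "inv y \<otimes> x \<otimes> y = x [^] (l::nat)" and gen: "generate G {x, y} = carrier G"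
    and card: "card (carrier G) = a * b"
  shows "G \<cong> metacyclic_presentation a b (int l)"
proof -
  define R where "R = {(pow_word (gen_word Gen_x) (int a), []), (pow_word (gen_word Gen_y) (int b), []),
         (inv_word (gen_word Gen_y) @ gen_word Gen_x @ gen_word Gen_y, pow_word (gen_word Gen_x) (int l))}"
  define H where "H = metacyclic_presentation a b (int l)"
  have H: "H = presented_group R"
    unfolding H_def metacyclic_presentation_def R_def Let_def ..
  interpret H: group H unfolding H by (rule group_presented_group)
  define f where "f g = (case g of Gen_x \<Rightarrow> x | Gen_y \<Rightarrow> y)" for g
  have f: "f g \<in> carrier G" for g using x y by (cases g) (auto simp: f_def)
  have fxy: "f Gen_x = x" "f Gen_y = y" by (simp_all add: f_def)
  have relations: "word_val f u = word_val f v" if "(u, v) \<in> R" for u v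
    using that xa yb rel x y
    by (auto simp: R_def word_val_pow_word[OF f] word_val_append[OF f] word_val_inv_word[OF f]
        word_val_gen_word[OF f] int_pow_int fxy m_assoc)
  have "\<exists>h\<in>hom H G. \<forall>w. h (word_class R w) = word_val f w"
    unfolding H by (rule presented_group_hom[OF f]) (rule relations)
  then obtain h where h: "h \<in> hom H G" "\<forall>w. h (word_class R w) = word_val f w" by (elim bexE)
  interpret h: group_hom H G h by (unfold_locales) (rule h(1))
  have sub: "subgroup (h ` carrier H) G" by (rule h.img_is_subgroup)
  have "f g \<in> h ` carrier H" for g
  proof -
    have "word_class R (gen_word g) \<in> carrier H" unfolding H by (simp add: presented_group_def)
    moreover have "h (word_class R (gen_word g)) = f g" using h(2) word_val_gen_word[OF f] by simp
    ultimately show ?thesis by force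
  qed
  from this[of Gen_x] this[of Gen_y] have "{x, y} \<subseteq> h ` carrier H" unfolding fxy by simp
  from generate_subgroup_incl[OF this sub] have surj: "h ` carrier H = carrier G"
    using gen subgroup.subset[OF sub] by simp
  obtain s t where st: "s \<in> carrier H" "t \<in> carrier H" "s [^]\<^bsub>H\<^esub> a = \<one>\<^bsub>H\<^esub>" "t [^]\<^bsub>H\<^esub> b = \<one>\<^bsub>H\<^esub>"
    "inv\<^bsub>H\<^esub> t \<otimes>\<^bsub>H\<^esub> s \<otimes>\<^bsub>H\<^esub> t = s [^]\<^bsub>H\<^esub> int l" "generate H {s, t} = carrier H"
    using metacyclic_presentation_generators(2)[of a b "int l"] unfolding H_def by blast
  have st': "inv\<^bsub>H\<^esub> t \<otimes>\<^bsub>H\<^esub> s \<otimes>\<^bsub>H\<^esub> t = s [^]\<^bsub>H\<^esub> l" using st(5) by (simp only: int_pow_int)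
  have cover: "carrier H \<subseteq> (\<lambda>(j, i). t [^]\<^bsub>H\<^esub> j \<otimes>\<^bsub>H\<^esub> s [^]\<^bsub>H\<^esub> i) ` ({..<b} \<times> {..<a})"
  proof
    fix A assume "A \<in> carrier H"
    then obtain j i where "j < b" "i < a" "A = t [^]\<^bsub>H\<^esub> j \<otimes>\<^bsub>H\<^esub> s [^]\<^bsub>H\<^esub> i"
      using H.metacyclic_normal_form[OF st(1,2) a b st(3,4) st' st(6)] by blast
    then show "A \<in> (\<lambda>(j, i). t [^]\<^bsub>H\<^esub> j \<otimes>\<^bsub>H\<^esub> s [^]\<^bsub>H\<^esub> i) ` ({..<b} \<times> {..<a})" by force
  qed
  have fin: "finite (carrier H)" using finite_subset[OF cover] by simp
  have "card (carrier H) \<le> card ({..<b} \<times> {..<a})" using cover by (rule surj_card_le[rotated]) simp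
  then have "card (carrier H) \<le> card (h ` carrier H)" using card unfolding surj by (simp add: mult.commute)
  then have "inj_on h (carrier H)" using fin card_image_le[OF fin, of h] by (intro eq_card_imp_inj_on) auto
  then have "h \<in> iso H G" using h(1) surj unfolding iso_def bij_betw_def by blast
  then have "H \<cong> G" unfolding is_iso_def by blast
  then show ?thesis using H.iso_sym unfolding H_def by blast
qed

section \<open>The groups of the classification\<close>

lemma iso_integer_mod_group:
  assumes g: "g \<in> carrier G" and gen: "generate G {g} = carrier G"
  shows "G \<cong> integer_mod_group (card (carrier G))"
proof -
  let ?N = "card (carrier G)"
  let ?Z = "integer_mod_group ?N"
  have N: "?N > 0" using card_subgroup_pos[OF subgroup_self] .
  have gN: "g [^] ?N = \<one>" using pow_card_subgroup[OF subgroup_self g] .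
  interpret Z: group ?Z by simp
  have cZ: "carrier ?Z = {0..<int ?N}" using N by (simp add: carrier_integer_mod_group)
  define h where "h k = g [^] (k::int)" for k
  have md: "g [^] k = g [^] (k mod int ?N)" for k :: int
    using int_pow_eq_nat_pow_mod[OF g N gN, of k] int_pow_eq_nat_pow_mod[OF g N gN, of "k mod int ?N"] by simp
  have "h \<in> hom ?Z G"
  proof (rule homI)
    show "h k \<in> carrier G" for k unfolding h_def using g by simp
    show "h (k \<otimes>\<^bsub>?Z\<^esub> k') = h k \<otimes> h k'" for k k'
      unfolding h_def using md[of "k + k'"] g by (simp add: int_pow_mult)
  qed
  moreover have surj: "h ` carrier ?Z = carrier G"
  proof
    show "h ` carrier ?Z \<subseteq> carrier G" using g by (auto simp: h_def)
    show "carrier G \<subseteq> h ` carrier ?Z"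
    proof
      fix z assume "z \<in> carrier G"
      then obtain k :: int where "z = g [^] k" using gen generate_pow[OF g] by auto
      then have "z = h (k mod int ?N)" using md[of k] by (simp add: h_def)
      moreover have "k mod int ?N \<in> carrier ?Z" unfolding cZ using N by simp
      ultimately show "z \<in> h ` carrier ?Z" by blast
    qed
  qed
  moreover have "inj_on h (carrier ?Z)"
    using surj unfolding cZ by (intro eq_card_imp_inj_on) auto
  ultimately have "h \<in> iso ?Z G" unfolding iso_def bij_betw_def by blast
  then have "?Z \<cong> G" unfolding is_iso_def by blast
  then show ?thesis using Z.iso_sym by blast
qed

text \<open>If \<open>g\<close> generates \<open>G\<close>, then \<open>x = g ^ (q\<^sup>n)\<close> and \<open>y = g ^ (p\<^sup>m)\<close> generate \<open>G\<close> and commute, so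
  the case \<open>l = 1\<close> of the metacyclic one applies.\<close>

lemma cyclic_two_primes_factorization_graph:
  fixes p q m n :: nat
  assumes p: "Factorial_Ring.prime p" and q: "Factorial_Ring.prime q" and pq: "p \<noteq> q"
    and iso: "G \<cong> integer_mod_group (p ^ m * q ^ n)"
  shows "bipartite (factorization_graph G) \<and> (\<nexists>H. isolated_vertex (factorization_graph G) H)"
proof -
  let ?N = "p ^ m * q ^ n"
  have N: "?N > 0" using p q by (simp add: prime_gt_0_nat)
  let ?Z = "integer_mod_group ?N"
  interpret Z: group ?Z by simp
  obtain h where h: "h \<in> iso ?Z G" using iso_sym[OF iso] unfolding is_iso_def by blast
  then have hh: "h \<in> hom ?Z G" and surj: "h ` carrier ?Z = carrier G"
    unfolding iso_def bij_betw_def by auto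
  interpret h: group_hom ?Z G h by (unfold_locales) (rule hh)
  define e where "e = 1 mod int ?N"
  have e: "e \<in> carrier ?Z" unfolding e_def carrier_integer_mod_group using N by simp
  have epow: "e [^]\<^bsub>?Z\<^esub> k = int k mod int ?N" for k :: nat unfolding e_def by (simp add: mod_mult_right_eq)
  define g where "g = h e"
  have g: "g \<in> carrier G" unfolding g_def using e by (rule h.hom_closed)
  have gen: "\<exists>k::nat. z = g [^] k" if z: "z \<in> carrier G" for z
  proof -
    obtain k where k: "k \<in> carrier ?Z" "z = h k" using z surj by blast
    have "k = int (nat k) mod int ?N" using k(1) N by (auto simp: carrier_integer_mod_group split: if_splits)
    then have "k = e [^]\<^bsub>?Z\<^esub> nat k" by (simp only: epow)
    then have "z = g [^] nat k" using k(2) h.hom_nat_pow[OF e, of "nat k"] unfolding g_def by simp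
    then show ?thesis by blast
  qed
  have gN: "g [^] ?N = \<one>"
    using h.hom_nat_pow[OF e, of ?N] h.hom_one unfolding g_def epow by simp
  let ?x = "g [^] (q ^ n)" and ?y = "g [^] (p ^ m)"
  have x: "?x \<in> carrier G" and y: "?y \<in> carrier G" using g by auto
  have gg: "g [^] (i::nat) \<otimes> g [^] (j::nat) = g [^] j \<otimes> g [^] i" for i j
    using g by (rule nat_pow_comm)
  have xm: "?x [^] (p ^ m) = \<one>" and yn: "?y [^] (q ^ n) = \<one>"
    using gN g by (simp_all add: nat_pow_pow mult.commute)
  have rel: "inv ?y \<otimes> ?x \<otimes> ?y = ?x [^] (1::nat)"
    using gg[of "q ^ n" "p ^ m"] x y by (simp add: m_assoc) (simp add: m_assoc[symmetric])
  have sub: "subgroup (generate G {?x, ?y}) G" using x y by (intro generate_is_subgroup) auto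
  have "coprime (q ^ n) (p ^ m)" using p q pq by (simp add: primes_coprime)
  then have "g \<in> generate G {?x, ?y}"
    using mem_of_coprime_powers[OF sub g, of "q ^ n" "p ^ m"] by (auto intro: generate.incl)
  then have genxy: "generate G {?x, ?y} = carrier G"
    using gen subgroup_nat_pow_closed[OF sub] subgroup.subset[OF sub] by fastforce
  show ?thesis
  proof (rule metacyclic_factorization_graph[OF p q pq x y xm yn rel])
    show "?y [^] q \<otimes> ?x = ?x \<otimes> ?y [^] q" using gg g by (simp add: nat_pow_pow)
    show "\<exists>(j::nat) (i::nat). z = ?y [^] j \<otimes> ?x [^] i" if "z \<in> carrier G" for z
      using metacyclic_normal_form[OF x y _ _ xm yn rel genxy that] p q by (auto simp: prime_gt_0_nat)
  qed
qed

lemma metacyclic_presentation_factorization_graph: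
  fixes p q m n :: nat and l :: int
  assumes p: "Factorial_Ring.prime p" and q: "Factorial_Ring.prime q" and pq: "p \<noteq> q"
    and l: "Pocklington.ord (int (p ^ m)) l = q" and iso: "G \<cong> metacyclic_presentation (p ^ m) (q ^ n) l"
  shows "bipartite (factorization_graph G) \<and> (\<nexists>H. isolated_vertex (factorization_graph G) H)"
proof -
  define H where "H = metacyclic_presentation (p ^ m) (q ^ n) l"
  interpret H: group H unfolding H_def by (rule metacyclic_presentation_generators(1))
  obtain s t where st: "s \<in> carrier H" "t \<in> carrier H" "s [^]\<^bsub>H\<^esub> (p ^ m) = \<one>\<^bsub>H\<^esub>" "t [^]\<^bsub>H\<^esub> (q ^ n) = \<one>\<^bsub>H\<^esub>"
    "inv\<^bsub>H\<^esub> t \<otimes>\<^bsub>H\<^esub> s \<otimes>\<^bsub>H\<^esub> t = s [^]\<^bsub>H\<^esub> l" "generate H {s, t} = carrier H"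
    using metacyclic_presentation_generators(2)[of "p ^ m" "q ^ n" l] unfolding H_def by blast
  obtain h where h: "h \<in> iso H G" using iso_sym[OF iso] unfolding is_iso_def H_def by blast
  then have hh: "h \<in> hom H G" and surj: "h ` carrier H = carrier G"
    unfolding iso_def bij_betw_def by auto
  interpret h: group_hom H G h by (unfold_locales) (rule hh)
  have pm: "p ^ m > 0" and qn: "q ^ n > 0" using p q by (auto simp: prime_gt_0_nat)
  define k where "k = nat (l mod int (p ^ m))"
  have stk: "inv\<^bsub>H\<^esub> t \<otimes>\<^bsub>H\<^esub> s \<otimes>\<^bsub>H\<^esub> t = s [^]\<^bsub>H\<^esub> k"
    unfolding k_def using H.int_pow_eq_nat_pow_mod[OF st(1) pm st(3)] st(5) by simp
  have "Pocklington.ord (p ^ m) k = q" using l ord_int_eq_ord_nat[OF pm] unfolding k_def by simp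
  then have kq: "[k ^ q = 1] (mod p ^ m)" unfolding ord_divides by simp
  let ?x = "h s" and ?y = "h t"
  have x: "?x \<in> carrier G" and y: "?y \<in> carrier G" using st(1,2) by auto
  have xm: "?x [^] (p ^ m) = \<one>" and yn: "?y [^] (q ^ n) = \<one>"
    using h.hom_nat_pow[OF st(1), of "p ^ m"] h.hom_nat_pow[OF st(2), of "q ^ n"] st(3,4) by simp_all
  have rel: "inv ?y \<otimes> ?x \<otimes> ?y = ?x [^] k"
    using arg_cong[OF stk, of h] st(1,2) by (simp add: h.hom_nat_pow)
  show ?thesis
  proof (rule metacyclic_factorization_graph[OF p q pq x y xm yn rel])
    have "inv (?y [^] q) \<otimes> ?x \<otimes> ?y [^] q = ?x"
      using conj_power_power[OF x y rel, of q 1] nat_pow_cong[OF x xm kq] x by simp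
    then show "?y [^] q \<otimes> ?x = ?x \<otimes> ?y [^] q"
      using x y by (metis inv_closed inv_solve_left m_assoc m_closed nat_pow_closed)
    show "\<exists>(j::nat) (i::nat). z = ?y [^] j \<otimes> ?x [^] i" if z: "z \<in> carrier G" for z
    proof -
      obtain A where A: "A \<in> carrier H" "z = h A" using z surj by blast
      obtain j i :: nat where "A = t [^]\<^bsub>H\<^esub> j \<otimes>\<^bsub>H\<^esub> s [^]\<^bsub>H\<^esub> i"
        using H.metacyclic_normal_form[OF st(1,2) pm qn st(3,4) stk st(6) A(1)] by blast
      then have "z = ?y [^] j \<otimes> ?x [^] i" using A st(1,2) by (simp add: h.hom_nat_pow)
      then show ?thesis by blast
    qed
  qed
qed

end

section \<open>The classification\<close>

lemma two_prime_powers: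
  fixes N :: nat
  assumes N: "N > 0"
    and two: "\<And>r s t. Factorial_Ring.prime r \<Longrightarrow> Factorial_Ring.prime s \<Longrightarrow> Factorial_Ring.prime t \<Longrightarrow>
      r dvd N \<Longrightarrow> s dvd N \<Longrightarrow> t dvd N \<Longrightarrow> r = s \<or> r = t \<or> s = t"
  shows "\<exists>p q m n. Factorial_Ring.prime p \<and> Factorial_Ring.prime q \<and> p \<noteq> q \<and> N = p ^ m * q ^ n"
proof -
  have split: "\<exists>p m K. Factorial_Ring.prime p \<and> M = p ^ m * K \<and> \<not> p dvd K \<and> K > 0 \<and> p dvd M" if M: "M > 1" for M :: nat
  proof -
    obtain p where p: "Factorial_Ring.prime p" "p dvd M" using M prime_factor_nat[of M] by auto
    obtain K where "M = p ^ multiplicity p M * K" "\<not> p dvd K"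
      using multiplicity_decompose'[of M p] M p prime_gt_1_nat[OF p(1)] by auto
    then show ?thesis using p M by (metis gr0I mult_0_right not_one_less_zero)
  qed
  have two_three: "Factorial_Ring.prime (2::nat)" "Factorial_Ring.prime (3::nat)" "(2::nat) \<noteq> 3" by auto
  show ?thesis
  proof (cases "N = 1")
    case True
    then have "N = 2 ^ 0 * 3 ^ 0" by simp
    then show ?thesis using two_three by blast
  next
    case False
    then obtain p m K where p: "Factorial_Ring.prime p" "N = p ^ m * K" "\<not> p dvd K" "K > 0" "p dvd N"
      using split[of N] N by auto
    show ?thesis
    proof (cases "K = 1")
      case True
      obtain q :: nat where "Factorial_Ring.prime q" "q \<noteq> p" using two_three by metis
      moreover have "N = p ^ m * q ^ 0" using p True by simp
      ultimately show ?thesis using p(1) by blast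
    next
      case False
      then obtain q n J where q: "Factorial_Ring.prime q" "K = q ^ n * J" "\<not> q dvd J" "J > 0" "q dvd K"
        using split[of K] p by auto
      have "q \<noteq> p" using p q by blast
      have "J = 1"
      proof (rule ccontr)
        assume "J \<noteq> 1"
        then obtain t where t: "Factorial_Ring.prime t" "t dvd J" using prime_factor_nat by blast
        have "t dvd K" using t q by simp
        then have "t dvd N" "q dvd N" using p q by auto
        moreover have "t \<noteq> q" "t \<noteq> p" using t q p \<open>t dvd K\<close> by auto
        ultimately show False using two[OF p(1) q(1) t(1) p(5)] \<open>q \<noteq> p\<close> by auto
      qed
      then have "N = p ^ m * q ^ n" using p q by simp
      then show ?thesis using p q \<open>q \<noteq> p\<close> by blast
    qed
  qed
qed

context supplemented_triangle_free_group begin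

text \<open>For three different prime divisors of \<open>|G|\<close>, the subgroups \<open>\<langle>g\<^sup>r\<rangle>\<close>, \<open>\<langle>g\<^sup>s\<rangle>\<close> and \<open>\<langle>g\<^sup>t\<rangle>\<close> have pairwise
  coprime indices and would form a triangle.\<close>

lemma cyclic_prime_divisors:
  assumes g: "g \<in> carrier G" and gen: "generate G {g} = carrier G"
    and r: "Factorial_Ring.prime r" "r dvd card (carrier G)" and s: "Factorial_Ring.prime s" "s dvd card (carrier G)"
    and t: "Factorial_Ring.prime t" "t dvd card (carrier G)"
  shows "r = s \<or> r = t \<or> s = t"
proof (rule ccontr)
  assume ne: "\<not> ?thesis"
  let ?A = "\<lambda>u. generate G {g [^] (u::nat)}"
  have og: "ord g = card (carrier G)" using generate_pow_card[OF g] gen by simp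
  have A: "subgroup (?A u) G" for u using g by (intro generate_is_subgroup) auto
  have cA: "card (carrier G) = u * card (?A u)" if u: "Factorial_Ring.prime u" "u dvd card (carrier G)" for u
  proof -
    have "gcd (ord g) u = u" using u og by (simp add: gcd_nat.absorb2)
    then have "ord (g [^] u) = card (carrier G) div u" using ord_pow_gen[OF g, of u] og u by (auto simp: prime_gt_0_nat)
    then show ?thesis using generate_pow_card[of "g [^] u"] g u by simp
  qed
  have pA: "proper_subgroup (?A u) G" if u: "Factorial_Ring.prime u" "u dvd card (carrier G)" for u
  proof -
    have "?A u \<noteq> carrier G"
    proof
      assume "?A u = carrier G"
      then have "card (carrier G) = u * card (carrier G)" using cA[OF u] by simp
      then show False using u prime_gt_1_nat card_subgroup_pos[OF subgroup_self] by fastforce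
    qed
    then show ?thesis using A unfolding proper_subgroup_def by blast
  qed
  have adj: "carrier G = ?A u <#> ?A v"
    if "Factorial_Ring.prime u" "u dvd card (carrier G)" "Factorial_Ring.prime v" "v dvd card (carrier G)" "u \<noteq> v" for u v
    using coprime_index_factorization[OF A A that(1,3,5) cA[OF that(1,2)] cA[OF that(3,4)]] .
  show False
    using no_triangle[OF pA[OF r] pA[OF s] pA[OF t] adj[OF r s] adj[OF r t]] adj[OF s t] ne by blast
qed

end

lemma (in finite_group) bipartite_no_isolated_imp_supplemented:
  assumes "bipartite (factorization_graph G)" and "\<nexists>H. isolated_vertex (factorization_graph G) H"
  shows "supplemented_triangle_free_group G"
proof
  fix H assume H: "proper_subgroup H G" "\<not> H \<subseteq> frattini G"
  then have "H \<in> pverts (factorization_graph G)" unfolding factorization_graph_def by simp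
  then obtain V where "(H, V) \<in> parcs (factorization_graph G) \<or> (V, H) \<in> parcs (factorization_graph G)"
    using assms(2) unfolding isolated_vertex_def by blast
  then show "\<exists>V. proper_subgroup V G \<and> carrier G = H <#> V"
    using factorization_graph_adjacent_iff factorization_commute unfolding proper_subgroup_def by metis
next
  fix A B C assume ABC: "proper_subgroup A G" "proper_subgroup B G" "proper_subgroup C G"
    "carrier G = A <#> B" "carrier G = A <#> C"
  show "carrier G \<noteq> B <#> C"
  proof
    assume "carrier G = B <#> C"
    then have e: "(A, B) \<in> parcs (factorization_graph G)" "(A, C) \<in> parcs (factorization_graph G)"
      "(B, C) \<in> parcs (factorization_graph G)"
      using ABC factorization_graph_adjacent_iff by blast+
    obtain P Q where PQ: "P \<inter> Q = {}"
      and edge: "\<forall>(u, v)\<in>parcs (factorization_graph G). u \<in> P \<and> v \<in> Q \<or> u \<in> Q \<and> v \<in> P"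
      using assms(1) unfolding bipartite_def by (elim exE conjE) simp
    show False using bspec[OF edge e(1)] bspec[OF edge e(2)] bspec[OF edge e(3)] PQ by auto
  qed
qed

context supplemented_triangle_free_group begin

text \<open>An element outside all maximal subgroups generates \<open>G\<close>.\<close>

lemma cyclic_classification:
  assumes g: "g \<in> carrier G" and avoids: "\<And>T. maximal_subgroup T G \<Longrightarrow> g \<notin> T"
  shows "\<exists>p q m n. Factorial_Ring.prime p \<and> Factorial_Ring.prime q \<and> p \<noteq> q \<and>
    G \<cong> integer_mod_group (p ^ m * q ^ n)"
proof -
  have gen: "generate G {g} = carrier G"
  proof (rule subgroup_eq_carrierI)
    show "subgroup (generate G {g}) G" using g by (intro generate_is_subgroup) auto
    show "\<not> generate G {g} \<subseteq> T" if "maximal_subgroup T G" for T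
      using avoids[OF that] generate.incl[of g "{g}" G] by blast
  qed
  obtain p q m n where pq: "Factorial_Ring.prime p" "Factorial_Ring.prime q" "p \<noteq> q"
    and card: "card (carrier G) = p ^ m * q ^ n"
    using two_prime_powers[OF card_subgroup_pos[OF subgroup_self]] cyclic_prime_divisors[OF g gen] by metis
  have "G \<cong> integer_mod_group (p ^ m * q ^ n)"
    using iso_integer_mod_group[OF g gen] unfolding card .
  then show ?thesis using pq by blast
qed

text \<open>A commutative group has only normal subgroups, so the non-normal subgroup found in
  \<open>noncyclic_frattini_index\<close> provides the noncommuting elements required for the lift. They also
  exclude \<open>l \<equiv> 1\<close>, which leaves \<open>q\<close> as the multiplicative order of \<open>l\<close>.\<close>

lemma noncyclic_classification:
  assumes noncyclic: "\<And>g. g \<in> carrier G \<Longrightarrow> \<exists>T. maximal_subgroup T G \<and> g \<in> T"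
  shows "\<exists>p q m n l. Factorial_Ring.prime p \<and> Factorial_Ring.prime q \<and> p \<noteq> q \<and> m \<ge> 1 \<and> n \<ge> 1 \<and>
    Pocklington.ord (int (p ^ m)) l = q \<and> G \<cong> metacyclic_presentation (p ^ m) (q ^ n) l"
proof -
  obtain p q M L where pq: "Factorial_Ring.prime p" "Factorial_Ring.prime q" "p \<noteq> q"
    and M: "maximal_subgroup M G" "M \<lhd> G" "card (carrier G) = q * card M" "card M = p * card (frattini G)"
    and L: "subgroup L G" "\<not> L \<lhd> G"
    using noncyclic_frattini_index[OF noncyclic] by blast
  have "\<exists>a\<in>carrier G. \<exists>b\<in>carrier G. a \<otimes> b \<noteq> b \<otimes> a"
  proof (rule ccontr)
    assume comm: "\<not> ?thesis"
    have "a \<otimes> b \<otimes> inv a \<in> L" if a: "a \<in> carrier G" and b: "b \<in> L" for a b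
    proof -
      have bc: "b \<in> carrier G" using b L(1) by (meson subgroup.mem_carrier)
      have "a \<otimes> b = b \<otimes> a" using comm a bc by blast
      then have "a \<otimes> b \<otimes> inv a = b" using a bc by (simp add: m_assoc)
      then show ?thesis using b by simp
    qed
    then show False using L unfolding normal_inv_iff by blast
  qed
  then obtain a b where "a \<in> carrier G" "b \<in> carrier G" "a \<otimes> b \<noteq> b \<otimes> a" by blast
  from metacyclic_lift[OF pq M this]
  obtain x y m n l where x: "x \<in> carrier G" "y \<in> carrier G" "m \<ge> 1" "n \<ge> 1" "x [^] (p ^ m) = \<one>"
    "y [^] (q ^ n) = \<one>" "inv y \<otimes> x \<otimes> y = x [^] (l::nat)" "generate G {x, y} = carrier G"
    "card (carrier G) = p ^ m * q ^ n" and l: "[l ^ q = 1] (mod p ^ m)" "\<not> [l = 1] (mod p ^ m)"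
    by blast
  have "G \<cong> metacyclic_presentation (p ^ m) (q ^ n) (int l)"
    using iso_metacyclic_presentation[OF x(1,2) _ _ x(5-9)] pq by (simp add: prime_gt_0_nat)
  moreover have "Pocklington.ord (int (p ^ m)) (int l) = q"
  proof -
    have "p ^ m > 0" using pq(1) by (simp add: prime_gt_0_nat)
    then have "Pocklington.ord (int (p ^ m)) (int l) = Pocklington.ord (p ^ m) l"
      using ord_int_eq_ord_nat[of "p ^ m" "int l"] by (simp only: zmod_int[symmetric] nat_int ord_mod)
    moreover have "Pocklington.ord (p ^ m) l dvd q" using l(1) unfolding ord_divides .
    moreover have "Pocklington.ord (p ^ m) l \<noteq> 1" using l(2) ord_divides[of l 1 "p ^ m"] by auto
    ultimately show ?thesis using pq(2) by (metis prime_nat_iff)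
  qed
  ultimately show ?thesis using pq x(3,4) by blast
qed

end

theorem theorem2p4:
  fixes G :: "('a, 'b) monoid_scheme"
  assumes "group G" and "finite (carrier G)"
  shows "bipartite (factorization_graph G) \<and> (\<nexists>H. isolated_vertex (factorization_graph G) H)
    \<longleftrightarrow>
      (\<exists>(p::nat) (q::nat) (m::nat) (n::nat).
          Factorial_Ring.prime p \<and> Factorial_Ring.prime q \<and> p \<noteq> q \<and>
          (G \<cong> integer_mod_group (p ^ m) \<or> G \<cong> integer_mod_group (p ^ m * q ^ n))) \<or>
      (\<exists>(p::nat) (q::nat) (m::nat) (n::nat) (l::int).
          Factorial_Ring.prime p \<and> Factorial_Ring.prime q \<and> p \<noteq> q \<and> m \<ge> 1 \<and> n \<ge> 1 \<and>
          Pocklington.ord (int (p ^ m)) l = q \<and>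
          G \<cong> metacyclic_presentation (p ^ m) (q ^ n) l)"
    (is "?graph \<longleftrightarrow> ?cyclic \<or> ?metacyclic")
proof
  interpret finite_group G using assms by (simp add: finite_group_def finite_group_axioms_def)
  assume ?graph
  then interpret supplemented_triangle_free_group G
    using bipartite_no_isolated_imp_supplemented by blast
  show "?cyclic \<or> ?metacyclic"
  proof (cases "\<exists>g\<in>carrier G. \<forall>T. maximal_subgroup T G \<longrightarrow> g \<notin> T")
    case True
    then have ?cyclic using cyclic_classification by blast
    then show ?thesis ..
  next
    case False
    then have ?metacyclic using noncyclic_classification by blast
    then show ?thesis ..
  qed
next
  interpret finite_group G using assms by (simp add: finite_group_def finite_group_axioms_def)
  assume "?cyclic \<or> ?metacyclic"
  then show ?graph
  proof
    assume ?cyclic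
    then obtain p q m n where pq: "Factorial_Ring.prime p" "Factorial_Ring.prime q" "p \<noteq> q"
      and "G \<cong> integer_mod_group (p ^ m) \<or> G \<cong> integer_mod_group (p ^ m * q ^ n)"
      by blast
    then have "G \<cong> integer_mod_group (p ^ m * q ^ 0) \<or> G \<cong> integer_mod_group (p ^ m * q ^ n)" by simp
    then show ?graph using cyclic_two_primes_factorization_graph[OF pq] by blast
  next
    assume ?metacyclic
    then obtain p q m n l where pq: "Factorial_Ring.prime p" "Factorial_Ring.prime q" "p \<noteq> q"
      and "Pocklington.ord (int (p ^ m)) l = q" "G \<cong> metacyclic_presentation (p ^ m) (q ^ n) l"
      by blast
    then show ?graph using metacyclic_presentation_factorization_graph by blast
  qed
qed

end
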